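(* Let $X\subset\mathcal A^{\mathbb Z}$ be an aperiodic subshift over a finite alphabet $\mathcal A$, let $T=\sigma|_X$ be the shift map on $X$, and let $k\in\mathbb N$ be such that $\liminf_{n\to\infty}\frac{p_X(n)}{n}\leq k$. Then $$\mathrm{Mult}(T)\leq 2k\quad\text{and}\quad \sum_{\mu}\mathrm{Mult}(\mu)\leq 2k,$$ where the sum runs over all ergodic $T$-invariant Borel probability measures $\mu$ on $X$.
   Context: A subshift is a nonempty closed subset $X\subset\mathcal A^{\mathbb Z}$ invariant under the shift $\sigma$, $(\sigma x)_n=x_{n+1}$ (so $\sigma(X)=X$). Aperiodic means that $X$ contains no $\sigma$-periodic point. $p_X(n)$ is the number of words of length $n$ of the form $x_jx_{j+1}\cdots x_{j+n-1}$ with $x\in X$, $j\in\mathbb Z$. For an invertible bounded linear operator $U$ on a normed space $E$, its multiplicity $\mathrm{Mult}(U)\in\mathbb N\cup\{\infty\}$ is the smallest cardinality of a set $F\subset E$ such that the linear span of $\{U^n x: x\in F,\ n\in\mathbb Z\}$ is dense in $E$ (it is $0$ if $E=\{0\}$ and $\infty$ if no finite such $F$ exists). $\mathrm{Mult}(T)$ (topological multiplicity) is the multiplicity of $\phi\mapsto\phi\circ T$ on the Banach space $C(X)$ of real continuous functions with the supremum norm. For an ergodic $T$-invariant probability measure $\mu$, $\mathrm{Mult}(\mu)$ (ergodic multiplicity) is the multiplicity of $\phi\mapsto\phi\circ T$ on $L^2_0(\mu)=\{f\in L^2(\mu):\int f\,d\mu=0\}$. *)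

theory Defs
  imports "HOL-Probability.Probability" "HOL-Library.Function_Algebras"
begin

section \<open>Subshifts\<close>

text \<open>The alphabet is a finite set \<open>A\<close> in a type with the discrete topology; the type
  \<open>int \<Rightarrow> 'a\<close> carries the product topology, in which the full shift_map \<open>UNIV \<rightarrow> A\<close> is
  closed. So a subset of the full shift_map is closed in it iff it is \<open>closed\<close>.\<close>

definition shift_map :: "(int \<Rightarrow> 'a) \<Rightarrow> (int \<Rightarrow> 'a)" where
  "shift_map x = (\<lambda>n. x (n + 1))"

definition subshift :: "'a::discrete_topology set \<Rightarrow> (int \<Rightarrow> 'a) set \<Rightarrow> bool" where
  "subshift A X \<longleftrightarrow> X \<noteq> {} \<and> X \<subseteq> UNIV \<rightarrow> A \<and> closed X \<and> shift_map ` X = X"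

definition aperiodic :: "(int \<Rightarrow> 'a) set \<Rightarrow> bool" where
  "aperiodic X \<longleftrightarrow> \<not> (\<exists>x\<in>X. \<exists>n>0. (shift_map ^^ n) x = x)"

definition word_complexity :: "(int \<Rightarrow> 'a) set \<Rightarrow> nat \<Rightarrow> nat" where
  "word_complexity X n = card {map (\<lambda>i. x (j + int i)) [0..<n] | x j. x \<in> X}"


section \<open>Multiplicity of an invertible operator\<close>

instantiation "fun" :: (type, real_vector) real_vector
begin

definition "scaleR c f = (\<lambda>x. c *\<^sub>R f x)"

instance
  by standard (simp_all add: scaleR_fun_def fun_eq_iff algebra_simps)

end

definition int_pow_on :: "'v set \<Rightarrow> ('v \<Rightarrow> 'v) \<Rightarrow> int \<Rightarrow> 'v \<Rightarrow> 'v" where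
  "int_pow_on E U n = (if 0 \<le> n then U ^^ nat n else inv_into E U ^^ nat (- n))"

text \<open>A (semi)normed space is given by a linear subspace \<open>E\<close> of a real vector space and a
  (semi)norm \<open>N\<close> on \<open>E\<close>; \<open>U\<close> is a linear bijection of \<open>E\<close>. If \<open>N\<close> is only
  a seminorm, \<open>E\<close> stands for the normed space obtained by identifying vectors at distance 0.
  The infimum of the empty set in \<^typ>\<open>enat\<close> is \<open>\<infinity>\<close>.\<close>

definition dense_in_seminorm :: "'v::real_vector set \<Rightarrow> ('v \<Rightarrow> real) \<Rightarrow> 'v set \<Rightarrow> bool" where
  "dense_in_seminorm E N D \<longleftrightarrow> D \<subseteq> E \<and> (\<forall>f\<in>E. \<forall>e>0. \<exists>g\<in>D. N (f - g) < e)"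

definition multiplicity_op :: "'v::real_vector set \<Rightarrow> ('v \<Rightarrow> real) \<Rightarrow> ('v \<Rightarrow> 'v) \<Rightarrow> enat" where
  "multiplicity_op E N U =
    (INF F \<in> {F. finite F \<and> F \<subseteq> E \<and>
                dense_in_seminorm E N (span {int_pow_on E U n x | n x. x \<in> F})}. enat (card F))"

definition koopman :: "((int \<Rightarrow> 'a) \<Rightarrow> real) \<Rightarrow> ((int \<Rightarrow> 'a) \<Rightarrow> real)" where
  "koopman f = f \<circ> shift_map"


section \<open>Topological multiplicity\<close>

text \<open>A continuous function on \<open>X\<close> is represented by its extension by 0 to the whole type.\<close>

definition C_space :: "(int \<Rightarrow> 'a::topological_space) set \<Rightarrow> ((int \<Rightarrow> 'a) \<Rightarrow> real) set" where
  "C_space X = {f. continuous_on X f \<and> (\<forall>x. x \<notin> X \<longrightarrow> f x = 0)}"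

definition sup_norm_on :: "'x set \<Rightarrow> ('x \<Rightarrow> real) \<Rightarrow> real" where
  "sup_norm_on X f = (SUP x\<in>X. \<bar>f x\<bar>)"

definition top_mult :: "(int \<Rightarrow> 'a::topological_space) set \<Rightarrow> enat" where
  "top_mult X = multiplicity_op (C_space X) (sup_norm_on X) koopman"


section \<open>Ergodic multiplicity\<close>

definition ergodic_measures :: "(int \<Rightarrow> 'a::topological_space) set \<Rightarrow> (int \<Rightarrow> 'a) measure set" where
  "ergodic_measures X = {\<mu>. prob_space \<mu> \<and> sets \<mu> = sets (restrict_space borel X) \<and>
     distr \<mu> \<mu> shift_map = \<mu> \<and>
     (\<forall>B\<in>sets \<mu>. shift_map -` B \<inter> space \<mu> = B \<longrightarrow> measure \<mu> B = 0 \<or> measure \<mu> B = 1)}"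

text \<open>Representatives of the elements of \<open>L\<^sup>2\<^sub>0(\<mu>)\<close>: the seminorm \<open>L2_norm \<mu>\<close> vanishes
  exactly on the functions that are 0 almost everywhere. On a probability space square
  integrability implies integrability.\<close>

definition L20_space :: "'x measure \<Rightarrow> ('x \<Rightarrow> real) set" where
  "L20_space \<mu> = {f \<in> borel_measurable \<mu>. integrable \<mu> (\<lambda>x. (f x)\<^sup>2) \<and> (\<integral>x. f x \<partial>\<mu>) = 0}"

definition L2_norm :: "'x measure \<Rightarrow> ('x \<Rightarrow> real) \<Rightarrow> real" where
  "L2_norm \<mu> f = sqrt (\<integral>x. (f x)\<^sup>2 \<partial>\<mu>)"

definition ergodic_mult :: "(int \<Rightarrow> 'a) measure \<Rightarrow> enat" where
  "ergodic_mult \<mu> = multiplicity_op (L20_space \<mu>) (L2_norm \<mu>) koopman"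


section \<open>Well-definedness\<close>

lemma bij_shift: "bij (shift_map :: (int \<Rightarrow> 'a) \<Rightarrow> _)"
  by (rule o_bij[where g = "\<lambda>x n. x (n - 1)"]) (auto simp: shift_map_def fun_eq_iff)

lemma inv_shift_shift: "inv shift_map (shift_map x) = x"
  by (rule inv_f_f[OF bij_is_inj[OF bij_shift]])

lemma shift_inv_shift: "shift_map (inv shift_map x) = x"
  by (rule surj_f_inv_f[OF bij_is_surj[OF bij_shift]])

lemma bij_koopman: "bij (koopman :: ((int \<Rightarrow> 'a) \<Rightarrow> real) \<Rightarrow> _)"
proof (rule o_bij[where g = "\<lambda>f. f \<circ> inv shift_map"])
  show "(\<lambda>f::(int \<Rightarrow> 'a) \<Rightarrow> real. f \<circ> inv shift_map) \<circ> koopman = id"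
    by (simp add: koopman_def fun_eq_iff shift_inv_shift)
  show "koopman \<circ> (\<lambda>f::(int \<Rightarrow> 'a) \<Rightarrow> real. f \<circ> inv shift_map) = id"
    by (simp add: koopman_def fun_eq_iff inv_shift_shift)
qed

lemma continuous_on_shift:
  "continuous_on S (shift_map :: (int \<Rightarrow> 'a::topological_space) \<Rightarrow> _)"
  unfolding shift_map_def
  by (intro continuous_on_coordinatewise_then_product continuous_on_product_coordinates
        continuous_on_subset[OF _ subset_UNIV])

lemma inv_shift: "inv shift_map = (\<lambda>x n. x (n - 1))"
  by (rule inv_unique_comp) (auto simp: shift_map_def fun_eq_iff)

lemma continuous_on_inv_shift:
  "continuous_on S (inv shift_map :: (int \<Rightarrow> 'a::topological_space) \<Rightarrow> _)"
  unfolding inv_shift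
  by (intro continuous_on_coordinatewise_then_product continuous_on_product_coordinates
        continuous_on_subset[OF _ subset_UNIV])

lemma shift_mem_iff: "shift_map ` X = X \<Longrightarrow> shift_map x \<in> X \<longleftrightarrow> x \<in> X"
  by (metis bij_is_inj bij_shift inj_image_mem_iff)

lemma unshift_mem_iff: "shift_map ` X = X \<Longrightarrow> inv shift_map x \<in> X \<longleftrightarrow> x \<in> X"
  by (metis bij_inv_eq_iff bij_shift shift_mem_iff)

lemma koopman_bij_betw_C_space:
  fixes X :: "(int \<Rightarrow> 'a::topological_space) set"
  assumes X: "shift_map ` X = X"
  shows "bij_betw koopman (C_space X) (C_space X)"
  unfolding bij_betw_def
proof
  show "inj_on koopman (C_space X)"
    using bij_koopman by (metis bij_betw_def inj_on_subset subset_UNIV)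
  show "koopman ` C_space X = C_space X"
  proof
    show "koopman ` C_space X \<subseteq> C_space X"
      using X by (auto simp: C_space_def koopman_def shift_mem_iff
          intro!: continuous_on_compose continuous_on_shift)
    show "C_space X \<subseteq> koopman ` C_space X"
    proof
      fix f assume f: "f \<in> C_space X"
      have im: "inv shift_map ` X = X"
        by (metis X bij_is_inj bij_shift image_inv_f_f)
      have "f \<circ> inv shift_map \<in> C_space X"
        using f X im continuous_on_compose[of X "inv shift_map" f] continuous_on_inv_shift[of X]
        by (auto simp: C_space_def unshift_mem_iff)
      moreover have "koopman (f \<circ> inv shift_map) = f"
        by (simp add: koopman_def fun_eq_iff inv_shift_shift)
      ultimately show "f \<in> koopman ` C_space X" by (metis imageI)
    qed
  qed
qed

lemma koopman_bij_betw_L20_space: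
  fixes X :: "(int \<Rightarrow> 'a::topological_space) set"
  assumes X: "shift_map ` X = X" and \<mu>: "\<mu> \<in> ergodic_measures X"
  shows "bij_betw koopman (L20_space \<mu>) (L20_space \<mu>)"
    and "f \<in> L20_space \<mu> \<Longrightarrow> L2_norm \<mu> (koopman f) = L2_norm \<mu> f"
proof -
  have sets: "sets \<mu> = sets (restrict_space borel X)"
    and inv: "distr \<mu> \<mu> shift_map = \<mu>"
    using \<mu> by (auto simp: ergodic_measures_def)
  have meas: "g \<in> measurable \<mu> \<mu>"
    if "continuous_on UNIV g" "\<And>x. x \<in> X \<Longrightarrow> g x \<in> X" for g :: "(int \<Rightarrow> 'a) \<Rightarrow> _"
  proof -
    have "g \<in> measurable (restrict_space borel X) (restrict_space borel X)"
      using that borel_measurable_continuous_onI[OF that(1)]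
      by (intro measurable_restrict_space3) auto
    then show ?thesis by (subst measurable_cong_sets[OF sets sets])
  qed
  have m1: "shift_map \<in> measurable \<mu> \<mu>"
    using X by (intro meas continuous_on_shift) (simp add: shift_mem_iff)
  have m2: "inv shift_map \<in> measurable \<mu> \<mu>"
    using X by (intro meas) (simp_all add: unshift_mem_iff continuous_on_inv_shift)
  have "distr \<mu> \<mu> (inv shift_map) = distr (distr \<mu> \<mu> shift_map) \<mu> (inv shift_map)"
    by (simp add: inv)
  also have "\<dots> = distr \<mu> \<mu> (\<lambda>x. x)"
    using m1 m2 by (subst distr_distr) (auto simp: comp_def inv_shift_shift)
  finally have inv2: "distr \<mu> \<mu> (inv shift_map) = \<mu>" by simp
  have L: "f \<circ> g \<in> L20_space \<mu> \<and> L2_norm \<mu> (f \<circ> g) = L2_norm \<mu> f"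
    if f: "f \<in> L20_space \<mu>" and g: "g \<in> measurable \<mu> \<mu>" "distr \<mu> \<mu> g = \<mu>" for f g
  proof -
    have fm: "f \<in> borel_measurable \<mu>" and fi: "integrable \<mu> (\<lambda>x. (f x)\<^sup>2)"
      and f0: "(\<integral>x. f x \<partial>\<mu>) = 0"
      using f by (auto simp: L20_space_def)
    have f2: "(\<lambda>x. (f x)\<^sup>2) \<in> borel_measurable \<mu>" using fm by simp
    show ?thesis
      using integral_distr[OF g(1) fm] integral_distr[OF g(1) f2]
        integrable_distr_eq[OF g(1) f2] fi f0 measurable_comp[OF g(1) fm]
      by (simp add: g(2) L20_space_def L2_norm_def comp_def)
  qed
  show "f \<in> L20_space \<mu> \<Longrightarrow> L2_norm \<mu> (koopman f) = L2_norm \<mu> f"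
    using L m1 inv by (simp add: koopman_def)
  show "bij_betw koopman (L20_space \<mu>) (L20_space \<mu>)"
    unfolding bij_betw_def
  proof
    show "inj_on koopman (L20_space \<mu>)"
      using bij_koopman by (metis bij_betw_def inj_on_subset subset_UNIV)
    show "koopman ` L20_space \<mu> = L20_space \<mu>"
    proof
      show "koopman ` L20_space \<mu> \<subseteq> L20_space \<mu>"
        using L m1 inv by (auto simp: koopman_def)
      show "L20_space \<mu> \<subseteq> koopman ` L20_space \<mu>"
      proof
        fix f assume f: "f \<in> L20_space \<mu>"
        have "koopman (f \<circ> inv shift_map) = f"
          by (simp add: koopman_def fun_eq_iff inv_shift_shift)
        then show "f \<in> koopman ` L20_space \<mu>"
          using L[OF f m2 inv2] by (metis imageI)
      qed
    qed
  qed
qed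

lemma infsum_enat_eq_SUP:
  fixes f :: "'b \<Rightarrow> enat"
  shows "(\<Sum>\<^sub>\<infinity>x\<in>S. f x) = (SUP F\<in>{F. finite F \<and> F \<subseteq> S}. sum f F)"
  by (rule nonneg_infsum_complete) simp

end

theory Submission
  imports Defs "Jordan_Normal_Form.Char_Poly"
begin

text \<open>
  If the complexity is at most \<open>k n\<close> along a sequence, then \<open>p(n + 1) - p(n) \<le> k\<close> for infinitely many
  \<open>n\<close>. For such \<open>n\<close> at most \<open>2k\<close> edges of the Rauzy graph leave right special words, and
  since \<open>X\<close> is aperiodic, every point of \<open>X\<close> has such an edge in its recent past. Its word of
  length \<open>n\<close> is determined by the last such edge and the time elapsed since then, so the
  indicators of these \<open>2k\<close> edges generate all functions of \<open>n\<close> coordinates under the shift.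

  Generators for larger and larger \<open>n\<close> are turned into true generators by a Baire category
  argument. It rests on the density of cyclic tuples: a combination of the generators with a
  matrix of Laurent polynomials as coefficients can be perturbed so that the determinant has no
  zero on the unit circle, and then it is invertible on any space where the shift is isometric.

  For an ergodic measure only the edges whose columns have non-vanishing mass are needed. Distinct
  ergodic measures are mutually singular, and no column can have a large mass for two of them.
\<close>

section \<open>Perturbation of polynomial matrices\<close>

text \<open>The generators found for one \<open>n\<close> bear no relation to those for the next, so
  they have no evident limit. The way out: if \<open>f\<close> generates a prescribed tuple
  \<open>u\<close> approximately, then \<open>u\<close> is nearly a matrix combination of
  \<open>f\<close>, and a small change of the matrix makes it invertible. The resulting tuple is
  near \<open>u\<close> and still generates \<open>f\<close>. The unit circle enters because the
  spectrum of an invertible isometry lies on it; polynomials without zeros there are inverted root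
  by root in the l1 norm of the coefficients, so that one argument serves both
  \<open>C_space X\<close> and \<open>L20_space \<mu>\<close>. The factor 2 in \<open>2 * k\<close>
  comes from the edge count: a word with \<open>c\<close> extensions adds \<open>c - 1\<close> to
  \<open>p(n + 1) - p(n)\<close> but contributes \<open>c\<close> edges when \<open>c\<close> is at
  least 2, and then \<open>c\<close> is at most \<open>2 * (c - 1)\<close>. For the sum over
  measures, the number of heavy columns must be controlled along infinitely many \<open>n\<close>
  for all measures at once. The vector of these numbers takes finitely many values, so one value
  recurs infinitely often.\<close>

definition coeff_norm :: "'a::real_normed_field poly \<Rightarrow> real" where
  "coeff_norm p = (\<Sum>i\<le>degree p. norm (coeff p i))"

lemma coeff_norm_eq: "degree p \<le> n \<Longrightarrow> coeff_norm p = (\<Sum>i\<le>n. norm (coeff p i))"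
  unfolding coeff_norm_def
  by (rule sum.mono_neutral_left) (auto simp: coeff_eq_0)

lemma coeff_norm_nonneg: "0 \<le> coeff_norm p"
  by (simp add: coeff_norm_def sum_nonneg)

lemma coeff_norm_0 [simp]: "coeff_norm 0 = 0"
  by (simp add: coeff_norm_def)

lemma coeff_norm_pCons: "coeff_norm (pCons a p) = norm a + coeff_norm p"
proof -
  have "coeff_norm (pCons a p) = (\<Sum>i\<le>Suc (degree p). norm (coeff (pCons a p) i))"
    by (rule coeff_norm_eq) (rule degree_pCons_le)
  then show ?thesis
    by (simp add: sum.atMost_Suc_shift coeff_norm_def del: sum.atMost_Suc)
qed

lemma coeff_norm_add: "coeff_norm (p + q) \<le> coeff_norm p + coeff_norm q"
proof -
  let ?n = "max (degree p) (degree q)"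
  have "coeff_norm (p + q) = (\<Sum>i\<le>?n. norm (coeff p i + coeff q i))"
    using coeff_norm_eq[OF degree_add_le_max[of p q]] by simp
  also have "\<dots> \<le> (\<Sum>i\<le>?n. norm (coeff p i) + norm (coeff q i))"
    by (intro sum_mono norm_triangle_ineq)
  also have "\<dots> = coeff_norm p + coeff_norm q"
    by (simp add: sum.distrib coeff_norm_eq[of p ?n] coeff_norm_eq[of q ?n])
  finally show ?thesis .
qed

lemma coeff_norm_smult: "coeff_norm (Polynomial.smult a p) = norm a * coeff_norm p"
  using coeff_norm_eq[OF degree_smult_le[of a p]] by (simp add: coeff_norm_def norm_mult sum_distrib_left)

text \<open>Submultiplicativity of this l1 norm is what allows approximate inverses of the factors
  of a polynomial to be multiplied to one of the product.\<close>

lemma coeff_norm_mult: "coeff_norm (p * q) \<le> coeff_norm p * coeff_norm q"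
proof (induction p)
  case (pCons a p)
  have "coeff_norm (pCons a p * q) \<le> coeff_norm (Polynomial.smult a q) + coeff_norm (pCons 0 (p * q))"
    using coeff_norm_add[of "Polynomial.smult a q" "pCons 0 (p * q)"] by simp
  also have "\<dots> \<le> norm a * coeff_norm q + coeff_norm p * coeff_norm q"
    using pCons.IH by (simp add: coeff_norm_smult coeff_norm_pCons)
  finally show ?case by (simp add: coeff_norm_pCons algebra_simps)
qed simp

lemma coeff_norm_monom [simp]: "coeff_norm (monom a n) = norm a"
  by (induction n) (simp_all add: monom_0 monom_Suc coeff_norm_pCons)

text \<open>Truncated geometric series in powers of \<open>x / a\<close> or of \<open>a / x\<close>; the monomial clears the
  negative powers of \<open>x\<close>.\<close>

lemma linear_coeff_norm_inverse:
  fixes a :: complex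
  assumes "norm a \<noteq> 1" "0 < e"
  shows "\<exists>q s. coeff_norm (q * [:-a, 1:] - monom 1 s) < e"
proof -
  have geo: "\<exists>q. q * [:-a, 1:] = monom 1 s - [:a ^ s:]" for s
  proof -
    have "poly (monom 1 s - [:a ^ s:]) a = 0" by (simp add: poly_monom)
    then obtain q where "monom 1 s - [:a ^ s:] = [:-a, 1:] * q" unfolding poly_eq_0_iff_dvd by (rule dvdE)
    then show ?thesis by (metis mult.commute)
  qed
  consider "norm a < 1" | "norm a > 1" using assms by linarith
  then show ?thesis
  proof cases
    case 1
    then obtain s where s: "norm a ^ s < e" using assms real_arch_pow_inv by blast
    obtain q where "q * [:-a, 1:] = monom 1 s - [:a ^ s:]" using geo by blast
    then have "q * [:-a, 1:] - monom 1 s = [:- (a ^ s):]" by simp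
    then show ?thesis using s by (metis coeff_norm_pCons coeff_norm_0 norm_minus_cancel norm_power add.right_neutral)
  next
    case 2
    then have "norm (inverse a) < 1" by (simp add: norm_inverse inverse_less_1_iff)
    then obtain s where s: "norm (inverse a) ^ s < e" using assms real_arch_pow_inv by blast
    obtain q where q: "q * [:-a, 1:] = monom 1 s - [:a ^ s:]" using geo by blast
    have a: "a \<noteq> 0" using 2 by auto
    have "Polynomial.smult (- inverse (a ^ s)) q * [:-a, 1:] - monom 1 0 = monom (- inverse (a ^ s)) s"
      using a by (simp add: q smult_diff_right smult_monom one_pCons del: mult_smult_right mult_pCons_right mult_pCons_left)
       (simp add: smult_monom monom_0 minus_monom)
    moreover have "coeff_norm (monom (- inverse (a ^ s)) s) < e"
      using s by (simp add: norm_inverse norm_power power_inverse)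
    ultimately show ?thesis by metis
  qed
qed

text \<open>Over the complex numbers \<open>d\<close> splits into linear factors with roots off the
  unit circle. Each is inverted up to a monomial by \<open>linear_coeff_norm_inverse\<close>, and
  the induction on the degree multiplies these inverses.\<close>

lemma complex_coeff_norm_inverse:
  fixes d :: "complex poly"
  assumes "\<And>z. norm z = 1 \<Longrightarrow> poly d z \<noteq> 0" "0 < e"
  shows "\<exists>q s. coeff_norm (q * d - monom 1 s) < e"
  using assms
proof (induction "degree d" arbitrary: d e)
  case 0
  then obtain c where d: "d = [:c:]" by (metis degree_eq_zeroE)
  then have "c \<noteq> 0" using "0.prems"(1)[of 1] by auto
  then have "[:inverse c:] * d - monom 1 0 = 0" by (simp add: d monom_0)
  then show ?case using \<open>0 < e\<close> by (metis coeff_norm_0)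
next
  case (Suc n)
  have "\<not> constant (poly d)" using Suc.hyps(2) by (simp add: constant_degree)
  then obtain a where a: "poly d a = 0" using fundamental_theorem_of_algebra by blast
  then obtain d' where d: "d = [:-a, 1:] * d'" unfolding poly_eq_0_iff_dvd by (rule dvdE)
  have d'0: "d' \<noteq> 0" using Suc.hyps(2) d by auto
  have "degree d = 1 + degree d'" unfolding d using d'0 by (subst degree_mult_eq) auto
  then have deg: "n = degree d'" using Suc.hyps(2) by simp
  have na: "norm a \<noteq> 1" using Suc.prems(1) a by blast
  have nz: "\<And>z. norm z = 1 \<Longrightarrow> poly d' z \<noteq> 0" using Suc.prems(1) d by fastforce
  \<comment> \<open>With errors \<open>u\<close> and \<open>v\<close> the product has the error
    \<open>u * v\<close> plus \<open>u\<close> and \<open>v\<close> times monomials. As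
    \<open>h\<close> is at most 1, the norm of \<open>u * v\<close> is at most that of
    \<open>v\<close>, so the total stays below \<open>3 * h\<close>.\<close>
  define h where "h = min 1 (e / 3)"
  have h: "0 < h" "h \<le> 1" "3 * h \<le> e" using Suc.prems(2) by (auto simp: h_def)
  obtain q1 s1 where 1: "coeff_norm (q1 * [:-a, 1:] - monom 1 s1) < h" using linear_coeff_norm_inverse[OF na h(1)] by blast
  obtain q2 s2 where 2: "coeff_norm (q2 * d' - monom 1 s2) < h" using Suc.hyps(1)[OF deg nz h(1)] by blast
  define u where "u = q1 * [:-a, 1:] - monom 1 s1"
  define v where "v = q2 * d' - monom 1 s2"
  have "(q1 * q2) * d = (u + monom 1 s1) * (v + monom 1 s2)"
    by (simp add: u_def v_def d algebra_simps del: mult_pCons_left mult_pCons_right)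
  also have "\<dots> = (u * v + (u * monom 1 s2 + v * monom 1 s1)) + monom 1 (s1 + s2)"
    by (simp add: algebra_simps mult_monom)
  finally have "(q1 * q2) * d - monom 1 (s1 + s2) = u * v + (u * monom 1 s2 + v * monom 1 s1)" by simp
  moreover have "coeff_norm (u * v + (u * monom 1 s2 + v * monom 1 s1)) \<le> coeff_norm u * coeff_norm v + (coeff_norm u + coeff_norm v)"
    using coeff_norm_add[of "u * v" "u * monom 1 s2 + v * monom 1 s1"] coeff_norm_add[of "u * monom 1 s2" "v * monom 1 s1"]
      coeff_norm_mult[of u v] coeff_norm_mult[of u "monom 1 s2"] coeff_norm_mult[of v "monom 1 s1"] by simp
  moreover have "coeff_norm u * coeff_norm v \<le> 1 * coeff_norm v"
    using 1 h coeff_norm_nonneg[of v] by (intro mult_right_mono) (auto simp: u_def)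
  moreover have "coeff_norm u < h" "coeff_norm v < h" using 1 2 by (auto simp: u_def v_def)
  ultimately have "coeff_norm ((q1 * q2) * d - monom 1 (s1 + s2)) < e" using h by auto
  then show ?case by blast
qed

text \<open>As \<open>d\<close> and the monomial are real, passing to the real parts of the
  coefficients of a complex \<open>q\<close> takes the real part of the error, which does not
  enlarge it.\<close>

lemma real_coeff_norm_inverse:
  fixes d :: "real poly"
  assumes nz: "\<And>z::complex. norm z = 1 \<Longrightarrow> poly (map_poly of_real d) z \<noteq> 0" and "0 < e"
  shows "\<exists>q s. coeff_norm (q * d - monom 1 s) < e"
proof -
  obtain q s where q: "coeff_norm (q * map_poly complex_of_real d - monom 1 s) < e"
    using complex_coeff_norm_inverse[OF nz \<open>0 < e\<close>] by blast
  define r where "r = map_poly Re q"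
  have c: "coeff (r * d - monom 1 s) i = Re (coeff (q * map_poly complex_of_real d - monom 1 s) i)" for i
    by (simp add: r_def coeff_mult coeff_map_poly)
  let ?p = "q * map_poly complex_of_real d - monom 1 s"
  have "degree (r * d - monom 1 s) \<le> degree ?p"
    by (rule degree_le) (unfold c, auto simp only: coeff_eq_0 zero_complex.sel)
  then have "coeff_norm (r * d - monom 1 s) = (\<Sum>i\<le>degree ?p. \<bar>Re (coeff ?p i)\<bar>)"
    using coeff_norm_eq by (metis (no_types, lifting) c real_norm_def sum.cong)
  also have "\<dots> \<le> coeff_norm ?p"
    unfolding coeff_norm_def by (intro sum_mono abs_Re_le_cmod)
  finally show ?thesis using q by (meson order.strict_trans1)
qed


text \<open>The condition for \<open>d\<close> to act invertibly on every space with an isometric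
  bijection, whose spectrum lies on the unit circle; hence complex zeros count although
  \<open>d\<close> is real.\<close>

definition circle_free :: "real poly \<Rightarrow> bool" where
  "circle_free d \<longleftrightarrow> (\<forall>z::complex. norm z = 1 \<longrightarrow> poly (map_poly of_real d) z \<noteq> 0)"

lemma coeff_pcompose_scale:
  fixes p :: "real poly"
  shows "coeff (pcompose p [:0, c:]) i = c ^ i * coeff p i"
  by (induction p arbitrary: i) (auto simp: pcompose_pCons coeff_pCons split: nat.splits)

lemma poly_map_poly_scale:
  fixes p :: "real poly"
  shows "poly (map_poly of_real (pcompose p [:0, c:])) z = poly (map_poly of_real p) (of_real c * z :: complex)"
  by (induction p) (auto simp: pcompose_pCons map_poly_pCons hom_distribs algebra_simps)

lemma tendsto_coeff_norm_scale:
  fixes p :: "real poly"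
  shows "((\<lambda>c. coeff_norm (pcompose p [:0, c:] - p)) \<longlongrightarrow> 0) (at_right 1)"
proof -
  have eq: "coeff_norm (pcompose p [:0, c:] - p) = (\<Sum>i\<le>degree p. \<bar>c ^ i * coeff p i - coeff p i\<bar>)" for c
  proof -
    have "degree (pcompose p [:0, c:] - p) \<le> degree p"
      by (rule degree_le) (auto simp: coeff_pcompose_scale coeff_eq_0)
    from coeff_norm_eq[OF this] show ?thesis by (simp add: coeff_pcompose_scale)
  qed
  have "((\<lambda>c. \<Sum>i\<le>degree p. \<bar>c ^ i * coeff p i - coeff p i\<bar>) \<longlongrightarrow> (\<Sum>i\<le>degree p. \<bar>1 ^ i * coeff p i - coeff p i\<bar>)) (at_right 1)"
    by (intro tendsto_intros)
  then show ?thesis by (simp add: eq)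
qed

text \<open>The zeros of the rescaled polynomial are those of \<open>d\<close> divided by
  \<open>c\<close>, so the only bad values of \<open>c\<close> are the finitely many moduli of zeros
  of \<open>d\<close>.\<close>

lemma eventually_circle_free_scale:
  fixes d :: "real poly"
  assumes "d \<noteq> 0"
  shows "\<forall>\<^sub>F c in at_right 1. circle_free (pcompose d [:0, c:])"
proof -
  let ?R = "{z::complex. poly (map_poly of_real d) z = 0}"
  have "finite ?R" using assms by (intro poly_roots_finite) simp
  \<comment> \<open>Taking out 1 makes the complement of this finite set a neighbourhood of 1; the
    value 1 itself is avoided by the one-sided filter.\<close>
  then have "finite (norm ` ?R - {1})" by simp
  then have op: "open (- (norm ` ?R - {1}))" by (intro open_Compl finite_imp_closed)
  have "\<forall>\<^sub>F c in at_right (1::real). c \<notin> norm ` ?R - {1}"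
    unfolding eventually_at_filter
    by (rule eventually_mono[OF eventually_nhds_in_open[OF op]]) auto
  then show ?thesis
    using eventually_at_right_less[of 1]
  proof eventually_elim
    case (elim c)
    show ?case
      unfolding circle_free_def poly_map_poly_scale
    proof (intro allI impI notI)
      fix z :: complex assume "norm z = 1" "poly (map_poly of_real d) (of_real c * z) = 0"
      then have "norm (of_real c * z) \<in> norm ` ?R" "norm (of_real c * z) = c"
        using elim(2) by (blast, simp add: norm_mult)
      then have "c \<in> norm ` ?R - {1}" using elim(2) by auto
      then show False using elim(1) by simp
    qed
  qed
qed

text \<open>Two small changes: subtracting a constant \<open>t\<close> on the diagonal makes the
  determinant a nonzero polynomial, and rescaling the variable then moves its zeros off the unit
  circle.\<close>

lemma perturb_matrix:
  fixes P :: "real poly mat"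
  assumes P: "P \<in> carrier_mat m m" and "0 < e"
  shows "\<exists>Q\<in>carrier_mat m m. circle_free (Determinant.det Q) \<and>
           (\<forall>i<m. \<forall>j<m. coeff_norm (Q $$ (i, j) - P $$ (i, j)) < e)"
proof -
  define h where "h = e / 2"
  have h: "0 < h" using assms by (simp add: h_def)
  \<comment> \<open>This polynomial has coefficients in the ring of real polynomials. Being monic it
    is nonzero, so only finitely many constants \<open>t\<close> are roots of it.\<close>
  have cp: "char_poly P \<noteq> 0" using degree_monic_char_poly[OF P] by auto
  then have "finite {x. poly (char_poly P) x = 0}" by (rule poly_roots_finite)
  then have "finite ((\<lambda>t. [:t:]) -` {x. poly (char_poly P) x = 0} \<inter> {0<..<h})"
    by (intro finite_vimage_IntI) (auto simp: inj_on_def)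
  moreover have "infinite {0<..<h}" using h by simp
  ultimately obtain t where t: "0 < t" "t < h" "poly (char_poly P) [:t:] \<noteq> 0"
    by (smt (verit, ccfv_threshold) Int_iff Collect_mono_iff greaterThanLessThan_iff mem_Collect_eq rev_finite_subset subsetI vimage_eq)
  define R where "R = P - [:t:] \<cdot>\<^sub>m 1\<^sub>m m"
  have R: "R \<in> carrier_mat m m" by (auto simp: R_def P)
  have ev: "comm_ring_hom (\<lambda>p::real poly poly. poly p [:t:])"
    by unfold_locales auto
  have "R = (- 1) \<cdot>\<^sub>m map_mat (\<lambda>p. poly p [:t:]) (char_poly_matrix P)"
    using P by (intro eq_matI) (auto simp: R_def char_poly_matrix_def)
  then have "Determinant.det R = (- 1) ^ m * poly (char_poly P) [:t:]"
    using char_poly_matrix_closed[OF P] comm_ring_hom.hom_det[OF ev, of "char_poly_matrix P"] by (auto simp: char_poly_def)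
  then have "Determinant.det R \<noteq> 0" using t(3) by simp
  then have "\<forall>\<^sub>F c in at_right 1. circle_free (pcompose (Determinant.det R) [:0, c:])"
    by (rule eventually_circle_free_scale)
  moreover have "\<forall>\<^sub>F c in at_right 1. \<forall>i\<in>{..<m}. \<forall>j\<in>{..<m}. coeff_norm (pcompose (R $$ (i, j)) [:0, c:] - R $$ (i, j)) < h"
    using h order_tendstoD(2)[OF tendsto_coeff_norm_scale] by (simp add: eventually_ball_finite_distrib)
  ultimately have "\<forall>\<^sub>F c in at_right 1. circle_free (pcompose (Determinant.det R) [:0, c:]) \<and>
      (\<forall>i\<in>{..<m}. \<forall>j\<in>{..<m}. coeff_norm (pcompose (R $$ (i, j)) [:0, c:] - R $$ (i, j)) < h)"
    by (rule eventually_conj)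
  then obtain c where c: "circle_free (pcompose (Determinant.det R) [:0, c:])"
      "\<And>i j. i < m \<Longrightarrow> j < m \<Longrightarrow> coeff_norm (pcompose (R $$ (i, j)) [:0, c:] - R $$ (i, j)) < h"
    by (auto dest!: eventually_happens)
  \<comment> \<open>Rescaling the variable is a ring homomorphism and hence commutes with the
    determinant.\<close>
  have sc: "comm_ring_hom (\<lambda>p::real poly. pcompose p [:0, c:])"
    by unfold_locales (auto simp: pcompose_add pcompose_mult)
  define Q where "Q = map_mat (\<lambda>p. pcompose p [:0, c:]) R"
  have "Q \<in> carrier_mat m m" using R by (simp add: Q_def)
  moreover have "circle_free (Determinant.det Q)" using c(1) by (simp add: Q_def comm_ring_hom.hom_det[OF sc])
  moreover have "coeff_norm (Q $$ (i, j) - P $$ (i, j)) < e" if "i < m" "j < m" for i j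
  proof -
    have "Q $$ (i, j) - P $$ (i, j) = (pcompose (R $$ (i, j)) [:0, c:] - R $$ (i, j)) + (R $$ (i, j) - P $$ (i, j))"
      using that R by (simp add: Q_def)
    then have "coeff_norm (Q $$ (i, j) - P $$ (i, j)) \<le> coeff_norm (pcompose (R $$ (i, j)) [:0, c:] - R $$ (i, j)) + coeff_norm (R $$ (i, j) - P $$ (i, j))"
      by (metis coeff_norm_add)
    moreover have "R $$ (i, j) - P $$ (i, j) = (if i = j then [:-t:] else 0)"
      using that P by (simp add: R_def)
    then have "coeff_norm (R $$ (i, j) - P $$ (i, j)) < h" using t by (simp add: coeff_norm_pCons)
    ultimately show ?thesis using c(2)[OF that] by (simp add: h_def)
  qed
  ultimately show ?thesis by blast
qed

section \<open>Isometric bijections of seminormed spaces\<close>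

text \<open>A common setting for continuous functions and for mean-zero square integrable functions.
  \<open>N\<close> may vanish on nonzero vectors, as \<open>L2_norm\<close> does on functions that
  are 0 almost everywhere.\<close>

locale isometric_bijection =
  fixes E :: "'v::real_vector set" and N :: "'v \<Rightarrow> real" and U :: "'v \<Rightarrow> 'v"
  assumes subspace_E: "subspace E"
    and N_add: "\<And>x y. x \<in> E \<Longrightarrow> y \<in> E \<Longrightarrow> N (x + y) \<le> N x + N y"
    and N_scale: "\<And>c x. x \<in> E \<Longrightarrow> N (c *\<^sub>R x) = \<bar>c\<bar> * N x"
    and linear_U: "linear U"
    and bij_U: "bij_betw U E E"
    and N_U: "\<And>x. x \<in> E \<Longrightarrow> N (U x) = N x"
begin

lemmas E_closed = subspace_0[OF subspace_E] subspace_add[OF subspace_E] subspace_diff[OF subspace_E]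
  subspace_scale[OF subspace_E] subspace_neg[OF subspace_E] subspace_sum[OF subspace_E]

lemma N_0 [simp]: "N 0 = 0"
  using N_scale[OF E_closed(1), of 0] by simp

lemma N_minus: "x \<in> E \<Longrightarrow> N (- x) = N x"
  using N_scale[of x "-1"] by simp

lemma N_nonneg: "x \<in> E \<Longrightarrow> 0 \<le> N x"
  using N_add[of x "- x"] E_closed(5)[of x] by (simp add: N_minus)

lemma N_diff_triangle: "x \<in> E \<Longrightarrow> y \<in> E \<Longrightarrow> z \<in> E \<Longrightarrow> N (x - z) \<le> N (x - y) + N (y - z)"
  using N_add[of "x - y" "y - z"] E_closed(3) by simp

lemma N_diff_commute: "x \<in> E \<Longrightarrow> y \<in> E \<Longrightarrow> N (x - y) = N (y - x)"
  using N_minus[of "x - y"] E_closed(3) by simp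

lemma N_sum: "(\<And>i. i \<in> I \<Longrightarrow> f i \<in> E) \<Longrightarrow> N (\<Sum>i\<in>I. f i) \<le> (\<Sum>i\<in>I. N (f i))"
proof (induction I rule: infinite_finite_induct)
  case (insert i I)
  then have "N (f i + sum f I) \<le> N (f i) + N (sum f I)" by (intro N_add E_closed) auto
  then show ?case using insert by fastforce
qed simp_all

abbreviation "V \<equiv> int_pow_on E U"

lemma U_in: "x \<in> E \<Longrightarrow> U x \<in> E"
  using bij_U by (auto simp: bij_betw_def)

lemma U_inj: "x \<in> E \<Longrightarrow> y \<in> E \<Longrightarrow> U x = U y \<Longrightarrow> x = y"
  using bij_U by (auto simp: bij_betw_def inj_on_def)

lemma inv_in: "x \<in> E \<Longrightarrow> inv_into E U x \<in> E" and U_inv: "x \<in> E \<Longrightarrow> U (inv_into E U x) = x"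
  using bij_U by (auto simp: bij_betw_def intro: inv_into_into f_inv_into_f)

lemma V_in: "x \<in> E \<Longrightarrow> V n x \<in> E"
proof -
  assume x: "x \<in> E"
  have "(U ^^ i) x \<in> E \<and> (inv_into E U ^^ i) x \<in> E" for i
    by (induction i) (auto simp: x U_in inv_in)
  then show ?thesis by (simp add: int_pow_on_def)
qed

lemma V_0 [simp]: "V 0 x = x"
  by (simp add: int_pow_on_def)

lemma V_nat: "V (int i) x = (U ^^ i) x"
  by (simp add: int_pow_on_def)

lemma V_Suc: "x \<in> E \<Longrightarrow> V (n + 1) x = U (V n x)"
proof (cases "0 \<le> n")
  case True
  then show ?thesis by (simp add: int_pow_on_def nat_add_distrib)
next
  case False
  assume x: "x \<in> E"
  have "nat (- n) = Suc (nat (- (n + 1)))" using False by simp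
  then have "V n x = inv_into E U (V (n + 1) x)"
    using False by (cases "n = -1") (auto simp: int_pow_on_def)
  then show ?thesis using U_inv V_in x by metis
qed

lemma V_add: "x \<in> E \<Longrightarrow> V (m + n) x = V m (V n x)"
proof (induction m rule: int_induct[where k = 0])
  case (step1 i)
  then show ?case using V_Suc[of x "i + n"] V_Suc[of "V n x" i] V_in by (simp add: algebra_simps)
next
  case (step2 i)
  have "U (V (i - 1 + n) x) = U (V (i - 1) (V n x))"
    using step2 V_Suc[of x "i - 1 + n"] V_Suc[of "V n x" "i - 1"] V_in by (simp add: algebra_simps)
  then show ?case using U_inj V_in step2 by blast
qed simp

lemma V_plus: "x \<in> E \<Longrightarrow> y \<in> E \<Longrightarrow> V n (x + y) = V n x + V n y"
proof (induction n rule: int_induct[where k = 0])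
  case (step1 i)
  then show ?case by (simp add: V_Suc E_closed linear_add[OF linear_U])
next
  case (step2 i)
  have "U (V (i - 1) (x + y)) = U (V (i - 1) x + V (i - 1) y)"
    using step2 V_Suc[of _ "i - 1"] by (simp add: E_closed linear_add[OF linear_U])
  then show ?case using U_inj[OF V_in E_closed(2)[OF V_in V_in]] step2 E_closed by blast
qed simp

lemma V_scale: "x \<in> E \<Longrightarrow> V n (c *\<^sub>R x) = c *\<^sub>R V n x"
proof (induction n rule: int_induct[where k = 0])
  case (step1 i)
  then show ?case by (simp add: V_Suc E_closed linear_scale[OF linear_U])
next
  case (step2 i)
  have "U (V (i - 1) (c *\<^sub>R x)) = U (c *\<^sub>R V (i - 1) x)"
    using step2 V_Suc[of _ "i - 1"] by (simp add: E_closed linear_scale[OF linear_U])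
  then show ?case using U_inj[of "V (i - 1) (c *\<^sub>R x)" "c *\<^sub>R V (i - 1) x"] step2 by (simp add: V_in E_closed)
qed simp

lemma V_minus: "x \<in> E \<Longrightarrow> y \<in> E \<Longrightarrow> V n (x - y) = V n x - V n y"
  using V_plus[of x "- y" n] V_scale[of y n "-1"] E_closed by simp

lemma N_V: "x \<in> E \<Longrightarrow> N (V n x) = N x"
proof (induction n rule: int_induct[where k = 0])
  case (step1 i)
  then show ?case by (simp add: V_Suc N_U V_in)
next
  case (step2 i)
  then show ?case using V_Suc[of x "i - 1"] N_U[OF V_in, of x "i - 1"] by simp
qed simp

section \<open>Orbit spans and their closures\<close>

definition orbit_span :: "'v set \<Rightarrow> 'v set" where
  "orbit_span F = span {V n x | n x. x \<in> F}"

definition orbit_closure :: "'v set \<Rightarrow> 'v set" where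
  "orbit_closure F = {g \<in> E. \<forall>e>0. \<exists>h\<in>orbit_span F. N (g - h) < e}"

lemma orbit_span_sub_E: "F \<subseteq> E \<Longrightarrow> orbit_span F \<subseteq> E"
  unfolding orbit_span_def by (rule span_minimal) (auto simp: subspace_E V_in)

lemma orbit_span_V: assumes F: "F \<subseteq> E" and "x \<in> orbit_span F" shows "V m x \<in> orbit_span F"
proof -
  have "orbit_span F \<subseteq> {x \<in> E. V m x \<in> orbit_span F}"
    unfolding orbit_span_def
  proof (rule span_minimal)
    have "V m 0 = 0" using V_scale[of 0 m 0] E_closed(1) by simp
    then show "subspace {x \<in> E. V m x \<in> span {V n x |n x. x \<in> F}}"
      by (auto simp: subspace_def E_closed V_plus V_scale span_zero span_add span_scale)
    show "{V n x |n x. x \<in> F} \<subseteq> {x \<in> E. V m x \<in> span {V n x |n x. x \<in> F}}"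
      using F by (auto simp: V_in intro!: span_base) (metis V_add subsetD)
  qed
  then show ?thesis using assms by blast
qed

lemma orbit_span_base: "x \<in> F \<Longrightarrow> V n x \<in> orbit_span F"
  unfolding orbit_span_def by (auto intro!: span_base)

lemma subspace_Z: "subspace (orbit_span F)"
  by (simp add: orbit_span_def)

lemma orbit_closure_subspace: assumes F: "F \<subseteq> E" shows "subspace (orbit_closure F)"
proof (rule subspaceI)
  show "0 \<in> orbit_closure F"
    using subspace_0[OF subspace_Z] E_closed(1) by (auto simp: orbit_closure_def intro!: bexI[of _ 0])
next
  fix x y assume xy: "x \<in> orbit_closure F" "y \<in> orbit_closure F"
  have "\<exists>h\<in>orbit_span F. N (x + y - h) < e" if "0 < e" for e
  proof -
    have "0 < e / 2" using \<open>0 < e\<close> by simp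
    then obtain a b where ab: "a \<in> orbit_span F" "b \<in> orbit_span F" "N (x - a) < e / 2" "N (y - b) < e / 2"
      using xy unfolding orbit_closure_def by blast
    have "N ((x - a) + (y - b)) \<le> N (x - a) + N (y - b)"
      using xy ab orbit_span_sub_E[OF F] by (intro N_add E_closed(3)) (auto simp: orbit_closure_def)
    then have "N (x + y - (a + b)) < e" using ab by (simp add: algebra_simps)
    then show ?thesis using subspace_add[OF subspace_Z] ab by blast
  qed
  then show "x + y \<in> orbit_closure F" using xy by (auto simp: orbit_closure_def E_closed)
next
  fix c x assume x: "x \<in> orbit_closure F"
  have "\<exists>h\<in>orbit_span F. N (c *\<^sub>R x - h) < e" if "0 < e" for e
  proof -
    have "0 < e / (\<bar>c\<bar> + 1)" using \<open>0 < e\<close> by simp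
    then obtain a where a: "a \<in> orbit_span F" "N (x - a) < e / (\<bar>c\<bar> + 1)"
      using x unfolding orbit_closure_def by blast
    have xa: "x - a \<in> E" using x a orbit_span_sub_E[OF F] by (auto simp: orbit_closure_def intro!: E_closed(3))
    have "N (c *\<^sub>R x - c *\<^sub>R a) = \<bar>c\<bar> * N (x - a)"
      using N_scale[OF xa, of c] by (simp add: scaleR_diff_right)
    also have "\<dots> \<le> (\<bar>c\<bar> + 1) * N (x - a)" using N_nonneg[OF xa] by (simp add: mult_right_mono)
    also have "\<dots> < e" using a(2) by (simp add: field_simps)
    finally show ?thesis using subspace_scale[OF subspace_Z] a by blast
  qed
  then show "c *\<^sub>R x \<in> orbit_closure F" using x by (auto simp: orbit_closure_def E_closed)
qed

lemma orbit_closure_closed: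
  assumes F: "F \<subseteq> E" and g: "g \<in> E" and *: "\<And>e. e > 0 \<Longrightarrow> \<exists>h\<in>orbit_closure F. N (g - h) < e"
  shows "g \<in> orbit_closure F"
proof -
  have "\<exists>h\<in>orbit_span F. N (g - h) < e" if "0 < e" for e
  proof -
    have e2: "0 < e / 2" using \<open>0 < e\<close> by simp
    obtain h where h: "h \<in> orbit_closure F" "N (g - h) < e / 2" using *[OF e2] by auto
    then obtain k where k: "k \<in> orbit_span F" "N (h - k) < e / 2" using e2 unfolding orbit_closure_def by blast
    have "N (g - k) \<le> N (g - h) + N (h - k)"
      using g h k orbit_span_sub_E[OF F] by (intro N_diff_triangle) (auto simp: orbit_closure_def)
    then show ?thesis using h k by force
  qed
  then show ?thesis using g by (auto simp: orbit_closure_def)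
qed

lemma orbit_span_sub_orbit_closure: "F \<subseteq> E \<Longrightarrow> orbit_span F \<subseteq> orbit_closure F"
  using orbit_span_sub_E by (auto simp: orbit_closure_def intro!: bexI)

lemma orbit_closure_V: assumes F: "F \<subseteq> E" and g: "g \<in> orbit_closure F" shows "V n g \<in> orbit_closure F"
proof -
  have "\<exists>h\<in>orbit_span F. N (V n g - h) < e" if "0 < e" for e
  proof -
    obtain h where h: "h \<in> orbit_span F" "N (g - h) < e" using g \<open>0 < e\<close> by (auto simp: orbit_closure_def)
    have "g \<in> E" "h \<in> E" using g h orbit_span_sub_E[OF F] by (auto simp: orbit_closure_def)
    then have "N (V n g - V n h) < e" using h by (simp add: V_minus[symmetric] N_V E_closed)
    then show ?thesis using orbit_span_V[OF F] h by blast
  qed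
  then show ?thesis using g by (auto simp: orbit_closure_def V_in)
qed

lemma orbit_span_orbit_closure_minimal: "F \<subseteq> E \<Longrightarrow> G \<subseteq> orbit_closure F \<Longrightarrow> orbit_span G \<subseteq> orbit_closure F"
  unfolding orbit_span_def by (rule span_minimal) (auto simp: orbit_closure_V orbit_closure_subspace)

section \<open>Polynomials in the operator\<close>

definition poly_act :: "real poly \<Rightarrow> 'v \<Rightarrow> 'v" where
  "poly_act p x = (\<Sum>i\<le>degree p. coeff p i *\<^sub>R (U ^^ i) x)"

lemma poly_act_eq: "degree p \<le> n \<Longrightarrow> poly_act p x = (\<Sum>i\<le>n. coeff p i *\<^sub>R (U ^^ i) x)"
  unfolding poly_act_def by (rule sum.mono_neutral_left) (auto simp: coeff_eq_0)

lemma poly_act_0 [simp]: "poly_act 0 x = 0"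
  by (simp add: poly_act_def)

lemma poly_act_pCons: "poly_act (pCons a p) x = a *\<^sub>R x + U (poly_act p x)"
proof -
  have "poly_act (pCons a p) x = (\<Sum>i\<le>Suc (degree p). coeff (pCons a p) i *\<^sub>R (U ^^ i) x)"
    by (rule poly_act_eq) (rule degree_pCons_le)
  then show ?thesis
    by (simp add: sum.atMost_Suc_shift poly_act_def linear_sum[OF linear_U] linear_scale[OF linear_U] del: sum.atMost_Suc)
qed

lemma poly_act_add: "poly_act (p + q) x = poly_act p x + poly_act q x"
proof -
  let ?n = "max (degree p) (degree q)"
  have "poly_act (p + q) x = (\<Sum>i\<le>?n. (coeff p i + coeff q i) *\<^sub>R (U ^^ i) x)"
    using poly_act_eq[OF degree_add_le_max[of p q]] by simp
  then show ?thesis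
    by (simp add: sum.distrib poly_act_eq[of p ?n] poly_act_eq[of q ?n] scaleR_add_left)
qed

lemma poly_act_smult: "poly_act (Polynomial.smult a p) x = a *\<^sub>R poly_act p x"
  using poly_act_eq[OF degree_smult_le[of a p]] by (simp add: poly_act_def scaleR_sum_right)

lemma poly_act_diff: "poly_act (p - q) x = poly_act p x - poly_act q x"
  using poly_act_add[of p "Polynomial.smult (-1) q" x] poly_act_smult[of "-1" q x] by simp

lemma poly_act_sum: "poly_act (\<Sum>i\<in>I. p i) x = (\<Sum>i\<in>I. poly_act (p i) x)"
  by (induction I rule: infinite_finite_induct) (simp_all add: poly_act_add)

lemma poly_act_vec_add: "poly_act p (x + y) = poly_act p x + poly_act p y"
  by (induction p) (simp_all add: poly_act_pCons linear_add[OF linear_U] scaleR_add_right)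

lemma poly_act_vec_scale: "poly_act p (c *\<^sub>R x) = c *\<^sub>R poly_act p x"
  by (induction p) (simp_all add: poly_act_pCons linear_scale[OF linear_U] scaleR_add_right)

lemma poly_act_vec_0 [simp]: "poly_act p 0 = 0"
  using poly_act_vec_scale[of p 0] by simp

lemma poly_act_vec_sum: "poly_act p (\<Sum>i\<in>I. f i) = (\<Sum>i\<in>I. poly_act p (f i))"
  by (induction I rule: infinite_finite_induct) (simp_all add: poly_act_vec_add)

lemma poly_act_mult: "poly_act (p * q) x = poly_act p (poly_act q x)"
  by (induction p) (simp_all add: poly_act_add poly_act_smult poly_act_pCons)

lemma poly_act_monom: "poly_act (monom a n) x = a *\<^sub>R (U ^^ n) x"
  by (induction n) (simp_all add: monom_0 monom_Suc poly_act_pCons linear_0[OF linear_U] linear_scale[OF linear_U])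

lemma poly_act_in: "x \<in> E \<Longrightarrow> poly_act p x \<in> E"
  unfolding poly_act_def V_nat[symmetric] by (intro E_closed V_in)

text \<open>All powers of an isometry preserve \<open>N\<close>, so the l1 norm of the coefficients
  bounds the operator norm. This turns small changes of coefficients into small changes of
  vectors.\<close>

lemma N_poly_act: "x \<in> E \<Longrightarrow> N (poly_act p x) \<le> coeff_norm p * N x"
proof -
  assume x: "x \<in> E"
  have "N (poly_act p x) \<le> (\<Sum>i\<le>degree p. N (coeff p i *\<^sub>R V (int i) x))"
    unfolding poly_act_def V_nat[symmetric] using x by (intro N_sum E_closed V_in)
  also have "\<dots> = coeff_norm p * N x"
    using x by (simp add: coeff_norm_def N_scale V_in N_V sum_distrib_right)
  finally show ?thesis .
qed

lemma poly_act_orbit_closure: "F \<subseteq> E \<Longrightarrow> x \<in> orbit_closure F \<Longrightarrow> poly_act p x \<in> orbit_closure F"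
  unfolding poly_act_def V_nat[symmetric]
  by (intro subspace_sum[OF orbit_closure_subspace] subspace_scale[OF orbit_closure_subspace] orbit_closure_V)

text \<open>For an approximate inverse \<open>q\<close> with \<open>q * d\<close> close to the
  monomial of degree \<open>s\<close>, apply \<open>q\<close> to the given vector and then the power
  \<open>- s\<close> of \<open>U\<close>: the result stays in the closure and is close to
  \<open>f\<close>.\<close>

lemma orbit_closure_of_circle_free:
  assumes F: "F \<subseteq> E" and f: "f \<in> E" and d: "circle_free d" and df: "poly_act d f \<in> orbit_closure F"
  shows "f \<in> orbit_closure F"
proof (rule orbit_closure_closed[OF F f])
  fix e :: real assume e: "0 < e"
  define h where "h = e / (N f + 1)"
  have nf: "0 \<le> N f" using N_nonneg f .
  have h: "0 < h" using e nf by (simp add: h_def)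
  obtain q s where q: "coeff_norm (q * d - monom 1 s) < h"
    using real_coeff_norm_inverse[OF _ h] d unfolding circle_free_def by blast
  define g where "g = V (- int s) (poly_act q (poly_act d f))"
  have g: "g \<in> orbit_closure F" unfolding g_def by (intro orbit_closure_V poly_act_orbit_closure F df)
  have fV: "f = V (- int s) (V (int s) f)" using V_add[OF f, of "- int s" "int s"] by simp
  have "N (g - f) = N (poly_act (q * d - monom 1 s) f)"
  proof -
    have "g - f = V (- int s) (poly_act q (poly_act d f) - V (int s) f)"
      unfolding g_def using f by (subst (2) fV) (simp add: V_minus poly_act_in V_in)
    also have "poly_act q (poly_act d f) - V (int s) f = poly_act (q * d - monom 1 s) f"
      by (simp add: poly_act_diff poly_act_mult poly_act_monom V_nat)
    finally show ?thesis using f by (simp add: N_V poly_act_in)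
  qed
  also have "\<dots> \<le> h * N f"
    using N_poly_act[OF f, of "q * d - monom 1 s"] q nf by (meson mult_right_mono less_imp_le order_trans)
  also have "\<dots> < e" using e nf by (simp add: h_def field_simps)
  finally have "N (f - g) < e" using f g by (simp add: N_diff_commute orbit_closure_def)
  then show "\<exists>h\<in>orbit_closure F. N (f - h) < e" using g by blast
qed


section \<open>Perturbing the generators\<close>

lemma orbit_span_mono: "F \<subseteq> G \<Longrightarrow> orbit_span F \<subseteq> orbit_span G"
  unfolding orbit_span_def by (rule span_mono) auto

text \<open>Only finitely many negative powers occur, and moving all generators back by a large
  \<open>K\<close> turns Laurent polynomials into polynomials. Allowing every \<open>K\<close>
  beyond \<open>K0\<close> lets several vectors share the same \<open>K\<close>.\<close>

lemma orbit_span_representation: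
  fixes u :: "nat \<Rightarrow> 'v" and m :: nat
  assumes u: "\<And>i. i < m \<Longrightarrow> u i \<in> E" and h: "h \<in> orbit_span (u ` {..<m})"
  shows "\<exists>K0. \<forall>K\<ge>K0. \<exists>P. h = (\<Sum>i<m. poly_act (P i) (V (- int K) (u i)))"
proof -
  let ?S = "{h. \<exists>K0. \<forall>K\<ge>K0. \<exists>P. h = (\<Sum>i<m. poly_act (P i) (V (- int K) (u i)))}"
  have "orbit_span (u ` {..<m}) \<subseteq> ?S"
    unfolding orbit_span_def
  proof (rule span_minimal)
    show "subspace ?S"
    proof (rule subspaceI)
      show "0 \<in> ?S" by (auto intro!: exI[of _ "\<lambda>_. 0"])
    next
      fix x y assume "x \<in> ?S" "y \<in> ?S"
      then obtain K1 K2 where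
        1: "\<And>K. K \<ge> K1 \<Longrightarrow> \<exists>P. x = (\<Sum>i<m. poly_act (P i) (V (- int K) (u i)))" and
        2: "\<And>K. K \<ge> K2 \<Longrightarrow> \<exists>P. y = (\<Sum>i<m. poly_act (P i) (V (- int K) (u i)))" by blast
      have "\<exists>P. x + y = (\<Sum>i<m. poly_act (P i) (V (- int K) (u i)))" if K: "K \<ge> max K1 K2" for K
      proof -
        obtain P Q where "x = (\<Sum>i<m. poly_act (P i) (V (- int K) (u i)))" "y = (\<Sum>i<m. poly_act (Q i) (V (- int K) (u i)))"
          using 1[of K] 2[of K] K by auto
        then have "x + y = (\<Sum>i<m. poly_act (P i + Q i) (V (- int K) (u i)))"
          by (simp add: poly_act_add sum.distrib)
        then show ?thesis by (intro exI[of _ "\<lambda>i. P i + Q i"])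
      qed
      then show "x + y \<in> ?S" by blast
    next
      fix c x assume "x \<in> ?S"
      then obtain K1 where
        1: "\<And>K. K \<ge> K1 \<Longrightarrow> \<exists>P. x = (\<Sum>i<m. poly_act (P i) (V (- int K) (u i)))" by blast
      have "\<exists>P. c *\<^sub>R x = (\<Sum>i<m. poly_act (P i) (V (- int K) (u i)))" if K: "K \<ge> K1" for K
      proof -
        obtain P where "x = (\<Sum>i<m. poly_act (P i) (V (- int K) (u i)))" using 1[OF K] by blast
        then have "c *\<^sub>R x = (\<Sum>i<m. poly_act (Polynomial.smult c (P i)) (V (- int K) (u i)))"
          by (simp add: poly_act_smult scaleR_sum_right)
        then show ?thesis by (intro exI[of _ "\<lambda>i. Polynomial.smult c (P i)"])
      qed
      then show "c *\<^sub>R x \<in> ?S" by blast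
    qed
    have "\<exists>P. V n (u k) = (\<Sum>i<m. poly_act (P i) (V (- int K) (u i)))" if k: "k < m" and K: "K \<ge> nat (- n)" for n k K
    proof -
      define P where "P i = (if i = k then monom (1::real) (nat (n + int K)) else 0)" for i
      have "(\<Sum>i<m. poly_act (P i) (V (- int K) (u i))) = (\<Sum>i<m. if i = k then V (int (nat (n + int K))) (V (- int K) (u k)) else 0)"
        by (intro sum.cong) (auto simp: P_def poly_act_monom int_pow_on_def)
      also have "\<dots> = V (n + int K) (V (- int K) (u k))" using k K by (simp add: int_pow_on_def)
      also have "\<dots> = V n (u k)" using V_add[OF u[OF k], of "n + int K" "- int K"] by simp
      finally show ?thesis by metis
    qed
    then show "{V n x |n x. x \<in> u ` {..<m}} \<subseteq> ?S" by blast
  qed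
  then show ?thesis using h by blast
qed

lemma poly_act_Z: "F \<subseteq> E \<Longrightarrow> x \<in> orbit_span F \<Longrightarrow> poly_act p x \<in> orbit_span F"
  unfolding poly_act_def V_nat[symmetric]
  by (intro subspace_sum[OF subspace_Z] subspace_scale[OF subspace_Z] orbit_span_V)

text \<open>The openness half of the Baire argument: the coefficients that represent
  \<open>h\<close> are kept and applied to the nearby tuple \<open>v\<close>.\<close>

lemma orbit_span_perturb_generators:
  fixes u :: "nat \<Rightarrow> 'v" and m :: nat
  assumes u: "\<And>i. i < m \<Longrightarrow> u i \<in> E" and h: "h \<in> orbit_span (u ` {..<m})" and "0 < e"
  shows "\<exists>r>0. \<forall>v. (\<forall>i<m. v i \<in> E \<and> N (u i - v i) \<le> r) \<longrightarrow> (\<exists>k\<in>orbit_span (v ` {..<m}). N (h - k) < e)"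
proof -
  obtain K P where hP: "h = (\<Sum>i<m. poly_act (P i) (V (- int K) (u i)))"
    using orbit_span_representation[OF u h] by blast
  \<comment> \<open>The 1 is added so that \<open>s\<close> is positive and the final error
    \<open>(s - 1) * r\<close> is strictly below \<open>e\<close>.\<close>
  define s where "s = (\<Sum>i<m. coeff_norm (P i)) + 1"
  have s: "0 < s" unfolding s_def by (simp add: add_nonneg_pos sum_nonneg coeff_norm_nonneg)
  define r where "r = e / s"
  have "\<exists>k\<in>orbit_span (v ` {..<m}). N (h - k) < e" if v: "\<And>i. i < m \<Longrightarrow> v i \<in> E" "\<And>i. i < m \<Longrightarrow> N (u i - v i) \<le> r" for v
  proof -
    define k where "k = (\<Sum>i<m. poly_act (P i) (V (- int K) (v i)))"
    have vE: "v ` {..<m} \<subseteq> E" using v by auto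
    have "k \<in> orbit_span (v ` {..<m})"
      unfolding k_def by (intro subspace_sum[OF subspace_Z] poly_act_Z orbit_span_base vE) auto
    moreover have "N (h - k) < e"
    proof -
      have diff: "poly_act p x - poly_act p y = poly_act p (x - y)" for p x y
        using poly_act_vec_add[of p "x - y" y] by simp
      have "h - k = (\<Sum>i<m. poly_act (P i) (V (- int K) (u i - v i)))"
        unfolding hP k_def sum_subtractf[symmetric] using u v by (intro sum.cong) (auto simp: diff V_minus)
      also have "N \<dots> \<le> (\<Sum>i<m. N (poly_act (P i) (V (- int K) (u i - v i))))"
        using u v by (intro N_sum) (auto intro!: poly_act_in V_in E_closed)
      also have "\<dots> \<le> (\<Sum>i<m. coeff_norm (P i) * r)"
      proof (rule sum_mono)
        fix i assume "i \<in> {..<m}"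
        then have i: "i < m" by simp
        have d: "u i - v i \<in> E" using u v i by (auto intro!: E_closed)
        have "N (poly_act (P i) (V (- int K) (u i - v i))) \<le> coeff_norm (P i) * N (u i - v i)"
          using N_poly_act[OF V_in[OF d]] N_V[OF d] by metis
        also have "\<dots> \<le> coeff_norm (P i) * r" using v(2)[OF i] coeff_norm_nonneg by (intro mult_left_mono)
        finally show "N (poly_act (P i) (V (- int K) (u i - v i))) \<le> coeff_norm (P i) * r" .
      qed
      also have "\<dots> = (s - 1) * r" by (simp add: s_def sum_distrib_right)
      also have "\<dots> < e" using s \<open>0 < e\<close> by (simp add: r_def field_simps)
      finally show ?thesis .
    qed
    ultimately show ?thesis by blast
  qed
  moreover have "0 < r" using s \<open>0 < e\<close> by (simp add: r_def)
  ultimately show ?thesis by blast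
qed

text \<open>The density half of the Baire argument. After the matrix \<open>P\<close> is perturbed
  to \<open>Q\<close>, multiplying the new combinations by the adjugate of \<open>Q\<close> recovers
  the determinant applied to each \<open>f j\<close>, and a determinant without zeros on the unit
  circle can be cancelled.\<close>

lemma perturb_combinations:
  fixes f :: "nat \<Rightarrow> 'v" and m :: nat
  assumes f: "\<And>j. j < m \<Longrightarrow> f j \<in> E" and "0 < e"
  shows "\<exists>u. (\<forall>i<m. u i \<in> E \<and> N ((\<Sum>j<m. poly_act (P i j) (f j)) - u i) < e) \<and> (\<forall>j<m. f j \<in> orbit_closure (u ` {..<m}))"
proof -
  define M where "M = mat m m (\<lambda>(i, j). P i j)"
  define s where "s = (\<Sum>j<m. N (f j)) + 1"
  have "0 \<le> (\<Sum>j<m. N (f j))" by (intro sum_nonneg N_nonneg f) simp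
  then have s: "0 < s" unfolding s_def by linarith
  have "M \<in> carrier_mat m m" by (simp add: M_def)
  from perturb_matrix[OF this, of "e / s"] s \<open>0 < e\<close>
  obtain Q where Q: "Q \<in> carrier_mat m m" "circle_free (Determinant.det Q)"
    "\<And>i j. i < m \<Longrightarrow> j < m \<Longrightarrow> coeff_norm (Q $$ (i, j) - M $$ (i, j)) < e / s" by auto
  define u where "u i = (\<Sum>j<m. poly_act (Q $$ (i, j)) (f j))" for i
  have uE: "u i \<in> E" for i unfolding u_def using f by (intro E_closed poly_act_in) auto
  have near: "N ((\<Sum>j<m. poly_act (P i j) (f j)) - u i) < e" if i: "i < m" for i
  proof -
    have "N ((\<Sum>j<m. poly_act (P i j) (f j)) - u i) = N (u i - (\<Sum>j<m. poly_act (P i j) (f j)))"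
      using uE f by (intro N_diff_commute E_closed poly_act_in) auto
    also have "u i - (\<Sum>j<m. poly_act (P i j) (f j)) = (\<Sum>j<m. poly_act (Q $$ (i, j) - M $$ (i, j)) (f j))"
      using i by (simp add: u_def M_def poly_act_diff sum_subtractf)
    also have "N \<dots> \<le> (\<Sum>j<m. N (poly_act (Q $$ (i, j) - M $$ (i, j)) (f j)))"
      using f by (intro N_sum) (auto intro!: poly_act_in)
    also have "\<dots> \<le> (\<Sum>j<m. e / s * N (f j))"
    proof (rule sum_mono)
      fix j assume "j \<in> {..<m}"
      then have j: "j < m" by simp
      show "N (poly_act (Q $$ (i, j) - M $$ (i, j)) (f j)) \<le> e / s * N (f j)"
        using N_poly_act[OF f[OF j], of "Q $$ (i, j) - M $$ (i, j)"] Q(3)[OF i j] N_nonneg[OF f[OF j]]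
        by (meson mult_right_mono less_imp_le order_trans)
    qed
    also have "\<dots> = e / s * (s - 1)" by (simp add: s_def sum_distrib_left)
    also have "\<dots> < e" using s \<open>0 < e\<close> by (simp add: field_simps)
    finally show ?thesis .
  qed
  have "f k \<in> orbit_closure (u ` {..<m})" if k: "k < m" for k
  proof -
    let ?d = "Determinant.det Q"
    have F: "u ` {..<m} \<subseteq> E" using uE by auto
    have A: "adj_mat Q \<in> carrier_mat m m" and AQ: "adj_mat Q * Q = ?d \<cdot>\<^sub>m 1\<^sub>m m" using adj_mat[OF Q(1)] by auto
    have ent: "(\<Sum>i<m. adj_mat Q $$ (k, i) * Q $$ (i, j)) = (if k = j then ?d else 0)" if j: "j < m" for j
    proof -
      have "(adj_mat Q * Q) $$ (k, j) = (\<Sum>i<m. adj_mat Q $$ (k, i) * Q $$ (i, j))"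
        using A Q(1) j k by (auto simp: scalar_prod_def lessThan_atLeast0 intro!: sum.cong)
      moreover have "(adj_mat Q * Q) $$ (k, j) = (if k = j then ?d else 0)"
        unfolding AQ using j k by simp
      ultimately show ?thesis by metis
    qed
    have "(\<Sum>i<m. poly_act (adj_mat Q $$ (k, i)) (u i)) = (\<Sum>i<m. \<Sum>j<m. poly_act (adj_mat Q $$ (k, i) * Q $$ (i, j)) (f j))"
      by (simp add: u_def poly_act_vec_sum poly_act_mult)
    also have "\<dots> = (\<Sum>j<m. \<Sum>i<m. poly_act (adj_mat Q $$ (k, i) * Q $$ (i, j)) (f j))"
      by (rule sum.swap)
    also have "\<dots> = (\<Sum>j<m. poly_act (if k = j then ?d else 0) (f j))"
      using ent by (intro sum.cong) (auto simp: poly_act_sum[symmetric])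
    also have "\<dots> = (\<Sum>j<m. if k = j then poly_act ?d (f j) else 0)"
      by (intro sum.cong) auto
    also have "\<dots> = poly_act ?d (f k)" using k by simp
    finally have "poly_act ?d (f k) = (\<Sum>i<m. poly_act (adj_mat Q $$ (k, i)) (u i))" ..
    also have "\<dots> \<in> orbit_closure (u ` {..<m})"
    proof (intro subspace_sum[OF orbit_closure_subspace[OF F]] poly_act_orbit_closure[OF F])
      fix i assume "i \<in> {..<m}"
      then show "u i \<in> orbit_closure (u ` {..<m})"
        using orbit_span_sub_orbit_closure[OF F] orbit_span_base[of "u i" "u ` {..<m}" 0] by auto
    qed
    finally show ?thesis using orbit_closure_of_circle_free[OF F f[OF k] Q(2)] by blast
  qed
  then show ?thesis using uE near by blast
qed

section \<open>From approximate to exact generators\<close>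

definition approximable :: "nat \<Rightarrow> bool" where
  "approximable m \<longleftrightarrow> (\<forall>G e. finite G \<longrightarrow> G \<subseteq> E \<longrightarrow> 0 < e \<longrightarrow>
     (\<exists>F. finite F \<and> F \<subseteq> E \<and> card F \<le> m \<and> (\<forall>g\<in>G. \<exists>h\<in>orbit_span F. N (g - h) < e)))"

text \<open>In \<open>approximable\<close> the generators may jump when \<open>G\<close> or
  \<open>e\<close> changes; here they are brought close to a prescribed tuple \<open>u\<close> of
  the right length without loss of what they generate.\<close>

lemma approximable_near:
  assumes m: "approximable m" and u: "\<And>i. i < m \<Longrightarrow> u i \<in> E"
    and G: "finite G" "G \<subseteq> E" and e: "0 < e"
  shows "\<exists>v. (\<forall>i<m. v i \<in> E \<and> N (u i - v i) < e) \<and> (\<forall>g\<in>G. \<exists>h\<in>orbit_span (v ` {..<m}). N (g - h) < e)"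
proof -
  \<comment> \<open>The entries of \<open>u\<close> are put among the vectors to be approximated, so
    that \<open>u\<close> becomes nearly a combination of the generators in
    \<open>F\<close>.\<close>
  have "finite (G \<union> u ` {..<m})" "G \<union> u ` {..<m} \<subseteq> E" "0 < e / 2" using G u e by auto
  with m obtain F where F: "finite F" "F \<subseteq> E" "card F \<le> m"
    "\<And>g. g \<in> G \<union> u ` {..<m} \<Longrightarrow> \<exists>h\<in>orbit_span F. N (g - h) < e / 2"
    unfolding approximable_def by meson
  obtain f0 where f0: "F = f0 ` {..<card F}"
    using ex_bij_betw_nat_finite[OF F(1)] by (auto simp: bij_betw_def lessThan_atLeast0)
  \<comment> \<open>\<open>F\<close> may have fewer than \<open>m\<close> elements; padding with 0
    gives the square matrix that \<open>perturb_combinations\<close> works with.\<close>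
  define f where "f j = (if j < card F then f0 j else 0)" for j
  have fE: "f j \<in> E" for j using f0 F(2) E_closed(1) by (auto simp: f_def)
  have "F \<subseteq> f ` {..<m}"
  proof
    fix x assume "x \<in> F"
    then obtain j where "j < card F" "x = f0 j" using f0 by auto
    then show "x \<in> f ` {..<m}" using F(3) by (intro image_eqI[of _ _ j]) (auto simp: f_def)
  qed
  then have ZF: "orbit_span F \<subseteq> orbit_span (f ` {..<m})" by (rule orbit_span_mono)
  have "\<exists>w. w \<in> orbit_span (f ` {..<m}) \<and> N (u i - w) < e / 2" if "i < m" for i
    using F(4)[of "u i"] ZF that by blast
  then obtain w where w: "\<And>i. i < m \<Longrightarrow> w i \<in> orbit_span (f ` {..<m})" "\<And>i. i < m \<Longrightarrow> N (u i - w i) < e / 2"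
    by metis
  have "\<exists>K0. \<forall>K\<ge>K0. \<exists>P. w i = (\<Sum>j<m. poly_act (P j) (V (- int K) (f j)))" if "i < m" for i
    by (rule orbit_span_representation[OF fE w(1)[OF that]])
  then obtain K0 where K0: "\<And>i K. i < m \<Longrightarrow> K \<ge> K0 i \<Longrightarrow> \<exists>P. w i = (\<Sum>j<m. poly_act (P j) (V (- int K) (f j)))"
    by metis
  \<comment> \<open>The sum is a common upper bound of all \<open>K0 i\<close>, so one backward
    shift of \<open>f\<close> serves every row.\<close>
  define K where "K = (\<Sum>i<m. K0 i)"
  have "K0 i \<le> K" if "i < m" for i unfolding K_def using that by (intro member_le_sum) auto
  then have "\<exists>P. w i = (\<Sum>j<m. poly_act (P j) (V (- int K) (f j)))" if "i < m" for i
    using K0 that by blast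
  then obtain P where P: "\<And>i. i < m \<Longrightarrow> w i = (\<Sum>j<m. poly_act (P i j) (V (- int K) (f j)))" by metis
  obtain v where v: "\<And>i. i < m \<Longrightarrow> v i \<in> E"
      "\<And>i. i < m \<Longrightarrow> N ((\<Sum>j<m. poly_act (P i j) (V (- int K) (f j))) - v i) < e / 2"
      "\<And>j. j < m \<Longrightarrow> V (- int K) (f j) \<in> orbit_closure (v ` {..<m})"
    using perturb_combinations[of m "\<lambda>j. V (- int K) (f j)" "e / 2" P] V_in[OF fE] e by auto
  have vE: "v ` {..<m} \<subseteq> E" and fE': "f ` {..<m} \<subseteq> E" using v fE by auto
  have "N (u i - v i) < e" if i: "i < m" for i
    using N_diff_triangle[OF u[OF i] _ v(1)[OF i], of "w i"] w[OF i] v(2)[OF i] P[OF i] orbit_span_sub_E[OF fE'] by auto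
  moreover have "\<exists>h\<in>orbit_span (v ` {..<m}). N (g - h) < e" if g: "g \<in> G" for g
  proof -
    have "f j \<in> orbit_closure (v ` {..<m})" if "j < m" for j
      using orbit_closure_V[OF vE v(3)[OF that], of "int K"] V_add[OF fE, of "int K" "- int K" j] by simp
    then have sub: "orbit_span (f ` {..<m}) \<subseteq> orbit_closure (v ` {..<m})" by (intro orbit_span_orbit_closure_minimal vE) auto
    obtain h where h: "h \<in> orbit_span F" "N (g - h) < e / 2" using F(4) g by auto
    then have "h \<in> orbit_closure (v ` {..<m})" using ZF sub by auto
    moreover have "0 < e / 2" using e by simp
    ultimately obtain k where k: "k \<in> orbit_span (v ` {..<m})" "N (h - k) < e / 2" unfolding orbit_closure_def by blast
    have "N (g - k) \<le> N (g - h) + N (h - k)"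
      using g G h k orbit_span_sub_E[OF F(2)] orbit_span_sub_E[OF vE] by (intro N_diff_triangle) auto
    then show ?thesis using h k by force
  qed
  ultimately show ?thesis using v(1) by blast
qed

text \<open>A Baire category argument: tuples whose orbits span approximately a given finite set form
  an open dense subset of \<open>E\<^sup>m\<close>.\<close>

lemma multiplicity_le:
  fixes g :: "nat \<Rightarrow> 'v" and m :: nat
  assumes m: "approximable m"
    and g: "\<And>n. g n \<in> E" "\<And>f e. f \<in> E \<Longrightarrow> 0 < e \<Longrightarrow> \<exists>h\<in>span (range g). N (f - h) < e"
    and complete: "\<And>x. (\<And>n. x n \<in> E) \<Longrightarrow> (\<And>n. N (x n - x (Suc n)) \<le> (1/2) ^ n) \<Longrightarrow>
      \<exists>v\<in>E. (\<lambda>n. N (x n - v)) \<longlonglongrightarrow> 0"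
  shows "multiplicity_op E N U \<le> enat m"
proof -
  \<comment> \<open>A tuple that is \<open>good n\<close> for every \<open>n\<close> generates each
    \<open>g j\<close> to any accuracy.\<close>
  define good where "good n v \<longleftrightarrow> (\<forall>j<n. \<exists>h\<in>orbit_span (v ` {..<m}). N (g j - h) < 1 / real n)" for n and v :: "nat \<Rightarrow> 'v"
  \<comment> \<open>A state is a centre \<open>u\<close> with a radius \<open>r\<close> such that
    the whole closed ball, and so any limit found inside it, is \<open>good n\<close>.\<close>
  define ok where "ok n s \<longleftrightarrow> (case s of (u, r) \<Rightarrow> (\<forall>i<m. u i \<in> E) \<and> 0 < r \<and> r \<le> (1/2) ^ n \<and>
     (\<forall>v. (\<forall>i<m. v i \<in> E \<and> N (u i - v i) \<le> r) \<longrightarrow> good n v))" for n and s :: "(nat \<Rightarrow> 'v) \<times> real"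
  \<comment> \<open>Moving the centre by at most half of the radius and halving the radius keeps the
    new ball inside the old one.\<close>
  define nxt where "nxt n s t \<longleftrightarrow> (\<forall>i<m. N (fst s i - fst t i) \<le> snd s / 2) \<and> snd t \<le> snd s / 2" for n :: nat and s t :: "(nat \<Rightarrow> 'v) \<times> real"
  have base: "\<exists>s. ok 0 s"
    by (rule exI[of _ "(\<lambda>_. 0, 1)"]) (auto simp: ok_def good_def E_closed(1))
  have step: "\<exists>t. ok (Suc n) t \<and> nxt n s t" if "ok n s" for n s
  proof -
    obtain u r where s: "s = (u, r)" by (cases s)
    have u: "\<And>i. i < m \<Longrightarrow> u i \<in> E" and r: "0 < r" "r \<le> (1/2) ^ n" using that by (auto simp: ok_def s)
    define e where "e = min (r / 2) (1 / real (Suc n))"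
    have e: "0 < e" using r by (simp add: e_def)
    have "finite (g ` {..<Suc n})" "g ` {..<Suc n} \<subseteq> E" using g(1) by auto
    from approximable_near[OF m _ this e, of u] u
    obtain v where v: "\<And>i. i < m \<Longrightarrow> v i \<in> E" "\<And>i. i < m \<Longrightarrow> N (u i - v i) < e"
      "\<And>j. j < Suc n \<Longrightarrow> \<exists>h\<in>orbit_span (v ` {..<m}). N (g j - h) < e"
      by (metis imageI lessThan_iff)
    have "\<exists>r>0. \<forall>w. (\<forall>i<m. w i \<in> E \<and> N (v i - w i) \<le> r) \<longrightarrow> (\<exists>h\<in>orbit_span (w ` {..<m}). N (g j - h) < 1 / real (Suc n))"
      if j: "j < Suc n" for j
    proof -
      have vE: "v ` {..<m} \<subseteq> E" using v by auto
      obtain h where h: "h \<in> orbit_span (v ` {..<m})" "N (g j - h) < 1 / real (Suc n)" using v(3)[OF j] by (auto simp: e_def)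
      then obtain r where r: "0 < r" "\<And>w. (\<forall>i<m. w i \<in> E \<and> N (v i - w i) \<le> r) \<Longrightarrow>
          \<exists>k\<in>orbit_span (w ` {..<m}). N (h - k) < 1 / real (Suc n) - N (g j - h)"
        using orbit_span_perturb_generators[of m v h "1 / real (Suc n) - N (g j - h)"] v(1) by auto
      have "\<exists>k\<in>orbit_span (w ` {..<m}). N (g j - k) < 1 / real (Suc n)" if w: "\<forall>i<m. w i \<in> E \<and> N (v i - w i) \<le> r" for w
      proof -
        have wE: "w ` {..<m} \<subseteq> E" using w by auto
        obtain k where k: "k \<in> orbit_span (w ` {..<m})" "N (h - k) < 1 / real (Suc n) - N (g j - h)" using r(2)[OF w] by auto
        have "N (g j - k) \<le> N (g j - h) + N (h - k)"
          using g(1) h k orbit_span_sub_E[OF vE] orbit_span_sub_E[OF wE] by (intro N_diff_triangle) auto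
        then show ?thesis using k by force
      qed
      then show ?thesis using r(1) by blast
    qed
    then obtain q where q: "\<And>j. j < Suc n \<Longrightarrow> 0 < q j"
      "\<And>j w. j < Suc n \<Longrightarrow> (\<forall>i<m. w i \<in> E \<and> N (v i - w i) \<le> q j) \<Longrightarrow> \<exists>h\<in>orbit_span (w ` {..<m}). N (g j - h) < 1 / real (Suc n)"
      by metis
    define r' where "r' = Min (insert (r / 2) (q ` {..<Suc n}))"
    have "0 < r'" unfolding r'_def using q(1) r by (subst Min_gr_iff) auto
    moreover have r'2: "r' \<le> r / 2" unfolding r'_def by (intro Min_le) auto
    moreover have r'q: "r' \<le> q j" if "j < Suc n" for j unfolding r'_def using that by (intro Min_le) auto
    have "good (Suc n) w" if w: "\<forall>i<m. w i \<in> E \<and> N (v i - w i) \<le> r'" for w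
      unfolding good_def
    proof (intro allI impI)
      fix j assume j: "j < Suc n"
      then show "\<exists>h\<in>orbit_span (w ` {..<m}). N (g j - h) < 1 / real (Suc n)"
        using w r'q[OF j] by (intro q(2)) (auto intro: order_trans)
    qed
    ultimately have "ok (Suc n) (v, r')" using v(1) r(2) by (auto simp: ok_def)
    moreover have "nxt n s (v, r')"
      using v(2) r'2 by (force simp: nxt_def s e_def)
    ultimately show ?thesis by blast
  qed
  obtain S where S: "\<And>n. ok n (S n)" "\<And>n. nxt n (S n) (S (Suc n))"
    using dependent_nat_choice[of ok "\<lambda>n. nxt n"] base step by metis
  define u where "u n = fst (S n)" for n
  define r where "r n = snd (S n)" for n
  have uE: "u n i \<in> E" if "i < m" for n i using S(1)[of n] that by (auto simp: ok_def u_def split: prod.splits)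
  have r: "0 < r n" "r n \<le> (1/2) ^ n" for n using S(1)[of n] by (auto simp: ok_def r_def split: prod.splits)
  have good: "good n v" if "\<And>i. i < m \<Longrightarrow> v i \<in> E" "\<And>i. i < m \<Longrightarrow> N (u n i - v i) \<le> r n" for n v
    using S(1)[of n] that by (auto simp: ok_def r_def u_def split: prod.splits)
  have un: "N (u n i - u (Suc n) i) \<le> r n / 2" if "i < m" for n i using S(2)[of n] that by (simp add: nxt_def u_def r_def)
  have rn: "r (Suc n) \<le> r n / 2" for n using S(2)[of n] by (simp add: nxt_def r_def)
  have "\<exists>v\<in>E. (\<lambda>n. N (u n i - v)) \<longlonglongrightarrow> 0" if i: "i < m" for i
  proof (rule complete)
    show "N (u n i - u (Suc n) i) \<le> (1/2) ^ n" for n using un[OF i, of n] r[of n] by simp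
  qed (rule uE[OF i])
  then obtain v where v: "\<And>i. i < m \<Longrightarrow> v i \<in> E" "\<And>i. i < m \<Longrightarrow> (\<lambda>n. N (u n i - v i)) \<longlonglongrightarrow> 0" by metis
  \<comment> \<open>Since \<open>r (Suc n)\<close> is at most \<open>r n / 2\<close>, each move of
    the centre costs at most \<open>r n - r (Suc n)\<close>, and these differences
    telescope.\<close>
  have tail: "N (u n i - u (n + j) i) \<le> r n - r (n + j)" if i: "i < m" for n i j
  proof (induction j)
    case (Suc j)
    have "N (u n i - u (n + Suc j) i) \<le> N (u n i - u (n + j) i) + N (u (n + j) i - u (n + Suc j) i)"
      by (intro N_diff_triangle uE i)
    also have "\<dots> \<le> r n - r (n + j) + r (n + j) / 2" using Suc un[OF i, of "n + j"] by simp
    also have "\<dots> \<le> r n - r (n + Suc j)" using rn[of "n + j"] by simp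
    finally show ?case .
  qed simp
  have lim: "N (u n i - v i) \<le> r n" if i: "i < m" for n i
  proof (rule field_le_epsilon)
    fix e :: real assume "0 < e"
    then have "\<forall>\<^sub>F k in sequentially. N (u k i - v i) < e" using order_tendstoD(2)[OF v(2)[OF i]] by blast
    then obtain k where k: "k \<ge> n" "N (u k i - v i) < e"
      unfolding eventually_sequentially by (metis nle_le)
    have "N (u n i - v i) \<le> N (u n i - u k i) + N (u k i - v i)"
      by (intro N_diff_triangle uE i v(1))
    then show "N (u n i - v i) \<le> r n + e" using tail[OF i, of n "k - n"] r(1)[of k] k by simp
  qed
  let ?F = "v ` {..<m}"
  have F: "?F \<subseteq> E" using v(1) by auto
  have "g j \<in> orbit_closure ?F" for j
  proof -
    have "\<exists>h\<in>orbit_span ?F. N (g j - h) < e" if "0 < e" for e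
    proof -
      obtain n where n: "inverse (real (Suc n)) < e" using reals_Archimedean[OF \<open>0 < e\<close>] by blast
      \<comment> \<open>Larger than \<open>j\<close>, so that \<open>g j\<close> is among the
        vectors tested, and larger than \<open>n\<close>, for the accuracy.\<close>
      let ?k = "Suc (max n j)"
      have "good ?k v" by (intro good v(1) lim)
      then obtain h where h: "h \<in> orbit_span ?F" "N (g j - h) < 1 / real ?k" unfolding good_def by (meson less_Suc_eq_le max.cobounded2)
      have "1 / real ?k \<le> inverse (real (Suc n))" by (simp add: divide_simps)
      then show ?thesis using h n by force
    qed
    then show ?thesis using g(1) by (auto simp: orbit_closure_def)
  qed
  then have "span (range g) \<subseteq> orbit_closure ?F" by (intro span_minimal orbit_closure_subspace F) auto
  then have "f \<in> orbit_closure ?F" if "f \<in> E" for f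
    using g(2)[OF that] that by (intro orbit_closure_closed F) blast+
  then have "dense_in_seminorm E N (orbit_span ?F)"
    using orbit_span_sub_E[OF F] by (auto simp: dense_in_seminorm_def orbit_closure_def)
  then have "multiplicity_op E N U \<le> enat (card ?F)"
    unfolding multiplicity_op_def orbit_span_def using F by (intro INF_lower) auto
  also have "\<dots> \<le> enat m" using card_image_le[of "{..<m}" v] by simp
  finally show ?thesis .
qed

end

section \<open>Right special words and branches\<close>

definition shift_by :: "int \<Rightarrow> (int \<Rightarrow> 'a) \<Rightarrow> (int \<Rightarrow> 'a)" where
  "shift_by i x = (\<lambda>n. x (n + i))"

definition word :: "nat \<Rightarrow> (int \<Rightarrow> 'a) \<Rightarrow> 'a list" where
  "word n x = map (\<lambda>i. x (int i)) [0..<n]"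

lemma shift_by_shift_by [simp]: "shift_by i (shift_by j x) = shift_by (i + j) x"
  by (simp add: shift_by_def algebra_simps)

lemma shift_by_0 [simp]: "shift_by 0 x = x"
  by (simp add: shift_by_def)

lemma shift_map_eq_shift_by: "shift_map = shift_by 1"
  by (simp add: shift_map_def shift_by_def fun_eq_iff)

lemma shift_map_funpow: "(shift_map ^^ n) x = shift_by (int n) x"
  by (induction n) (simp_all add: shift_map_eq_shift_by add.commute)

lemma word_eq_iff: "word n x = word n y \<longleftrightarrow> (\<forall>i<n. x (int i) = y (int i))"
  by (auto simp: word_def)

lemma butlast_word: "butlast (word (Suc n) x) = word n x"
  by (simp add: word_def)

lemma word_Suc_shift_by: "word (Suc n) x = word (Suc n) y \<Longrightarrow> word n (shift_by 1 x) = word n (shift_by 1 y)"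
  unfolding word_eq_iff shift_by_def by (metis Suc_less_eq of_nat_Suc add.commute)

lemma word_eq_mono: "word n x = word n y \<Longrightarrow> m \<le> n \<Longrightarrow> word m x = word m y"
  by (auto simp: word_eq_iff)

text \<open>In a product of discrete spaces, agreement with \<open>z\<close> on growing windows
  means convergence to \<open>z\<close>.\<close>

lemma closed_pointwise:
  fixes X :: "(int \<Rightarrow> 'a::discrete_topology) set"
  assumes X: "closed X" and z: "\<And>m::nat. \<exists>x\<in>X. \<forall>i. \<bar>i\<bar> \<le> int m \<longrightarrow> x i = z i"
  shows "z \<in> X"
proof -
  obtain x where x: "\<And>m. x m \<in> X" "\<And>m i. \<bar>i\<bar> \<le> int m \<Longrightarrow> x m i = z i" using z by metis
  have "((\<lambda>m. x m i) \<longlongrightarrow> z i) sequentially" for i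
  proof (rule tendsto_eventually)
    show "\<forall>\<^sub>F m in sequentially. x m i = z i"
      using eventually_ge_at_top[of "nat \<bar>i\<bar>"] by eventually_elim (simp add: x(2))
  qed
  then have "limitin (product_topology (\<lambda>_. euclidean) UNIV) x z sequentially"
    by (simp add: limitin_componentwise)
  then have "(x \<longlongrightarrow> z) sequentially" by (simp add: euclidean_product_topology)
  then show ?thesis using Lim_in_closed_set[OF X always_eventually sequentially_bot] x(1) by blast
qed

locale aperiodic_subshift =
  fixes A :: "'a::discrete_topology set" and X :: "(int \<Rightarrow> 'a) set"
  assumes finite_A: "finite A" and subshift: "subshift A X" and aperiodic: "aperiodic X"
begin

lemma X_ne: "X \<noteq> {}" and X_sub: "x \<in> X \<Longrightarrow> x i \<in> A" and closed_X: "closed X"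
  and shift_X: "shift_map ` X = X"
  using subshift by (auto simp: subshift_def)

lemma shift_by_in_iff [simp]: "shift_by i x \<in> X \<longleftrightarrow> x \<in> X"
proof -
  have 1: "shift_by 1 y \<in> X \<longleftrightarrow> y \<in> X" for y using shift_mem_iff[OF shift_X] by (simp add: shift_map_eq_shift_by)
  show ?thesis
  proof (induction i rule: int_induct[where k = 0])
    case (step1 i)
    then show ?case using 1[of "shift_by i x"] by (simp add: add.commute)
  next
    case (step2 i)
    then show ?case using 1[of "shift_by (i - 1) x"] by simp
  qed simp
qed

lemma no_period:
  assumes x: "x \<in> X" and q: "0 < q"
  shows "\<exists>i. x (i + int q) \<noteq> x i"
proof (rule ccontr)
  assume "\<not> ?thesis"
  then have "(shift_map ^^ q) x = x" by (simp add: shift_map_funpow shift_by_def)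
  then show False using aperiodic x q unfolding aperiodic_def by blast
qed

text \<open>A point that is periodic on the right half line has shifts converging to a two-sided
  periodic point, which closedness puts into \<open>X\<close>.\<close>

lemma no_eventual_period:
  assumes y: "y \<in> X" and q: "0 < q"
  shows "\<exists>i::nat. y (int i + int q) \<noteq> y (int i)"
proof (rule ccontr)
  assume "\<not> ?thesis"
  then have per: "y (int i + int q) = y (int i)" for i by auto
  have per': "y (int i + int j * int q) = y (int i)" for i j
  proof (induction j)
    case (Suc j)
    then show ?case using per[of "i + j * q"] by (simp add: algebra_simps)
  qed simp
  \<comment> \<open>The periodic continuation to both sides; shifting \<open>y\<close> by multiples
    of \<open>q\<close> makes it agree with \<open>z\<close> on arbitrarily long windows.\<close>
  define z where "z i = y (i mod int q)" for i
  have "z \<in> X"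
  proof (rule closed_pointwise[OF closed_X])
    fix m :: nat
    have "shift_by (int m * int q) y i = z i" if i: "\<bar>i\<bar> \<le> int m" for i
    proof -
      have "\<bar>i\<bar> \<le> int m * int q" using i q by (smt (verit) mult_le_cancel_left1 of_nat_0_le_iff of_nat_0_less_iff)
      then have 0: "0 \<le> i + int m * int q" by linarith
      define w where "w = nat (i + int m * int q)"
      have w: "int w = i + int m * int q" using 0 by (simp add: w_def)
      have "y (int w) = y (int (w mod q))"
        using per'[of "w mod q" "w div q"] by (metis mod_mult_div_eq mult.commute of_nat_add of_nat_mult)
      also have "int (w mod q) = i mod int q" by (simp add: zmod_int w)
      finally show ?thesis by (simp add: shift_by_def z_def w)
    qed
    then show "\<exists>x\<in>X. \<forall>i. \<bar>i\<bar> \<le> int m \<longrightarrow> x i = z i" using y by (intro bexI[of _ "shift_by (int m * int q) y"]) auto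
  qed
  moreover have "z (i + int q) = z i" for i by (simp add: z_def)
  ultimately show False using no_period q by blast
qed

section \<open>Words and their extensions\<close>

definition language :: "nat \<Rightarrow> 'a list set" where
  "language n = word n ` X"

lemma word_complexity_eq: "word_complexity X n = card (language n)"
proof -
  have "{map (\<lambda>i. x (j + int i)) [0..<n] |x j. x \<in> X} = language n"
  proof safe
    fix x j assume "x \<in> X"
    moreover have "map (\<lambda>i. x (j + int i)) [0..<n] = word n (shift_by j x)"
      by (simp add: word_def shift_by_def add.commute)
    ultimately show "map (\<lambda>i. x (j + int i)) [0..<n] \<in> language n" by (auto simp: language_def)
  next
    fix w assume "w \<in> language n"
    then obtain x where "x \<in> X" "w = word n x" by (auto simp: language_def)
    then show "\<exists>x j. w = map (\<lambda>i. x (j + int i)) [0..<n] \<and> x \<in> X"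
      by (intro exI[of _ x] exI[of _ 0]) (simp add: word_def)
  qed
  then show ?thesis by (simp add: word_complexity_def)
qed

lemma finite_language: "finite (language n)"
proof (rule finite_subset)
  show "language n \<subseteq> {w. set w \<subseteq> A \<and> length w = n}"
    using X_sub by (auto simp: language_def word_def)
qed (rule finite_lists_length_eq[OF finite_A])

definition extensions :: "nat \<Rightarrow> 'a list \<Rightarrow> 'a list set" where
  "extensions n w = {e \<in> language (Suc n). butlast e = w}"

definition right_special :: "nat \<Rightarrow> 'a list set" where
  "right_special n = {w \<in> language n. 2 \<le> card (extensions n w)}"

definition branches :: "nat \<Rightarrow> 'a list set" where
  "branches n = {e \<in> language (Suc n). butlast e \<in> right_special n}"

lemma finite_extensions: "finite (extensions n w)"
  using finite_language by (simp add: extensions_def)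

lemma finite_branches: "finite (branches n)"
  using finite_language by (simp add: branches_def)

text \<open>Summing over words with \<open>c\<close> extensions each, it is enough that
  \<open>c + 2\<close> is at most \<open>2 * c\<close> when \<open>c\<close> is at least 2, and that
  \<open>0 + 2\<close> is at most \<open>2 * c\<close> when \<open>c\<close> is 1.\<close>

lemma card_branches: "card (branches n) + 2 * card (language n) \<le> 2 * card (language (Suc n))"
proof -
  have U: "language (Suc n) = (\<Union>w\<in>language n. extensions n w)"
    by (auto simp: extensions_def language_def butlast_word)
  have disj: "\<forall>v\<in>W. \<forall>w\<in>W. v \<noteq> w \<longrightarrow> extensions n v \<inter> extensions n w = {}" for W
    by (auto simp: extensions_def)
  have c: "card (language (Suc n)) = (\<Sum>w\<in>language n. card (extensions n w))"
    unfolding U by (intro card_UN_disjoint finite_language disj ballI finite_extensions)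
  have "branches n = (\<Union>w\<in>right_special n. extensions n w)"
    by (auto simp: branches_def extensions_def)
  moreover have "finite (right_special n)" using finite_language by (simp add: right_special_def)
  ultimately have "card (branches n) = (\<Sum>w\<in>right_special n. card (extensions n w))"
    using card_UN_disjoint[OF _ _ disj] finite_extensions by metis
  also have "\<dots> = (\<Sum>w\<in>language n. if 2 \<le> card (extensions n w) then card (extensions n w) else 0)"
    unfolding right_special_def by (rule sum.inter_filter[OF finite_language])
  finally have b: "card (branches n) = (\<Sum>w\<in>language n. if 2 \<le> card (extensions n w) then card (extensions n w) else 0)" .
  have "(\<Sum>w\<in>language n. (if 2 \<le> card (extensions n w) then card (extensions n w) else 0) + 2)
      \<le> (\<Sum>w\<in>language n. 2 * card (extensions n w))"
  proof (rule sum_mono)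
    fix w assume w: "w \<in> language n"
    then have "extensions n w \<noteq> {}" by (auto simp: language_def extensions_def butlast_word)
    then have "0 < card (extensions n w)" using finite_extensions by (simp add: card_gt_0_iff)
    then show "(if 2 \<le> card (extensions n w) then card (extensions n w) else 0) + 2 \<le> 2 * card (extensions n w)" by auto
  qed
  then show ?thesis unfolding b c by (simp add: sum.distrib sum_distrib_left del: add_2_eq_Suc' add_2_eq_Suc)
qed

definition marked :: "nat \<Rightarrow> (int \<Rightarrow> 'a) \<Rightarrow> bool" where
  "marked n x \<longleftrightarrow> word n x \<in> right_special n"

lemma unmarked_word_Suc:
  assumes "x \<in> X" "y \<in> X" "word n x = word n y" "\<not> marked n x"
  shows "word (Suc n) x = word (Suc n) y"
proof -
  have "word (Suc n) x \<in> extensions n (word n x)" "word (Suc n) y \<in> extensions n (word n x)"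
    using assms by (auto simp: extensions_def language_def butlast_word)
  moreover have "card (extensions n (word n x)) \<le> Suc 0"
    using assms by (auto simp: marked_def right_special_def language_def)
  ultimately show ?thesis using card_le_Suc0_iff_eq[OF finite_extensions] by blast
qed

text \<open>An unmarked word has only one continuation, so the initial data propagate. The start
  itself may be marked; therefore \<open>Suc n\<close> letters are prescribed there, and marks are
  excluded only from time 1 on.\<close>

lemma word_determined:
  assumes "x \<in> X" "y \<in> X" "word (Suc n) x = word (Suc n) y"
    and "\<And>t. 1 \<le> t \<Longrightarrow> t < s \<Longrightarrow> \<not> marked n (shift_by (int t) x)" and "t \<le> s"
  shows "word n (shift_by (int t) x) = word n (shift_by (int t) y)"
  using \<open>t \<le> s\<close>
proof (induction t)
  case 0
  then show ?case using word_eq_mono[OF assms(3)] by simp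
next
  case (Suc t)
  have "word (Suc n) (shift_by (int t) x) = word (Suc n) (shift_by (int t) y)"
  proof (cases "t = 0")
    case False
    then show ?thesis using Suc assms by (intro unmarked_word_Suc) auto
  qed (use assms(3) in simp)
  from word_Suc_shift_by[OF this] show ?case by (simp add: add.commute)
qed

text \<open>Among one more window than there are words, two coincide. If all windows up to the
  second were unmarked, both would continue in the same way forever and the point would be
  eventually periodic.\<close>

lemma exists_marked:
  assumes x: "x \<in> X"
  shows "\<exists>t\<le>card (language n). marked n (shift_by (int t) x)"
proof (rule ccontr)
  assume *: "\<not> ?thesis"
  let ?W = "\<lambda>t::nat. word n (shift_by (int t) x)"
  have "\<not> inj_on ?W {..card (language n)}"
  proof
    assume "inj_on ?W {..card (language n)}"
    then have "card {..card (language n)} \<le> card (language n)"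
      using x by (intro card_inj_on_le finite_language) (auto simp: language_def)
    then show False by simp
  qed
  then obtain a b where ab: "a < b" "b \<le> card (language n)" "?W a = ?W b"
    unfolding inj_on_def by (metis atMost_iff linorder_neqE_nat)
  have un: "\<not> marked n (shift_by (int t) x)" if "t \<le> b" for t using * ab that by auto
  define q where "q = b - a"
  have q: "0 < q" "b = a + q" using ab by (auto simp: q_def)
  \<comment> \<open>Beyond the second occurrence, the absence of marks is inherited from the equal
    window \<open>q\<close> steps earlier; hence both statements are proved in one
    induction.\<close>
  have per: "?W (a + j) = ?W (b + j) \<and> \<not> marked n (shift_by (int (a + j)) x)" for j
  proof (induction j rule: less_induct)
    case (less j)
    have um: "\<not> marked n (shift_by (int (a + j)) x)"
    proof (cases "j \<le> q")
      case False
      then have "?W (a + (j - q)) = ?W (b + (j - q)) \<and> \<not> marked n (shift_by (int (a + (j - q))) x)"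
        using q by (intro less) auto
      moreover have "b + (j - q) = a + j" using False q by auto
      ultimately show ?thesis unfolding marked_def by metis
    next
      case True
      then show ?thesis using un[of "a + j"] q by simp
    qed
    have "?W (a + j) = ?W (b + j)"
    proof (cases j)
      case (Suc i)
      have "?W (a + i) = ?W (b + i) \<and> \<not> marked n (shift_by (int (a + i)) x)" using less[of i] Suc by simp
      then have "word (Suc n) (shift_by (int (a + i)) x) = word (Suc n) (shift_by (int (b + i)) x)"
        using x by (intro unmarked_word_Suc) auto
      from word_Suc_shift_by[OF this] show ?thesis by (simp add: Suc add.commute add.left_commute)
    qed (use ab in simp)
    then show ?case using um by simp
  qed
  have "shift_by (int a) x (int i + int q) = shift_by (int a) x (int i)" for i
  proof -
    have "?W (a + i) = ?W (b + i) \<and> \<not> marked n (shift_by (int (a + i)) x)" by (rule per)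
    then have "word (Suc n) (shift_by (int (a + i)) x) = word (Suc n) (shift_by (int (b + i)) x)"
      using x by (intro unmarked_word_Suc) auto
    then have "shift_by (int (a + i)) x (int 0) = shift_by (int (b + i)) x (int 0)"
      unfolding word_eq_iff by blast
    then show ?thesis by (simp add: shift_by_def q algebra_simps)
  qed
  then show False using no_eventual_period[of "shift_by (int a) x" q] x q(1) by auto
qed

section \<open>The most recent branch and the time since then\<close>

definition age :: "nat \<Rightarrow> (int \<Rightarrow> 'a) \<Rightarrow> nat" where
  "age n y = (LEAST s. marked n (shift_by (- int s) y))"

definition branch :: "nat \<Rightarrow> (int \<Rightarrow> 'a) \<Rightarrow> 'a list" where
  "branch n y = word (Suc n) (shift_by (- int (age n y)) y)"

lemma
  assumes y: "y \<in> X"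
  shows age_le: "age n y \<le> card (language n)"
    and marked_age: "marked n (shift_by (- int (age n y)) y)"
proof -
  let ?M = "card (language n)"
  \<comment> \<open>The search for a mark starts \<open>?M\<close> steps in the past, so the mark
    that \<open>exists_marked\<close> finds lies between there and the present.\<close>
  obtain t where t: "t \<le> ?M" "marked n (shift_by (int t) (shift_by (- int ?M) y))"
    using exists_marked[of "shift_by (- int ?M) y" n] y by auto
  then have "marked n (shift_by (- int (?M - t)) y)" by (simp add: of_nat_diff)
  then show "age n y \<le> ?M" "marked n (shift_by (- int (age n y)) y)"
    unfolding age_def by (auto intro: LeastI Least_le[THEN order_trans])
qed

lemma unmarked_before_age: "s < age n y \<Longrightarrow> \<not> marked n (shift_by (- int s) y)"
  unfolding age_def by (rule not_less_Least)

lemma branch_in: "y \<in> X \<Longrightarrow> branch n y \<in> branches n"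
  using marked_age[of y n] by (auto simp: branches_def branch_def butlast_word marked_def language_def)

text \<open>No mark occurs along \<open>y\<close> after its last edge, so \<open>z\<close> is forced
  to follow \<open>y\<close> from that edge on and to have the same marks. A nonempty set of points
  with given branch and age is therefore a full shifted cylinder.\<close>

lemma branch_level:
  assumes y: "y \<in> X" and z: "z \<in> X" and eq: "word (Suc n) (shift_by (- int (age n y)) z) = branch n y"
  shows "age n z = age n y" "branch n z = branch n y" "word n z = word n y"
proof -
  let ?s = "age n y"
  have w: "word n (shift_by (int t) (shift_by (- int ?s) y)) = word n (shift_by (int t) (shift_by (- int ?s) z))" if "t \<le> ?s" for t
  proof (rule word_determined[where s = ?s])
    show "word (Suc n) (shift_by (- int ?s) y) = word (Suc n) (shift_by (- int ?s) z)" using eq by (simp add: branch_def)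
    show "\<not> marked n (shift_by (int t) (shift_by (- int ?s) y))" if "1 \<le> t" "t < ?s" for t
      using unmarked_before_age[of "?s - t" n y] that by (simp add: of_nat_diff)
  qed (use y z that in auto)
  have m: "marked n (shift_by (- int j) z) \<longleftrightarrow> marked n (shift_by (- int j) y)" if "j \<le> ?s" for j
    using w[of "?s - j"] that by (simp add: marked_def of_nat_diff)
  have "marked n (shift_by (- int ?s) z)" using m marked_age[OF y] by simp
  moreover have "?s \<le> j" if "marked n (shift_by (- int j) z)" for j
    using m[of j] unmarked_before_age[of j n y] that by (meson not_le_imp_less less_imp_le)
  ultimately show "age n z = ?s" unfolding age_def[of n z] by (intro Least_equality)
  then show "branch n z = branch n y" using eq by (simp add: branch_def)
  show "word n z = word n y" using w[of ?s] by simp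
qed

definition branch_base :: "nat \<Rightarrow> 'a list \<Rightarrow> (int \<Rightarrow> 'a) \<Rightarrow> real" where
  "branch_base n e x = (if x \<in> X \<and> word (Suc n) x = e then 1 else 0)"

text \<open>Branch and age partition \<open>X\<close> into sets on which \<open>\<phi>\<close> is
  constant and whose indicators are shifts of \<open>branch_base\<close>. The subset
  \<open>S\<close> keeps some of the columns only, which is the form used for ergodic
  measures.\<close>

lemma word_function_representation:
  fixes \<phi> :: "(int \<Rightarrow> 'a) \<Rightarrow> real"
  assumes \<phi>: "\<And>x y. x \<in> X \<Longrightarrow> y \<in> X \<Longrightarrow> word n x = word n y \<Longrightarrow> \<phi> x = \<phi> y" and S: "S \<subseteq> branches n"
  shows "\<exists>c. \<forall>x. (if x \<in> X \<and> branch n x \<in> S then \<phi> x else 0) =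
     (\<Sum>e\<in>S. \<Sum>s\<le>card (language n). c e s * branch_base n e (shift_by (- int s) x))"
proof -
  let ?M = "card (language n)"
  define L where "L e s y \<longleftrightarrow> y \<in> X \<and> branch n y = e \<and> age n y = s" for e s y
  \<comment> \<open>The value 0 matters: if no point has branch \<open>e\<close> and age
    \<open>s\<close>, the shifted base may still contain points with a more recent mark.\<close>
  define c where "c e s = (if \<exists>y. L e s y then \<phi> (SOME y. L e s y) else 0)" for e s
  have fS: "finite S" using S finite_branches finite_subset by blast
  have *: "c e s * branch_base n e (shift_by (- int s) x) = (if s = age n x \<and> e = branch n x then \<phi> x else 0)" if x: "x \<in> X" for x e s
  proof (cases "\<exists>y. L e s y")
    case True
    define y where "y = (SOME y. L e s y)"
    have y: "L e s y" unfolding y_def using True by (rule someI_ex)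
    then have yX: "y \<in> X" "branch n y = e" "age n y = s" by (auto simp: L_def)
    have c: "c e s = \<phi> y" using True by (simp add: c_def y_def)
    show ?thesis
    proof (cases "word (Suc n) (shift_by (- int s) x) = e")
      case eq: True
      then have "age n x = s" "branch n x = e" "word n x = word n y"
        using branch_level[OF yX(1) x, of n] yX by auto
      then show ?thesis using \<phi>[OF x yX(1)] x eq by (simp add: branch_base_def c)
    next
      case False
      then have "\<not> (s = age n x \<and> e = branch n x)" by (auto simp: branch_def)
      then show ?thesis using False by (auto simp: branch_base_def)
    qed
  next
    case False
    then have "\<not> (s = age n x \<and> e = branch n x)" using x by (auto simp: L_def)
    then show ?thesis using False by (auto simp: c_def)
  qed
  have 1: "(\<Sum>e\<in>S. \<Sum>s\<le>?M. c e s * branch_base n e (shift_by (- int s) x)) = (if branch n x \<in> S then \<phi> x else 0)" if x: "x \<in> X" for x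
  proof -
    have "(\<Sum>e\<in>S. \<Sum>s\<le>?M. c e s * branch_base n e (shift_by (- int s) x)) = (\<Sum>e\<in>S. \<Sum>s\<le>?M. if s = age n x then if e = branch n x then \<phi> x else 0 else 0)"
      using * x by (intro sum.cong) auto
    also have "\<dots> = (\<Sum>e\<in>S. if e = branch n x then \<phi> x else 0)"
      using age_le[OF x, of n] by (simp add: sum.delta)
    finally show ?thesis using fS by (simp add: sum.delta)
  qed
  have 2: "(\<Sum>e\<in>S. \<Sum>s\<le>?M. c e s * branch_base n e (shift_by (- int s) x)) = 0" if "x \<notin> X" for x
    using that by (simp add: branch_base_def)
  show ?thesis
  proof (intro exI allI)
    fix x
    show "(if x \<in> X \<and> branch n x \<in> S then \<phi> x else 0) = (\<Sum>e\<in>S. \<Sum>s\<le>?M. c e s * branch_base n e (shift_by (- int s) x))"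
      using 1[of x] 2[of x] by (cases "x \<in> X") simp_all
  qed
qed

text \<open>If more than \<open>2 * k\<close> edges occurred for all \<open>n\<close> from
  \<open>N\<close> on, then by \<open>card_branches\<close> the complexity would grow by at least
  \<open>k + 1\<close> per step, with a lower limit of the quotient above \<open>k\<close>.\<close>

lemma frequently_few_branches:
  assumes "liminf (\<lambda>n. ereal (real (word_complexity X n) / real n)) \<le> ereal (real k)"
  shows "\<exists>n\<ge>N. card (branches n) \<le> 2 * k"
proof (rule ccontr)
  let ?p = "\<lambda>n. card (language n)"
  assume *: "\<not> ?thesis"
  have inc: "?p n + k + 1 \<le> ?p (Suc n)" if "n \<ge> N" for n
    using * that card_branches[of n] by force
  have lower: "(k + 1) * j \<le> ?p (N + j)" for j
  proof (induction j)
    case (Suc j)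
    then show ?case using inc[of "N + j"] by simp
  qed simp
  \<comment> \<open>The threshold makes \<open>(k + 1) * (n - N)\<close> at least
    \<open>(k + 1/2) * n\<close>; the extra 1 keeps \<open>n\<close> positive for the
    division.\<close>
  have "ereal (real k + 1 / 2) \<le> ereal (real (word_complexity X n) / real n)" if n: "n \<ge> 2 * (k + 1) * N + 1" for n
  proof -
    have nN: "N \<le> n" using n by (metis add_leE le_trans mult_le_mono1 mult_1 Suc_eq_plus1 le_add2 mult_2 add_mult_distrib le_add1)
    have "real (k + 1) * (real n - real N) \<le> real (?p n)"
      using lower[of "n - N"] nN by (metis of_nat_diff of_nat_mono of_nat_mult le_add_diff_inverse)
    moreover have "real (2 * (k + 1) * N + 1) \<le> real n" using n of_nat_mono by blast
    then have "2 * real k * real N + 2 * real N + 1 \<le> real n" by (simp add: algebra_simps)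
    ultimately have "(real k + 1 / 2) * real n \<le> real (?p n)" by (simp add: algebra_simps)
    moreover have "0 < real n" using n by simp
    ultimately show ?thesis by (simp add: word_complexity_eq pos_le_divide_eq)
  qed
  then have "ereal (real k + 1 / 2) \<le> liminf (\<lambda>n. ereal (real (word_complexity X n) / real n))"
    by (intro Liminf_bounded) (auto simp: eventually_sequentially)
  then have "ereal (real k + 1 / 2) \<le> ereal (real k)" using assms order_trans by blast
  then show False by simp
qed

end

section \<open>Topological multiplicity\<close>

lemma linear_koopman: "linear koopman"
  by (rule linearI) (simp_all add: koopman_def fun_eq_iff scaleR_fun_def)

lemma koopman_shift_by: "koopman (f \<circ> shift_by i) = f \<circ> shift_by (i + 1)"
  by (simp add: koopman_def shift_map_eq_shift_by fun_eq_iff)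

lemma int_pow_koopman:
  assumes E: "bij_betw koopman E E" and f: "f \<in> E"
  shows "int_pow_on E koopman n f = f \<circ> shift_by n"
proof -
  have pos: "(koopman ^^ i) f = f \<circ> shift_by (int i)" for i
  proof (induction i)
    case (Suc i)
    have "(koopman ^^ Suc i) f = koopman (f \<circ> shift_by (int i))" unfolding funpow.simps(2) comp_apply Suc.IH ..
    also have "\<dots> = f \<circ> shift_by (int (Suc i))" unfolding koopman_shift_by by (simp only: of_nat_Suc add.commute)
    finally show ?case .
  qed (simp add: comp_def)
  \<comment> \<open>\<open>inv_into\<close> is controlled only on the image of \<open>E\<close>, so
    membership in \<open>E\<close> is carried through the induction.\<close>
  have neg: "(inv_into E koopman ^^ i) f = f \<circ> shift_by (- int i) \<and> f \<circ> shift_by (- int i) \<in> E" for i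
  proof (induction i)
    case 0
    then show ?case using f by (simp add: comp_def)
  next
    case (Suc i)
    then obtain g where g: "g \<in> E" "koopman g = f \<circ> shift_by (- int i)"
      using E by (metis bij_betw_imp_surj_on imageE)
    have "g = f \<circ> shift_by (- int (Suc i))"
    proof
      fix x
      have "g x = koopman g (shift_by (-1) x)" by (simp add: koopman_def shift_map_eq_shift_by)
      then show "g x = (f \<circ> shift_by (- int (Suc i))) x" by (simp add: g(2) algebra_simps)
    qed
    moreover have "inv_into E koopman (f \<circ> shift_by (- int i)) = g"
      using E g by (metis bij_betw_imp_inj_on inv_into_f_f)
    moreover have "(inv_into E koopman ^^ Suc i) f = inv_into E koopman (f \<circ> shift_by (- int i))"
      using Suc by (metis comp_apply funpow.simps(2))
    ultimately show ?case using g(1) by metis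
  qed
  show ?thesis using pos[of "nat n"] neg[of "nat (- n)"] by (simp add: int_pow_on_def)
qed

context aperiodic_subshift
begin

section \<open>Centred windows and locally constant functions\<close>

definition agree :: "nat \<Rightarrow> (int \<Rightarrow> 'a) \<Rightarrow> (int \<Rightarrow> 'a) \<Rightarrow> bool" where
  "agree r x y \<longleftrightarrow> (\<forall>i. \<bar>i\<bar> \<le> int r \<longrightarrow> x i = y i)"

lemma agree_mono: "agree r x y \<Longrightarrow> q \<le> r \<Longrightarrow> agree q x y"
  by (auto simp: agree_def)

lemma agree_sym: "agree r x y \<Longrightarrow> agree r y x"
  and agree_trans: "agree r x y \<Longrightarrow> agree r y z \<Longrightarrow> agree r x z"
  by (simp_all add: agree_def)

text \<open>Centred windows suit the topology, words starting at 0 suit the combinatorics; a shift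
  by \<open>r\<close> translates between them.\<close>

lemma agree_iff_word: "agree r x y \<longleftrightarrow> word (2 * r + 1) (shift_by (- int r) x) = word (2 * r + 1) (shift_by (- int r) y)"
proof
  assume "agree r x y"
  then show "word (2 * r + 1) (shift_by (- int r) x) = word (2 * r + 1) (shift_by (- int r) y)"
    by (auto simp: word_eq_iff agree_def shift_by_def)
next
  assume *: "word (2 * r + 1) (shift_by (- int r) x) = word (2 * r + 1) (shift_by (- int r) y)"
  show "agree r x y"
    unfolding agree_def
  proof (intro allI impI)
    fix i assume i: "\<bar>i\<bar> \<le> int r"
    then have "nat (i + int r) < 2 * r + 1" by linarith
    with * have "shift_by (- int r) x (int (nat (i + int r))) = shift_by (- int r) y (int (nat (i + int r)))"
      unfolding word_eq_iff by blast
    moreover have "int (nat (i + int r)) = i + int r" using i by linarith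
    ultimately show "x i = y i" by (simp add: shift_by_def)
  qed
qed

lemma open_agree: "open {y. agree r x y}"
proof -
  have eq: "{y. agree r x y} = (\<Inter>i\<in>{- int r..int r}. (\<lambda>y. y i) -` {x i})"
    unfolding agree_def abs_le_iff by force
  show ?thesis
    unfolding eq
    by (intro open_INT ballI open_vimage discrete_topology_class.open_discrete continuous_on_product_coordinates)
      (auto intro: discrete_topology_class.open_discrete)
qed

lemma open_contains_agree:
  assumes "open S" "x \<in> S"
  shows "\<exists>r. \<forall>y. agree r x y \<longrightarrow> y \<in> S"
proof -
  have "openin (product_topology (\<lambda>_. euclidean) UNIV) S"
    using assms by (simp add: euclidean_product_topology)
  then obtain U where U: "finite {i. U i \<noteq> (UNIV :: 'a set)}" "x \<in> Pi\<^sub>E UNIV U" "Pi\<^sub>E UNIV U \<subseteq> S"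
    using assms(2) unfolding openin_product_topology_alt by fastforce
  define r where "r = (\<Sum>i | U i \<noteq> UNIV. nat \<bar>i\<bar>)"
  have "y \<in> S" if y: "agree r x y" for y
  proof -
    have "y i \<in> U i" for i
    proof (cases "U i = UNIV")
      case False
      then have "nat \<bar>i\<bar> \<le> r" unfolding r_def using U(1) by (intro member_le_sum) auto
      then have "\<bar>i\<bar> \<le> int r" by linarith
      then have "x i = y i" using y unfolding agree_def by blast
      then show ?thesis using U(2) by (metis PiE_mem UNIV_I)
    qed simp
    then show ?thesis using U(3) by auto
  qed
  then show ?thesis by blast
qed

lemma compact_X: "compact X"
proof -
  have "compactin (product_topology (\<lambda>_. euclidean) UNIV) (Pi\<^sub>E UNIV (\<lambda>_::int. A))"
    unfolding compactin_PiE using finite_A by (simp add: finite_imp_compact)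
  then have "compact (Pi\<^sub>E UNIV (\<lambda>_::int. A))"
    by (simp add: euclidean_product_topology)
  moreover have "X = X \<inter> Pi\<^sub>E UNIV (\<lambda>_::int. A)" using X_sub by (auto simp: PiE_iff)
  ultimately show ?thesis using closed_X compact_Int_closed by (metis inf_commute)
qed

text \<open>Uniform continuity by compactness: finitely many neighbourhoods cover \<open>X\<close>,
  and the sum of their radii bounds each of them.\<close>

lemma uniformly_locally_constant:
  fixes f :: "(int \<Rightarrow> 'a) \<Rightarrow> real"
  assumes f: "continuous_on X f" and e: "0 < e"
  shows "\<exists>r. \<forall>x\<in>X. \<forall>y\<in>X. agree r x y \<longrightarrow> \<bar>f x - f y\<bar> < e"
proof -
  have "\<exists>r. \<forall>y\<in>X. agree r x y \<longrightarrow> \<bar>f x - f y\<bar> < e / 2" if x: "x \<in> X" for x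
  proof -
    obtain S where S: "open S" "S \<inter> X = f -` ball (f x) (e / 2) \<inter> X"
      using f unfolding continuous_on_open_invariant by (metis open_ball)
    have "x \<in> S" using S(2) x e by auto
    with open_contains_agree[OF S(1)] obtain r where "\<forall>y. agree r x y \<longrightarrow> y \<in> S" by blast
    then have "\<forall>y\<in>X. agree r x y \<longrightarrow> dist (f x) (f y) < e / 2" using S(2) by auto
    then show ?thesis by (auto simp: dist_real_def)
  qed
  then obtain q where q: "\<And>x y. x \<in> X \<Longrightarrow> y \<in> X \<Longrightarrow> agree (q x) x y \<Longrightarrow> \<bar>f x - f y\<bar> < e / 2" by metis
  have "X \<subseteq> (\<Union>x\<in>X. {y. agree (q x) x y})" by (auto simp: agree_def)
  then obtain D where D: "D \<subseteq> X" "finite D" "X \<subseteq> (\<Union>x\<in>D. {y. agree (q x) x y})"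
    by (rule compactE_image[OF compact_X, of X "\<lambda>x. {y. agree (q x) x y}", OF open_agree])
  define r where "r = (\<Sum>x\<in>D. q x)"
  have "\<bar>f x - f y\<bar> < e" if xy: "x \<in> X" "y \<in> X" "agree r x y" for x y
  proof -
    obtain z where z: "z \<in> D" "agree (q z) z x" using D(3) xy(1) by auto
    have "q z \<le> r" unfolding r_def using z D by (intro member_le_sum) auto
    then have "agree (q z) z y" using z(2) xy(3) agree_mono agree_trans by blast
    then have "\<bar>f z - f y\<bar> < e / 2" "\<bar>f z - f x\<bar> < e / 2" using q z D xy by auto
    then show ?thesis by linarith
  qed
  then show ?thesis by blast
qed

definition cylindrical :: "nat \<Rightarrow> ((int \<Rightarrow> 'a) \<Rightarrow> real) \<Rightarrow> bool" where
  "cylindrical r f \<longleftrightarrow> (\<forall>x. x \<notin> X \<longrightarrow> f x = 0) \<and> (\<forall>x\<in>X. \<forall>y\<in>X. agree r x y \<longrightarrow> f x = f y)"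

lemma cylindrical_mono: "cylindrical q f \<Longrightarrow> q \<le> r \<Longrightarrow> cylindrical r f"
  unfolding cylindrical_def using agree_mono by blast

definition cylinder_indicator :: "nat \<Rightarrow> 'a list \<Rightarrow> (int \<Rightarrow> 'a) \<Rightarrow> real" where
  "cylinder_indicator r w x = (if x \<in> X \<and> word (2 * r + 1) (shift_by (- int r) x) = w then 1 else 0)"

text \<open>The countable family that \<open>multiplicity_le\<close> requires: its span contains all
  cylindrical functions, which are dense in both kinds of spaces.\<close>

definition cylinder_indicators :: "((int \<Rightarrow> 'a) \<Rightarrow> real) set" where
  "cylinder_indicators = (\<Union>r. cylinder_indicator r ` language (2 * r + 1))"

lemma countable_cylinder_indicators: "countable cylinder_indicators"
  unfolding cylinder_indicators_def
  by (rule countable_UN) (auto intro!: countable_finite finite_imageI finite_language)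

lemma cylinder_indicators_ne: "cylinder_indicators \<noteq> {}"
  using X_ne by (auto simp: cylinder_indicators_def language_def)

lemma cylindrical_indicator: "f \<in> cylinder_indicators \<Longrightarrow> \<exists>r. cylindrical r f"
proof -
  assume "f \<in> cylinder_indicators"
  then obtain r w where f: "f = cylinder_indicator r w" unfolding cylinder_indicators_def by blast
  have "cylindrical r f" by (simp add: f cylindrical_def cylinder_indicator_def agree_iff_word)
  then show ?thesis ..
qed

lemma sum_fun_apply: "(\<Sum>i\<in>I. f i) x = (\<Sum>i\<in>I. (f i x :: real))"
  by (induction I rule: infinite_finite_induct) simp_all

lemma cylindrical_in_span:
  assumes f: "cylindrical r f"
  shows "f \<in> span cylinder_indicators"
proof -
  let ?w = "\<lambda>x. word (2 * r + 1) (shift_by (- int r) x)"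
  define c where "c w = f (SOME x. x \<in> X \<and> ?w x = w)" for w
  have c: "c (?w x) = f x" if x: "x \<in> X" for x
  proof -
    define y where "y = (SOME y. y \<in> X \<and> ?w y = ?w x)"
    have "y \<in> X \<and> ?w y = ?w x" unfolding y_def by (rule someI[where x = x]) (simp add: x)
    then show ?thesis using f x unfolding c_def y_def[symmetric] cylindrical_def agree_iff_word by blast
  qed
  have "f = (\<Sum>w\<in>language (2 * r + 1). c w *\<^sub>R cylinder_indicator r w)"
  proof
    fix x
    show "f x = (\<Sum>w\<in>language (2 * r + 1). c w *\<^sub>R cylinder_indicator r w) x"
    proof (cases "x \<in> X")
      case True
      then have w: "?w x \<in> language (2 * r + 1)" by (auto simp: language_def)
      have "(\<Sum>w\<in>language (2 * r + 1). c w *\<^sub>R cylinder_indicator r w) x = (\<Sum>w\<in>language (2 * r + 1). if w = ?w x then c w else 0)"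
        unfolding sum_fun_apply using True by (intro sum.cong) (auto simp: scaleR_fun_def cylinder_indicator_def)
      also have "\<dots> = c (?w x)" using w finite_language by simp
      finally show ?thesis using c[OF True] by simp
    next
      case False
      then have "(\<Sum>w\<in>language (2 * r + 1). c w *\<^sub>R cylinder_indicator r w) x = 0"
        unfolding sum_fun_apply by (intro sum.neutral) (auto simp: scaleR_fun_def cylinder_indicator_def)
      then show ?thesis using f False by (simp add: cylindrical_def)
    qed
  qed
  also have "\<dots> \<in> span cylinder_indicators"
    by (intro span_sum span_scale span_base) (auto simp: cylinder_indicators_def)
  finally show ?thesis .
qed

lemma cylindrical_continuous: assumes f: "cylindrical r f" shows "continuous_on X f"
  unfolding continuous_on_open_invariant
proof (intro allI impI)
  fix B :: "real set"
  show "\<exists>S. open S \<and> S \<inter> X = f -` B \<inter> X"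
  proof (intro exI conjI)
    show "open (\<Union>x\<in>X \<inter> f -` B. {y. agree r x y})" using open_agree by auto
    show "(\<Union>x\<in>X \<inter> f -` B. {y. agree r x y}) \<inter> X = f -` B \<inter> X"
    proof (intro equalityI subsetI)
      fix y assume "y \<in> (\<Union>x\<in>X \<inter> f -` B. {y. agree r x y}) \<inter> X"
      then obtain x where x: "x \<in> X" "f x \<in> B" "agree r x y" "y \<in> X" by blast
      then have "f x = f y" using f unfolding cylindrical_def by blast
      then show "y \<in> f -` B \<inter> X" using x by simp
    next
      fix y assume y: "y \<in> f -` B \<inter> X"
      have "agree r y y" by (simp add: agree_def)
      then show "y \<in> (\<Union>x\<in>X \<inter> f -` B. {y. agree r x y}) \<inter> X" using y by blast
    qed
  qed
qed

text \<open>A function of the coordinates from \<open>- r\<close> to \<open>r\<close> becomes one of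
  the first \<open>2 * r + 1\<close> coordinates after a shift by \<open>r\<close>; undoing it
  accounts for the extra \<open>- int r\<close>.\<close>

lemma cylindrical_representation:
  assumes f: "cylindrical r f" and n: "2 * r + 1 \<le> n" and S: "S \<subseteq> branches n"
  shows "\<exists>c. \<forall>x. (if x \<in> X \<and> branch n (shift_by (- int r) x) \<in> S then f x else 0) =
     (\<Sum>e\<in>S. \<Sum>s\<le>card (language n). c e s * branch_base n e (shift_by (- int s - int r) x))"
proof -
  have "(f \<circ> shift_by (int r)) x = (f \<circ> shift_by (int r)) y" if xy: "x \<in> X" "y \<in> X" "word n x = word n y" for x y
  proof -
    have "word (2 * r + 1) x = word (2 * r + 1) y" by (rule word_eq_mono[OF xy(3) n])
    then have "agree r (shift_by (int r) x) (shift_by (int r) y)" by (simp add: agree_iff_word)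
    then show ?thesis using f xy by (simp add: cylindrical_def)
  qed
  from word_function_representation[where \<phi> = "f \<circ> shift_by (int r)", OF this S] obtain c where c:
    "\<And>x. (if x \<in> X \<and> branch n x \<in> S then (f \<circ> shift_by (int r)) x else 0) =
       (\<Sum>e\<in>S. \<Sum>s\<le>card (language n). c e s * branch_base n e (shift_by (- int s) x))" by blast
  show ?thesis
  proof (intro exI allI)
    fix x
    show "(if x \<in> X \<and> branch n (shift_by (- int r) x) \<in> S then f x else 0) =
      (\<Sum>e\<in>S. \<Sum>s\<le>card (language n). c e s * branch_base n e (shift_by (- int s - int r) x))"
      using c[of "shift_by (- int r) x"] by (simp only: comp_apply shift_by_shift_by shift_by_in_iff uminus_add_conv_diff right_minus shift_by_0 add_uminus_conv_diff)
  qed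
qed

lemma branch_base_cylindrical: "cylindrical (Suc n) (branch_base n e)"
proof -
  have "word (Suc n) x = word (Suc n) y" if "agree (Suc n) x y" for x y
    using that unfolding agree_def word_eq_iff by simp
  then show ?thesis by (simp add: cylindrical_def branch_base_def)
qed

section \<open>Continuous functions with the supremum norm\<close>

lemma C_space_I: "continuous_on X f \<Longrightarrow> (\<And>x. x \<notin> X \<Longrightarrow> f x = 0) \<Longrightarrow> f \<in> C_space X"
  by (simp add: C_space_def)

lemma cylindrical_in_C_space: "cylindrical r f \<Longrightarrow> f \<in> C_space X"
  using cylindrical_continuous by (auto simp: C_space_def cylindrical_def)

lemma abs_le_sup_norm:
  assumes "f \<in> C_space X" "x \<in> X"
  shows "\<bar>f x\<bar> \<le> sup_norm_on X f"
  unfolding sup_norm_on_def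
proof (rule cSUP_upper[OF assms(2)])
  have "compact ((\<lambda>x. \<bar>f x\<bar>) ` X)"
    using assms by (intro compact_continuous_image continuous_intros compact_X) (simp add: C_space_def)
  then show "bdd_above ((\<lambda>x. \<bar>f x\<bar>) ` X)"
    by (intro bounded_imp_bdd_above compact_imp_bounded)
qed

lemma sup_norm_le: "(\<And>x. x \<in> X \<Longrightarrow> \<bar>f x\<bar> \<le> c) \<Longrightarrow> sup_norm_on X f \<le> c"
  unfolding sup_norm_on_def using X_ne by (intro cSUP_least)

lemma subspace_C_space: "subspace (C_space X)"
  by (auto simp: subspace_def C_space_def zero_fun_def plus_fun_def scaleR_fun_def intro!: continuous_intros)

lemma isometric_C_space: "isometric_bijection (C_space X) (sup_norm_on X) koopman"
proof (rule isometric_bijection.intro)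
  show "subspace (C_space X)" by (rule subspace_C_space)
  show "linear koopman" by (rule linear_koopman)
  show "bij_betw koopman (C_space X) (C_space X)" by (rule koopman_bij_betw_C_space[OF shift_X])
next
  fix f g assume fg: "f \<in> C_space X" "g \<in> C_space X"
  show "sup_norm_on X (f + g) \<le> sup_norm_on X f + sup_norm_on X g"
  proof (rule sup_norm_le)
    fix x assume "x \<in> X"
    then show "\<bar>(f + g) x\<bar> \<le> sup_norm_on X f + sup_norm_on X g"
      using abs_le_sup_norm[OF fg(1), of x] abs_le_sup_norm[OF fg(2), of x] by simp
  qed
next
  fix c f assume f: "f \<in> C_space X"
  have le: "sup_norm_on X (c *\<^sub>R f) \<le> \<bar>c\<bar> * sup_norm_on X f" if f: "f \<in> C_space X" for c f
    using abs_le_sup_norm[OF f] by (intro sup_norm_le) (simp add: scaleR_fun_def abs_mult mult_left_mono)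
  show "sup_norm_on X (c *\<^sub>R f) = \<bar>c\<bar> * sup_norm_on X f"
  proof (cases "c = 0")
    case True
    have "0 \<le> sup_norm_on X (0 *\<^sub>R f)"
      using abs_le_sup_norm[of "0 *\<^sub>R f"] X_ne subspace_0[OF subspace_C_space] by fastforce
    then show ?thesis using le[OF f, of c] True by simp
  next
    case False
    have "sup_norm_on X f = sup_norm_on X (inverse c *\<^sub>R (c *\<^sub>R f))" using False by simp
    also have "\<dots> \<le> \<bar>inverse c\<bar> * sup_norm_on X (c *\<^sub>R f)"
      by (intro le subspace_scale[OF subspace_C_space] f)
    finally show ?thesis using le[OF f, of c] False by (simp add: field_simps)
  qed
next
  fix f assume "f \<in> C_space X"
  have "sup_norm_on X (koopman f) = (SUP x\<in>shift_map ` X. \<bar>f x\<bar>)"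
    by (simp add: sup_norm_on_def koopman_def image_image)
  then show "sup_norm_on X (koopman f) = sup_norm_on X f"
    by (simp add: shift_X sup_norm_on_def)
qed

lemma complete_C_space:
  assumes u: "\<And>n. u n \<in> C_space X" and le: "\<And>n. sup_norm_on X (u n - u (Suc n)) \<le> (1/2) ^ n"
  shows "\<exists>v\<in>C_space X. (\<lambda>n. sup_norm_on X (u n - v)) \<longlonglongrightarrow> 0"
proof -
  define d where "d n x = u (Suc n) x - u n x" for n x
  define v where "v x = u 0 x + (\<Sum>n. d n x)" for x
  have cont: "continuous_on X (u n)" for n using u by (simp add: C_space_def)
  have "norm (d n x) \<le> (1/2) ^ n" if "x \<in> X" for n x
    using abs_le_sup_norm[OF subspace_diff[OF subspace_C_space u u] that, of n "Suc n"] le[of n]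
    by (simp add: d_def abs_minus_commute)
  then have "uniform_limit X (\<lambda>n x. \<Sum>i<n. d i x) (\<lambda>x. \<Sum>i. d i x) sequentially"
    by (rule Weierstrass_m_test) (auto intro!: summable_geometric)
  then have "uniform_limit X (\<lambda>n x. u 0 x + (\<Sum>i<n. d i x)) v sequentially"
    unfolding v_def by (intro uniform_limit_add uniform_limit_const)
  moreover have "u 0 x + (\<Sum>i<n. d i x) = u n x" for n x
    unfolding d_def by (subst sum_lessThan_telescope) simp
  ultimately have lim: "uniform_limit X u v sequentially" by simp
  have v: "v \<in> C_space X"
  proof (rule C_space_I)
    show "continuous_on X v"
      by (rule uniform_limit_theorem[OF _ lim]) (simp_all add: cont)
    show "v x = 0" if "x \<notin> X" for x using that u by (simp add: v_def d_def C_space_def)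
  qed
  interpret C: isometric_bijection "C_space X" "sup_norm_on X" koopman by (rule isometric_C_space)
  have "(\<lambda>n. sup_norm_on X (u n - v)) \<longlonglongrightarrow> 0"
  proof (rule LIMSEQ_I)
    fix e :: real assume "0 < e"
    then have "\<forall>\<^sub>F n in sequentially. \<forall>x\<in>X. dist (u n x) (v x) < e / 2"
      using lim unfolding uniform_limit_iff by (meson half_gt_zero)
    then obtain n0 where n0: "\<And>n x. n \<ge> n0 \<Longrightarrow> x \<in> X \<Longrightarrow> dist (u n x) (v x) < e / 2"
      unfolding eventually_sequentially by blast
    have "norm (sup_norm_on X (u n - v) - 0) < e" if "n \<ge> n0" for n
    proof -
      have "sup_norm_on X (u n - v) \<le> e / 2"
        using n0[OF that] by (intro sup_norm_le) (auto simp: dist_real_def intro: less_imp_le)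
      moreover have "0 \<le> sup_norm_on X (u n - v)"
        by (intro C.N_nonneg C.E_closed u v)
      ultimately show ?thesis using \<open>0 < e\<close> by simp
    qed
    then show "\<exists>n0. \<forall>n\<ge>n0. norm (sup_norm_on X (u n - v) - 0) < e" by blast
  qed
  then show ?thesis using v by blast
qed

text \<open>Stated for every large \<open>r\<close>, so that finitely many functions can be
  approximated with a common \<open>r\<close>.\<close>

lemma cylindrical_uniform_approximation:
  assumes g: "g \<in> C_space X" and "0 < e"
  shows "\<exists>q. \<forall>r\<ge>q. \<exists>f. cylindrical r f \<and> sup_norm_on X (g - f) < e"
proof -
  have "continuous_on X g" "0 < e / 2" using g \<open>0 < e\<close> by (auto simp: C_space_def)
  from uniformly_locally_constant[OF this]
  obtain q where q: "\<And>x y. x \<in> X \<Longrightarrow> y \<in> X \<Longrightarrow> agree q x y \<Longrightarrow> \<bar>g x - g y\<bar> < e / 2" by blast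
  have "\<exists>f. cylindrical r f \<and> sup_norm_on X (g - f) < e" if r: "r \<ge> q" for r
  proof -
    define f where "f x = (if x \<in> X then g (SOME y. y \<in> X \<and> agree r x y) else 0)" for x
    have "f x = f y" if "x \<in> X" "y \<in> X" "agree r x y" for x y
    proof -
      have "(\<lambda>z. z \<in> X \<and> agree r x z) = (\<lambda>z. z \<in> X \<and> agree r y z)"
        using that agree_sym agree_trans by blast
      then show ?thesis using that by (simp add: f_def)
    qed
    then have "cylindrical r f" unfolding cylindrical_def by (auto simp: f_def)
    moreover have "\<bar>(g - f) x\<bar> \<le> e / 2" if x: "x \<in> X" for x
    proof -
      define y where "y = (SOME y. y \<in> X \<and> agree r x y)"
      have "y \<in> X \<and> agree r x y" unfolding y_def by (rule someI[of _ x]) (simp add: x agree_def)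
      then have "\<bar>g x - g y\<bar> < e / 2" using q x agree_mono[OF _ r] by blast
      then show ?thesis using x by (simp add: f_def y_def)
    qed
    then have "sup_norm_on X (g - f) \<le> e / 2" by (rule sup_norm_le)
    ultimately show ?thesis using \<open>0 < e\<close> by force
  qed
  then show ?thesis by blast
qed

text \<open>With a common radius \<open>r\<close> for the finite set to be approximated, an
  \<open>n\<close> of at least \<open>2 * r + 1\<close> with few edges is chosen. The bases of all
  columns then generate every cylindrical function of radius \<open>r\<close> exactly.\<close>

lemma top_mult_le:
  assumes k: "liminf (\<lambda>n. ereal (real (word_complexity X n) / real n)) \<le> ereal (real k)"
  shows "top_mult X \<le> enat (2 * k)"
proof -
  interpret C: isometric_bijection "C_space X" "sup_norm_on X" koopman by (rule isometric_C_space)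
  have V: "C.V n f = f \<circ> shift_by n" if "f \<in> C_space X" for n f
    by (rule int_pow_koopman[OF koopman_bij_betw_C_space[OF shift_X] that])
  have "C.approximable (2 * k)"
    unfolding C.approximable_def
  proof (intro allI impI)
    fix G and e :: real assume G: "finite G" "G \<subseteq> C_space X" and e: "0 < e"
    have "\<exists>q. \<forall>r\<ge>q. \<exists>f. cylindrical r f \<and> sup_norm_on X (g - f) < e" if "g \<in> G" for g
      using cylindrical_uniform_approximation[OF _ e] that G by blast
    then obtain q where q: "\<And>g r. g \<in> G \<Longrightarrow> r \<ge> q g \<Longrightarrow> \<exists>f. cylindrical r f \<and> sup_norm_on X (g - f) < e" by metis
    define r where "r = (\<Sum>g\<in>G. q g)"
    have qr: "q g \<le> r" if "g \<in> G" for g unfolding r_def using that G by (intro member_le_sum) auto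
    obtain n where n: "2 * r + 1 \<le> n" "card (branches n) \<le> 2 * k" using frequently_few_branches[OF k] by blast
    define F where "F = branch_base n ` branches n"
    have F: "F \<subseteq> C_space X" using branch_base_cylindrical cylindrical_in_C_space by (auto simp: F_def)
    have "f \<in> C.orbit_span F" if f: "cylindrical r f" for f
    proof -
      obtain c where c: "\<And>x. (if x \<in> X \<and> branch n (shift_by (- int r) x) \<in> branches n then f x else 0) =
          (\<Sum>e\<in>branches n. \<Sum>s\<le>card (language n). c e s * branch_base n e (shift_by (- int s - int r) x))"
        using cylindrical_representation[OF f n(1) order_refl] by blast
      have "f = (\<Sum>e\<in>branches n. \<Sum>s\<le>card (language n). c e s *\<^sub>R C.V (- int s - int r) (branch_base n e))"
      proof
        fix x
        have "f x = (if x \<in> X \<and> branch n (shift_by (- int r) x) \<in> branches n then f x else 0)"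
          using f branch_in[of "shift_by (- int r) x" n] by (auto simp: cylindrical_def)
        then show "f x = (\<Sum>e\<in>branches n. \<Sum>s\<le>card (language n). c e s *\<^sub>R C.V (- int s - int r) (branch_base n e)) x"
          unfolding c sum_fun_apply using F by (simp add: scaleR_fun_def V F_def image_subset_iff)
      qed
      also have "\<dots> \<in> C.orbit_span F"
        by (intro subspace_sum[OF C.subspace_Z] subspace_scale[OF C.subspace_Z] C.orbit_span_base) (auto simp: F_def)
      finally show ?thesis .
    qed
    then have "\<forall>g\<in>G. \<exists>h\<in>C.orbit_span F. sup_norm_on X (g - h) < e" using q qr by blast
    moreover have "finite F" "card F \<le> 2 * k"
      using n(2) finite_branches card_image_le[OF finite_branches, of "branch_base n" n] by (auto simp: F_def)
    ultimately show "\<exists>F. finite F \<and> F \<subseteq> C_space X \<and> card F \<le> 2 * k \<and> (\<forall>g\<in>G. \<exists>h\<in>C.orbit_span F. sup_norm_on X (g - h) < e)"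
      using F by blast
  qed
  moreover define g where "g = from_nat_into cylinder_indicators"
  have g: "range g = cylinder_indicators"
    unfolding g_def using countable_cylinder_indicators cylinder_indicators_ne by (rule range_from_nat_into[rotated])
  moreover have "g n \<in> C_space X" for n
    using g cylindrical_indicator cylindrical_in_C_space by blast
  moreover have "\<exists>h\<in>span (range g). sup_norm_on X (f - h) < e" if "f \<in> C_space X" "0 < e" for f e
    using cylindrical_uniform_approximation[OF that] cylindrical_in_span unfolding g by blast
  ultimately show ?thesis
    unfolding top_mult_def by (intro C.multiplicity_le[where g = g] complete_C_space) simp_all
qed

end

section \<open>Square integrable functions\<close>

context prob_space
begin

definition square_integrable :: "('a \<Rightarrow> real) \<Rightarrow> bool" where
  "square_integrable f \<longleftrightarrow> f \<in> borel_measurable M \<and> integrable M (\<lambda>x. (f x)\<^sup>2)"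

lemma square_integrable_measurable: "square_integrable f \<Longrightarrow> f \<in> borel_measurable M"
  by (simp add: square_integrable_def)

lemma square_integrable_mult:
  assumes f: "square_integrable f" and g: "square_integrable g"
  shows "integrable M (\<lambda>x. f x * g x)"
proof (rule Bochner_Integration.integrable_bound)
  show "integrable M (\<lambda>x. (f x)\<^sup>2 + (g x)\<^sup>2)" "(\<lambda>x. f x * g x) \<in> borel_measurable M"
    using f g by (auto simp: square_integrable_def)
  have "\<bar>a * b\<bar> \<le> a\<^sup>2 + b\<^sup>2" for a b :: real
  proof -
    have "0 \<le> (\<bar>a\<bar> - \<bar>b\<bar>)\<^sup>2" by simp
    then have "2 * (\<bar>a\<bar> * \<bar>b\<bar>) \<le> a\<^sup>2 + b\<^sup>2" by (simp add: power2_diff)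
    then show ?thesis by (simp add: abs_mult) (smt (verit) mult_nonneg_nonneg abs_ge_zero)
  qed
  then show "AE x in M. norm (f x * g x) \<le> norm ((f x)\<^sup>2 + (g x)\<^sup>2)" by simp
qed

lemma square_integrable_const [simp]: "square_integrable (\<lambda>x. c)"
  by (simp add: square_integrable_def)

lemma square_integrable_integrable: "square_integrable f \<Longrightarrow> integrable M f"
  using square_integrable_mult[of f "\<lambda>_. 1"] by simp

lemma square_integrable_add:
  assumes "square_integrable f" "square_integrable g"
  shows "square_integrable (\<lambda>x. f x + g x)"
  using assms square_integrable_mult[OF assms]
  by (auto simp: square_integrable_def power2_sum mult.assoc intro!: borel_measurable_add)

lemma square_integrable_scale: "square_integrable f \<Longrightarrow> square_integrable (\<lambda>x. c * f x)"
  by (auto simp: square_integrable_def power_mult_distrib intro!: borel_measurable_times)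

lemma square_integrable_diff:
  assumes "square_integrable f" "square_integrable g"
  shows "square_integrable (\<lambda>x. f x - g x)"
  using square_integrable_add[OF assms(1) square_integrable_scale[OF assms(2), of "-1"]] by simp

lemma L2_norm_nonneg [simp]: "0 \<le> L2_norm M f"
  by (simp add: L2_norm_def)

lemma L2_norm_power2: "(L2_norm M f)\<^sup>2 = (\<integral>x. (f x)\<^sup>2 \<partial>M)"
  by (simp add: L2_norm_def)

lemma L2_norm_cong: "(\<And>x. x \<in> space M \<Longrightarrow> f x = g x) \<Longrightarrow> L2_norm M f = L2_norm M g"
  unfolding L2_norm_def by (intro arg_cong[where f = sqrt] Bochner_Integration.integral_cong) auto

text \<open>Cauchy-Schwarz, from the fact that the quadratic polynomial in \<open>t\<close> given by
  the integral of \<open>(f x + t * g x)^2\<close> is nonnegative.\<close>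

lemma integral_mult_le_L2_norm:
  assumes f: "square_integrable f" and g: "square_integrable g"
  shows "(\<integral>x. f x * g x \<partial>M) \<le> L2_norm M f * L2_norm M g"
proof -
  define a where "a = (\<integral>x. (f x)\<^sup>2 \<partial>M)"
  define b where "b = (\<integral>x. f x * g x \<partial>M)"
  define c where "c = (\<integral>x. (g x)\<^sup>2 \<partial>M)"
  have q: "0 \<le> a + 2 * t * b + t\<^sup>2 * c" for t
  proof -
    have "0 \<le> (\<integral>x. (f x + t * g x)\<^sup>2 \<partial>M)" by simp
    also have "\<dots> = (\<integral>x. (f x)\<^sup>2 + (2 * t * (f x * g x) + t\<^sup>2 * (g x)\<^sup>2) \<partial>M)"
      by (intro Bochner_Integration.integral_cong) (auto simp: power2_sum power_mult_distrib)
    also have "\<dots> = a + (2 * t * b + t\<^sup>2 * c)"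
      using f g square_integrable_mult[OF f g] by (simp add: a_def b_def c_def square_integrable_def)
    finally show ?thesis by simp
  qed
  have c: "0 \<le> c" "0 \<le> a" by (simp_all add: c_def a_def)
  have "b\<^sup>2 \<le> a * c"
  proof (cases "c = 0")
    case True
    have "b = 0"
    proof (rule ccontr)
      assume "b \<noteq> 0"
      \<comment> \<open>With \<open>c = 0\<close> the polynomial is affine, and at this
        \<open>t\<close> its value is -1.\<close>
      then show False using q[of "- (a + 1) / (2 * b)"] True by (simp add: field_simps)
    qed
    then show ?thesis using c by simp
  next
    case False
    \<comment> \<open>The minimiser of the quadratic polynomial.\<close>
    then show ?thesis using q[of "- b / c"] c by (simp add: field_simps power2_eq_square)
  qed
  then have "sqrt (b\<^sup>2) \<le> sqrt (a * c)" by (rule real_sqrt_le_mono)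
  then have "\<bar>b\<bar> \<le> sqrt a * sqrt c" by (simp add: real_sqrt_mult)
  then show ?thesis by (simp add: L2_norm_def a_def b_def c_def)
qed

lemma L2_norm_triangle:
  assumes f: "square_integrable f" and g: "square_integrable g"
  shows "L2_norm M (\<lambda>x. f x + g x) \<le> L2_norm M f + L2_norm M g"
proof -
  have "(L2_norm M (\<lambda>x. f x + g x))\<^sup>2 = (\<integral>x. (f x)\<^sup>2 + (2 * (f x * g x) + (g x)\<^sup>2) \<partial>M)"
    unfolding L2_norm_power2 by (intro Bochner_Integration.integral_cong) (auto simp: power2_sum)
  also have "\<dots> = (L2_norm M f)\<^sup>2 + (2 * (\<integral>x. f x * g x \<partial>M) + (L2_norm M g)\<^sup>2)"
    using f g square_integrable_mult[OF f g] by (simp add: L2_norm_power2 square_integrable_def)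
  also have "\<dots> \<le> (L2_norm M f + L2_norm M g)\<^sup>2"
    using integral_mult_le_L2_norm[OF f g] by (simp add: power2_sum)
  finally show ?thesis by (rule power2_le_imp_le) simp
qed

lemma L2_norm_scale: "L2_norm M (\<lambda>x. c * f x) = \<bar>c\<bar> * L2_norm M f"
  by (simp add: L2_norm_def power_mult_distrib real_sqrt_mult)

lemma integral_abs_le_L2_norm:
  assumes f: "square_integrable f"
  shows "(\<integral>x. \<bar>f x\<bar> \<partial>M) \<le> L2_norm M f"
proof -
  have "square_integrable (\<lambda>x. \<bar>f x\<bar>)" using f by (auto simp: square_integrable_def intro!: borel_measurable_abs)
  from integral_mult_le_L2_norm[OF this square_integrable_const[of 1]]
  show ?thesis by (simp add: L2_norm_def prob_space)
qed

lemma abs_integral_le_L2_norm: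
  assumes f: "square_integrable f"
  shows "\<bar>\<integral>x. f x \<partial>M\<bar> \<le> L2_norm M f"
  using integral_abs_bound[of M f] integral_abs_le_L2_norm[OF f] by linarith

lemma L2_norm_centered:
  assumes f: "square_integrable f"
  shows "L2_norm M (\<lambda>x. f x - (\<integral>x. f x \<partial>M)) \<le> L2_norm M f"
proof -
  have i: "integrable M f" "integrable M (\<lambda>x. (f x)\<^sup>2)" using f square_integrable_integrable[OF f] by (simp_all add: square_integrable_def)
  have "(\<integral>x. (f x - (\<integral>x. f x \<partial>M))\<^sup>2 \<partial>M) = (\<integral>x. (f x)\<^sup>2 \<partial>M) - (\<integral>x. f x \<partial>M)\<^sup>2"
    using variance_eq[OF i] .
  also have "\<dots> \<le> (\<integral>x. (f x)\<^sup>2 \<partial>M)" by simp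
  finally show ?thesis by (simp add: L2_norm_def)
qed

text \<open>Riesz-Fischer: a rapidly Cauchy sequence converges almost everywhere, and Fatou's lemma
  identifies the pointwise limit as the limit in \<open>L\<^sup>2\<close>.\<close>

lemma L2_complete:
  assumes u: "\<And>n. square_integrable (u n)"
    and le: "\<And>n. L2_norm M (\<lambda>x. u n x - u (Suc n) x) \<le> (1/2) ^ n"
  shows "\<exists>v. square_integrable v \<and> (\<lambda>n. L2_norm M (\<lambda>x. u n x - v x)) \<longlonglongrightarrow> 0"
proof -
  have um [measurable]: "u n \<in> borel_measurable M" for n using u by (simp add: square_integrable_def)
  define d where "d n x = \<bar>u n x - u (Suc n) x\<bar>" for n x
  have dm [measurable]: "d n \<in> borel_measurable M" for n unfolding d_def by measurable
  have "(\<integral>\<^sup>+ x. ennreal (d n x) \<partial>M) \<le> ennreal ((1/2) ^ n)" for n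
  proof -
    have s: "square_integrable (\<lambda>x. u n x - u (Suc n) x)" by (intro square_integrable_diff u)
    have "(\<integral>\<^sup>+ x. ennreal (d n x) \<partial>M) = ennreal (\<integral>x. d n x \<partial>M)"
      using square_integrable_integrable[OF s] unfolding d_def
      by (intro nn_integral_eq_integral) auto
    then show ?thesis using integral_abs_le_L2_norm[OF s] le[of n] by (simp add: ennreal_leI d_def)
  qed
  then have "(\<Sum>n. \<integral>\<^sup>+ x. ennreal (d n x) \<partial>M) \<le> (\<Sum>n. ennreal ((1/2) ^ n))"
    by (intro suminf_le) auto
  also have "\<dots> = ennreal (\<Sum>n. (1/2) ^ n)"
    by (intro suminf_ennreal2) (auto intro!: summable_geometric)
  finally have "(\<integral>\<^sup>+ x. (\<Sum>n. ennreal (d n x)) \<partial>M) < \<infinity>"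
    by (subst nn_integral_suminf) (auto simp: le_less_trans)
  then have "AE x in M. (\<Sum>n. ennreal (d n x)) \<noteq> \<infinity>"
    by (intro nn_integral_PInf_AE) auto
  then have conv: "AE x in M. (\<lambda>n. u n x) \<longlonglongrightarrow> lim (\<lambda>n. u n x)"
  proof eventually_elim
    case (elim x)
    have "0 \<le> d n x" for n by (simp add: d_def)
    then have "summable (\<lambda>n. d n x)"
      using elim unfolding infinity_ennreal_def by (rule summable_suminf_not_top)
    then have "summable (\<lambda>n. \<bar>u n x - u (Suc n) x\<bar>)" by (simp only: d_def)
    then have "summable (\<lambda>n. u n x - u (Suc n) x)" by (rule summable_rabs_cancel)
    then have "summable (\<lambda>n. - (u n x - u (Suc n) x))" by (rule summable_minus)
    then have "summable (\<lambda>n. u (Suc n) x - u n x)" by (simp only: minus_diff_eq)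
    then have "convergent (\<lambda>n. \<Sum>i<n. u (Suc i) x - u i x)" by (simp add: summable_iff_convergent)
    then have "convergent (\<lambda>n. u 0 x + (\<Sum>i<n. u (Suc i) x - u i x))" by (intro convergent_add convergent_const)
    moreover have "u 0 x + (\<Sum>i<n. u (Suc i) x - u i x) = u n x" for n by (subst sum_lessThan_telescope) simp
    ultimately show ?case by (simp add: convergent_LIMSEQ_iff)
  qed
  \<comment> \<open>On the null set without convergence \<open>lim\<close> has an arbitrary value;
    \<open>v\<close> is nevertheless measurable.\<close>
  define v where "v x = lim (\<lambda>n. u n x)" for x
  have vm [measurable]: "v \<in> borel_measurable M" unfolding v_def by measurable
  have tri: "L2_norm M (\<lambda>x. f x - h x) \<le> L2_norm M (\<lambda>x. f x - g x) + L2_norm M (\<lambda>x. g x - h x)"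
    if "square_integrable f" "square_integrable g" "square_integrable h" for f g h
    using L2_norm_triangle[of "\<lambda>x. f x - g x" "\<lambda>x. g x - h x"] square_integrable_diff that by simp
  \<comment> \<open>The right-hand side is the sum of \<open>(1/2) ^ i\<close> for \<open>i\<close>
    from \<open>n\<close> to \<open>n + j - 1\<close>.\<close>
  have tail: "L2_norm M (\<lambda>x. u n x - u (n + j) x) \<le> 2 * (1/2) ^ n - 2 * (1/2) ^ (n + j)" for n j
  proof (induction j)
    case (Suc j)
    have "L2_norm M (\<lambda>x. u n x - u (n + Suc j) x) \<le> L2_norm M (\<lambda>x. u n x - u (n + j) x) + L2_norm M (\<lambda>x. u (n + j) x - u (n + Suc j) x)"
      by (intro tri u)
    then show ?case using Suc le[of "n + j"] by simp
  qed (simp add: L2_norm_def)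
  have fatou: "(\<integral>\<^sup>+ x. ennreal ((u n x - v x)\<^sup>2) \<partial>M) \<le> ennreal ((2 * (1/2) ^ n)\<^sup>2)" for n
  proof -
    have "(\<integral>\<^sup>+ x. ennreal ((u n x - v x)\<^sup>2) \<partial>M) = (\<integral>\<^sup>+ x. liminf (\<lambda>m. ennreal ((u n x - u m x)\<^sup>2)) \<partial>M)"
    proof (rule nn_integral_cong_AE)
      show "AE x in M. ennreal ((u n x - v x)\<^sup>2) = liminf (\<lambda>m. ennreal ((u n x - u m x)\<^sup>2))"
        using conv
      proof eventually_elim
        case (elim x)
        then have "(\<lambda>m. ennreal ((u n x - u m x)\<^sup>2)) \<longlonglongrightarrow> ennreal ((u n x - v x)\<^sup>2)"
          unfolding v_def by (intro tendsto_ennrealI tendsto_intros)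
        from lim_imp_Liminf[OF _ this] show ?case by simp
      qed
    qed
    also have "\<dots> \<le> liminf (\<lambda>m. \<integral>\<^sup>+ x. ennreal ((u n x - u m x)\<^sup>2) \<partial>M)"
      by (intro nn_integral_liminf) measurable
    also have "\<dots> \<le> ennreal ((2 * (1/2) ^ n)\<^sup>2)"
    proof (rule Liminf_le)
      show "\<forall>\<^sub>F m in sequentially. (\<integral>\<^sup>+ x. ennreal ((u n x - u m x)\<^sup>2) \<partial>M) \<le> ennreal ((2 * (1/2) ^ n)\<^sup>2)"
        using eventually_ge_at_top[of n]
      proof eventually_elim
        case (elim m)
        have "L2_norm M (\<lambda>x. u n x - u m x) \<le> 2 * (1/2) ^ n - 2 * (1/2) ^ m"
          using tail[of n "m - n"] elim by simp
        then have "L2_norm M (\<lambda>x. u n x - u m x) \<le> 2 * (1/2) ^ n" by (smt (verit) zero_le_power divide_nonneg_nonneg)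
        then have "(L2_norm M (\<lambda>x. u n x - u m x))\<^sup>2 \<le> (2 * (1/2) ^ n)\<^sup>2" by (rule power_mono) simp
        moreover have "(\<integral>\<^sup>+ x. ennreal ((u n x - u m x)\<^sup>2) \<partial>M) = ennreal (\<integral>x. (u n x - u m x)\<^sup>2 \<partial>M)"
          using square_integrable_diff[OF u u, of n m] by (intro nn_integral_eq_integral) (auto simp: square_integrable_def)
        ultimately show ?case by (simp add: L2_norm_power2 ennreal_leI)
      qed
    qed simp
    finally show ?thesis .
  qed
  have sd: "square_integrable (\<lambda>x. u n x - v x)" for n
  proof -
    have "(\<integral>\<^sup>+ x. ennreal ((u n x - v x)\<^sup>2) \<partial>M) < \<infinity>"
      using fatou[of n] by (rule le_less_trans) simp
    then have "integrable M (\<lambda>x. (u n x - v x)\<^sup>2)" by (intro integrableI_nonneg) auto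
    then show ?thesis by (simp add: square_integrable_def)
  qed
  have "square_integrable (\<lambda>x. u 0 x - (u 0 x - v x))" by (intro square_integrable_diff u sd)
  then have v: "square_integrable v" by simp
  have "L2_norm M (\<lambda>x. u n x - v x) \<le> 2 * (1/2) ^ n" for n
  proof -
    have "ennreal ((L2_norm M (\<lambda>x. u n x - v x))\<^sup>2) = (\<integral>\<^sup>+ x. ennreal ((u n x - v x)\<^sup>2) \<partial>M)"
      unfolding L2_norm_power2 using sd[of n] by (intro nn_integral_eq_integral[symmetric]) (auto simp: square_integrable_def)
    then have "(L2_norm M (\<lambda>x. u n x - v x))\<^sup>2 \<le> (2 * (1/2) ^ n)\<^sup>2"
      using fatou[of n] by (metis ennreal_le_iff zero_le_power2)
    then show ?thesis by (rule power2_le_imp_le) simp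
  qed
  note bound = this
  have "(\<lambda>n. 2 * (1/2::real) ^ n) \<longlonglongrightarrow> 2 * 0"
    by (intro tendsto_mult_left LIMSEQ_power_zero) simp
  then have lim: "(\<lambda>n. 2 * (1/2::real) ^ n) \<longlonglongrightarrow> 0" by simp
  have "(\<lambda>n. L2_norm M (\<lambda>x. u n x - v x)) \<longlonglongrightarrow> 0"
    by (rule tendsto_sandwich[OF _ _ tendsto_const lim]) (simp_all add: bound)
  then show ?thesis using v by blast
qed

lemma L20_space_iff: "f \<in> L20_space M \<longleftrightarrow> square_integrable f \<and> (\<integral>x. f x \<partial>M) = 0"
  by (auto simp: L20_space_def square_integrable_def)

text \<open>The limit in the mean has integral 0 because the integral is bounded by the norm on a
  probability space.\<close>

lemma L20_complete:
  assumes u: "\<And>n. u n \<in> L20_space M" and le: "\<And>n. L2_norm M (u n - u (Suc n)) \<le> (1/2) ^ n"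
  shows "\<exists>v\<in>L20_space M. (\<lambda>n. L2_norm M (u n - v)) \<longlonglongrightarrow> 0"
proof -
  have s: "square_integrable (u n)" for n using u by (simp add: L20_space_iff)
  obtain v where v: "square_integrable v" "(\<lambda>n. L2_norm M (\<lambda>x. u n x - v x)) \<longlonglongrightarrow> 0"
    using L2_complete[of u] s le by (auto simp: fun_diff_def)
  have "\<bar>\<integral>x. v x \<partial>M\<bar> \<le> L2_norm M (\<lambda>x. u n x - v x)" for n
  proof -
    have "(\<integral>x. u n x - v x \<partial>M) = - (\<integral>x. v x \<partial>M)"
      using u[of n] square_integrable_integrable[OF s] square_integrable_integrable[OF v(1)] by (simp add: L20_space_iff)
    then show ?thesis using abs_integral_le_L2_norm[OF square_integrable_diff[OF s v(1)], of n] by simp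
  qed
  then have "\<bar>\<integral>x. v x \<partial>M\<bar> \<le> 0" by (intro tendsto_lowerbound[OF v(2)]) auto
  then have "v \<in> L20_space M" using v by (simp add: L20_space_iff)
  then show ?thesis using v(2) by (auto simp: fun_diff_def)
qed

end

section \<open>Invariant measures\<close>

context aperiodic_subshift
begin

definition invariant_prob :: "(int \<Rightarrow> 'a) measure \<Rightarrow> bool" where
  "invariant_prob \<mu> \<longleftrightarrow> prob_space \<mu> \<and> sets \<mu> = sets (restrict_space borel X) \<and> distr \<mu> \<mu> shift_map = \<mu>"

lemma ergodic_invariant_prob: "\<mu> \<in> ergodic_measures X \<Longrightarrow> invariant_prob \<mu>"
  by (simp add: ergodic_measures_def invariant_prob_def)

lemma invariant_prob_prob_space: "invariant_prob \<mu> \<Longrightarrow> prob_space \<mu>"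
  and invariant_prob_sets: "invariant_prob \<mu> \<Longrightarrow> sets \<mu> = sets (restrict_space borel X)"
  by (simp_all add: invariant_prob_def)

lemma invariant_prob_space: "invariant_prob \<mu> \<Longrightarrow> space \<mu> = X"
  using sets_eq_imp_space_eq[of \<mu> "restrict_space borel X"]
  by (simp add: invariant_prob_def space_restrict_space)

lemma continuous_on_shift_by: "continuous_on UNIV (shift_by i :: (int \<Rightarrow> 'a) \<Rightarrow> _)"
  unfolding shift_by_def by (intro continuous_on_coordinatewise_then_product continuous_on_product_coordinates)

lemma shift_by_measurable:
  assumes \<mu>: "invariant_prob \<mu>"
  shows "shift_by i \<in> measurable \<mu> \<mu>"
proof -
  have "shift_by i \<in> measurable (restrict_space borel X) (restrict_space borel X)"
    by (intro measurable_restrict_space3 borel_measurable_continuous_onI continuous_on_shift_by) auto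
  then show ?thesis
    by (simp add: measurable_cong_sets[OF invariant_prob_sets[OF \<mu>] invariant_prob_sets[OF \<mu>]])
qed

lemma shift_by_distr:
  assumes \<mu>: "invariant_prob \<mu>"
  shows "distr \<mu> \<mu> (shift_by i) = \<mu>"
proof (induction i rule: int_induct[where k = 0])
  case base
  have "distr \<mu> \<mu> (shift_by 0) = distr \<mu> \<mu> (\<lambda>x. x)" by (intro distr_cong) auto
  then show ?case by simp
next
  case (step1 i)
  have "distr \<mu> \<mu> (shift_by (i + 1)) = distr (distr \<mu> \<mu> (shift_by i)) \<mu> (shift_by 1)"
    by (subst distr_distr) (auto intro: shift_by_measurable[OF \<mu>] simp: comp_def add.commute)
  then show ?case using step1 \<mu> by (simp add: invariant_prob_def shift_map_eq_shift_by)
next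
  case (step2 i)
  have "distr \<mu> \<mu> (shift_by (i - 1)) = distr (distr \<mu> \<mu> (shift_by 1)) \<mu> (shift_by (i - 1))"
    using \<mu> by (simp add: invariant_prob_def shift_map_eq_shift_by)
  also have "\<dots> = distr \<mu> \<mu> (shift_by i)"
    by (subst distr_distr) (auto intro: shift_by_measurable[OF \<mu>] simp: comp_def)
  finally show ?case using step2 by simp
qed

lemma measure_shift_by_vimage:
  assumes \<mu>: "invariant_prob \<mu>" and B: "B \<in> sets \<mu>"
  shows "{x \<in> X. shift_by i x \<in> B} \<in> sets \<mu>" "measure \<mu> {x \<in> X. shift_by i x \<in> B} = measure \<mu> B"
proof -
  have eq: "{x \<in> X. shift_by i x \<in> B} = shift_by i -` B \<inter> space \<mu>" using invariant_prob_space[OF \<mu>] by auto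
  show "{x \<in> X. shift_by i x \<in> B} \<in> sets \<mu>" unfolding eq using shift_by_measurable[OF \<mu>] B by (rule measurable_sets)
  show "measure \<mu> {x \<in> X. shift_by i x \<in> B} = measure \<mu> B"
    unfolding eq using measure_distr[OF shift_by_measurable[OF \<mu>] B] shift_by_distr[OF \<mu>] by simp
qed

lemma cylindrical_measurable:
  assumes "invariant_prob \<mu>" "cylindrical r f"
  shows "f \<in> borel_measurable \<mu>"
  using borel_measurable_continuous_on_restrict[OF cylindrical_continuous[OF assms(2)]]
  by (simp add: measurable_cong_sets[OF invariant_prob_sets[OF assms(1)] refl])

section \<open>Approximation of measurable sets by cylinder sets\<close>

definition cylinder_set :: "nat \<Rightarrow> (int \<Rightarrow> 'a) set \<Rightarrow> bool" where
  "cylinder_set r C \<longleftrightarrow> C \<subseteq> X \<and> (\<forall>x\<in>X. \<forall>y\<in>X. agree r x y \<longrightarrow> (x \<in> C \<longleftrightarrow> y \<in> C))"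

lemma cylinder_set_mono: "cylinder_set q C \<Longrightarrow> q \<le> r \<Longrightarrow> cylinder_set r C"
  unfolding cylinder_set_def using agree_mono by blast

lemma cylinder_set_Diff: "cylinder_set r C \<Longrightarrow> cylinder_set r (X - C)"
  by (auto simp: cylinder_set_def)

lemma cylinder_set_UN:
  assumes "\<And>i. i \<in> I \<Longrightarrow> cylinder_set r (C i)" shows "cylinder_set r (\<Union>i\<in>I. C i)"
  using assms unfolding cylinder_set_def by (intro conjI UN_least) (blast, simp)

lemma cylindrical_indicator_set: "cylinder_set r C \<Longrightarrow> cylindrical r (indicator C)"
  by (auto simp: cylinder_set_def cylindrical_def indicator_def)

lemma cylinder_set_sets:
  assumes \<mu>: "invariant_prob \<mu>" and C: "cylinder_set r C"
  shows "C \<in> sets \<mu>"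
proof -
  have "(indicator C :: _ \<Rightarrow> real) \<in> borel_measurable \<mu>"
    by (rule cylindrical_measurable[OF \<mu> cylindrical_indicator_set[OF C]])
  then have "C \<inter> space \<mu> \<in> sets \<mu>" by (simp add: borel_measurable_indicator_iff)
  moreover have "C \<inter> space \<mu> = C" using C invariant_prob_space[OF \<mu>] by (auto simp: cylinder_set_def)
  ultimately show ?thesis by simp
qed

text \<open>A single \<open>C\<close> has to serve both measures, because it is later used to
  separate them.\<close>

definition cylinder_approx :: "(int \<Rightarrow> 'a) measure \<Rightarrow> (int \<Rightarrow> 'a) measure \<Rightarrow> (int \<Rightarrow> 'a) set \<Rightarrow> bool" where
  "cylinder_approx \<mu> \<nu> B \<longleftrightarrow> B \<in> sets \<mu> \<and>
     (\<forall>e>0. \<exists>r C. cylinder_set r C \<and> measure \<mu> (sym_diff B C) < e \<and> measure \<nu> (sym_diff B C) < e)"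

lemma cylinder_approx_cylinder:
  assumes "invariant_prob \<mu>" "cylinder_set r C"
  shows "cylinder_approx \<mu> \<nu> C"
  unfolding cylinder_approx_def using assms cylinder_set_sets by (auto intro!: exI[of _ r] exI[of _ C])

lemma cylinder_approx_Diff:
  assumes \<mu>: "invariant_prob \<mu>" and B: "cylinder_approx \<mu> \<nu> B"
  shows "cylinder_approx \<mu> \<nu> (X - B)"
  unfolding cylinder_approx_def
proof (intro conjI allI impI)
  show "X - B \<in> sets \<mu>"
    using B invariant_prob_space[OF \<mu>] sets.compl_sets[of B \<mu>] by (simp add: cylinder_approx_def)
  have BX: "B \<subseteq> X" using B invariant_prob_space[OF \<mu>] sets.sets_into_space[of B \<mu>] by (auto simp: cylinder_approx_def)
  fix e :: real assume "0 < e"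
  then obtain r C where C: "cylinder_set r C" "measure \<mu> (sym_diff B C) < e" "measure \<nu> (sym_diff B C) < e"
    using B by (auto simp: cylinder_approx_def)
  have "sym_diff (X - B) (X - C) = sym_diff B C" using BX C(1) by (auto simp: cylinder_set_def)
  then show "\<exists>r C. cylinder_set r C \<and> measure \<mu> (sym_diff (X - B) C) < e \<and> measure \<nu> (sym_diff (X - B) C) < e"
    using C cylinder_set_Diff by metis
qed

lemma measure_tail_union:
  assumes "finite_measure \<mu>" "range B \<subseteq> sets \<mu>" "0 < (e::real)"
  shows "\<forall>\<^sub>F n in sequentially. measure \<mu> ((\<Union>i. B i) - (\<Union>i<n. B i)) < e"
proof -
  interpret finite_measure \<mu> by fact
  have m: "(\<Union>i<n. B i) \<in> sets \<mu>" for n using assms(2) by auto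
  have "incseq (\<lambda>n. \<Union>i<n. B i)" unfolding incseq_def by (intro allI impI UN_mono) auto
  then have "(\<lambda>n. measure \<mu> (\<Union>i<n. B i)) \<longlonglongrightarrow> measure \<mu> (\<Union>n. \<Union>i<n. B i)"
    using m by (intro finite_Lim_measure_incseq) auto
  moreover have "(\<Union>n. \<Union>i<n. B i) = (\<Union>i. B i)" by auto
  ultimately have "\<forall>\<^sub>F n in sequentially. measure \<mu> (\<Union>i. B i) - e < measure \<mu> (\<Union>i<n. B i)"
    using assms(3) by (intro order_tendstoD(1)) auto
  then show ?thesis
  proof eventually_elim
    case (elim n)
    have "measure \<mu> ((\<Union>i. B i) - (\<Union>i<n. B i)) = measure \<mu> (\<Union>i. B i) - measure \<mu> (\<Union>i<n. B i)"
      using m assms(2) by (intro finite_measure_Diff) auto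
    then show ?case using elim by simp
  qed
qed

lemma cylinder_approx_UN:
  fixes B :: "nat \<Rightarrow> (int \<Rightarrow> 'a) set"
  assumes \<mu>: "invariant_prob \<mu>" and \<nu>: "invariant_prob \<nu>" and B: "\<And>i. cylinder_approx \<mu> \<nu> (B i)"
  shows "cylinder_approx \<mu> \<nu> (\<Union>i. B i)"
  unfolding cylinder_approx_def
proof (intro conjI allI impI)
  have Bs: "B i \<in> sets \<mu>" for i using B by (simp add: cylinder_approx_def)
  then show "(\<Union>i. B i) \<in> sets \<mu>" by auto
  have sets: "sets \<nu> = sets \<mu>" using \<mu> \<nu> invariant_prob_sets by simp
  have fm: "finite_measure \<mu>" "finite_measure \<nu>"
    using \<mu> \<nu> invariant_prob_prob_space prob_space.finite_measure by blast+
  fix e :: real assume e: "0 < e"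
  then have e2: "0 < e / 2" by simp
  have rB: "range B \<subseteq> sets \<mu>" "range B \<subseteq> sets \<nu>" using Bs sets by auto
  obtain n where n: "measure \<mu> ((\<Union>i. B i) - (\<Union>i<n. B i)) < e / 2" "measure \<nu> ((\<Union>i. B i) - (\<Union>i<n. B i)) < e / 2"
    using eventually_conj[OF measure_tail_union[OF fm(1) rB(1) e2] measure_tail_union[OF fm(2) rB(2) e2]]
    by (auto dest!: eventually_happens simp: sequentially_bot)
  \<comment> \<open>At most \<open>n\<close> errors of size \<open>d\<close> are added, and they may
    take up half of \<open>e\<close>; \<open>Suc n\<close> avoids a division by 0.\<close>
  define d where "d = e / (2 * real (Suc n))"
  have d: "0 < d" "real n * d \<le> e / 2" using e by (auto simp: d_def field_simps)
  have "\<exists>r C. cylinder_set r C \<and> measure \<mu> (sym_diff (B i) C) < d \<and> measure \<nu> (sym_diff (B i) C) < d" for i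
    using B[of i] d(1) by (auto simp: cylinder_approx_def)
  then obtain q C where C: "\<And>i. cylinder_set (q i) (C i)" "\<And>i. measure \<mu> (sym_diff (B i) (C i)) < d"
    "\<And>i. measure \<nu> (sym_diff (B i) (C i)) < d" by metis
  define r where "r = (\<Sum>i<n. q i)"
  have "cylinder_set r (C i)" if "i < n" for i
    by (rule cylinder_set_mono[OF C(1)]) (use that in \<open>auto simp: r_def intro!: member_le_sum\<close>)
  then have cyl: "cylinder_set r (\<Union>i<n. C i)" by (intro cylinder_set_UN) auto
  have le: "measure \<kappa> (sym_diff (\<Union>i. B i) (\<Union>i<n. C i)) < e"
    if \<kappa>: "finite_measure \<kappa>" "sets \<kappa> = sets \<mu>" "measure \<kappa> ((\<Union>i. B i) - (\<Union>i<n. B i)) < e / 2" "\<And>i. measure \<kappa> (sym_diff (B i) (C i)) < d" for \<kappa>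
  proof -
    interpret \<kappa>: finite_measure \<kappa> by fact
    have BC: "B i \<in> sets \<kappa>" "C i \<in> sets \<kappa>" for i
      using Bs cylinder_set_sets[OF \<mu> C(1)] \<kappa>(2) by auto
    have UB: "(\<Union>i. B i) - (\<Union>i<n. B i) \<in> sets \<kappa>"
      using BC by (intro sets.Diff sets.countable_UN sets.finite_UN) auto
    have UC: "(\<Union>i<n. sym_diff (B i) (C i)) \<in> sets \<kappa>"
      using BC by (intro sets.Diff sets.Un sets.finite_UN) auto
    have "measure \<kappa> (sym_diff (\<Union>i. B i) (\<Union>i<n. C i)) \<le> measure \<kappa> (((\<Union>i. B i) - (\<Union>i<n. B i)) \<union> (\<Union>i<n. sym_diff (B i) (C i)))"
      using UB UC by (intro \<kappa>.finite_measure_mono sets.Un) blast+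
    also have "\<dots> \<le> measure \<kappa> ((\<Union>i. B i) - (\<Union>i<n. B i)) + measure \<kappa> (\<Union>i<n. sym_diff (B i) (C i))"
      using UB UC by (rule measure_Un_le)
    also have "measure \<kappa> (\<Union>i<n. sym_diff (B i) (C i)) \<le> (\<Sum>i<n. measure \<kappa> (sym_diff (B i) (C i)))"
      using BC by (intro measure_UNION_le) auto
    also have "\<dots> \<le> (\<Sum>i<n. d)" using \<kappa>(4) by (intro sum_mono less_imp_le)
    also have "\<dots> \<le> e / 2" using d(2) by simp
    finally show ?thesis using \<kappa>(3) by simp
  qed
  show "\<exists>r D. cylinder_set r D \<and> measure \<mu> (sym_diff (\<Union>i. B i) D) < e \<and> measure \<nu> (sym_diff (\<Union>i. B i) D) < e"
    using cyl le[OF fm(1) refl n(1) C(2)] le[OF fm(2) sets n(2) C(3)] by blast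
qed

text \<open>The approximable sets are closed under complements and countable unions and contain the
  traces of open sets, each of which is a countable union of cylinder sets.\<close>

lemma cylinder_approximation:
  assumes \<mu>: "invariant_prob \<mu>" and \<nu>: "invariant_prob \<nu>" and B: "B \<in> sets \<mu>"
  shows "cylinder_approx \<mu> \<nu> B"
proof -
  have "cylinder_approx \<mu> \<nu> (X \<inter> S)" if "S \<in> sigma_sets UNIV {S. open S}" for S
    using that
  proof (induction rule: sigma_sets.induct)
    case (Basic S)
    define C where "C r = {x \<in> X. \<forall>y. agree r x y \<longrightarrow> y \<in> S}" for r
    have "cylinder_set r (C r)" for r
      unfolding cylinder_set_def C_def using agree_sym agree_trans by blast
    then have "cylinder_approx \<mu> \<nu> (\<Union>r. C r)"
      by (intro cylinder_approx_UN \<mu> \<nu> cylinder_approx_cylinder)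
    moreover have "(\<Union>r. C r) = X \<inter> S"
    proof
      show "(\<Union>r. C r) \<subseteq> X \<inter> S" by (auto simp: C_def agree_def)
      show "X \<inter> S \<subseteq> (\<Union>r. C r)"
        using open_contains_agree[of S] Basic by (auto simp: C_def)
    qed
    ultimately show ?case by simp
  next
    case Empty
    have "cylinder_set 0 {}" by (simp add: cylinder_set_def)
    then show ?case using cylinder_approx_cylinder[OF \<mu>] by simp
  next
    case (Compl S)
    have "X \<inter> (UNIV - S) = X - X \<inter> S" by auto
    then show ?case using cylinder_approx_Diff[OF \<mu> Compl.IH] by simp
  next
    case (Union S)
    have "X \<inter> (\<Union>i. S i) = (\<Union>i. X \<inter> S i)" by auto
    then show ?case using cylinder_approx_UN[OF \<mu> \<nu> Union.IH] by simp
  qed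
  moreover have "B \<in> (\<inter>) X ` sets borel" using B invariant_prob_sets[OF \<mu>] by (simp add: sets_restrict_space)
  ultimately show ?thesis by (auto simp: borel_def)
qed

section \<open>Distinct ergodic measures are mutually singular\<close>

text \<open>The union of all shifts of a Hahn set of \<open>\<mu> - \<nu>\<close> is again a Hahn set, and it is invariant.\<close>

lemma ergodic_singular:
  assumes \<mu>: "\<mu> \<in> ergodic_measures X" and \<nu>: "\<nu> \<in> ergodic_measures X" and ne: "\<mu> \<noteq> \<nu>"
  shows "\<exists>B\<in>sets \<mu>. measure \<mu> B = 1 \<and> measure \<nu> B = 0"
proof -
  have i\<mu>: "invariant_prob \<mu>" and i\<nu>: "invariant_prob \<nu>" using \<mu> \<nu> ergodic_invariant_prob by auto
  interpret M: prob_space \<mu> using i\<mu> by (rule invariant_prob_prob_space)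
  interpret N: prob_space \<nu> using i\<nu> by (rule invariant_prob_prob_space)
  have sets: "sets \<nu> = sets \<mu>" using i\<mu> i\<nu> invariant_prob_sets by simp
  define g where "g B = measure \<mu> B - measure \<nu> B" for B
  obtain P where P: "P \<in> sets \<mu>" "\<And>B. B \<in> sets \<mu> \<Longrightarrow> B \<subseteq> P \<Longrightarrow> emeasure \<nu> B \<le> emeasure \<mu> B"
    "\<And>B. B \<in> sets \<mu> \<Longrightarrow> B \<inter> P = {} \<Longrightarrow> emeasure \<mu> B \<le> emeasure \<nu> B"
    using finite_unsigned_Hahn_decomposition[OF M.finite_measure_axioms N.finite_measure_axioms sets]
    by (elim bexE conjE) (rule that, blast+)
  have pos: "0 \<le> g B" if "B \<in> sets \<mu>" "B \<subseteq> P" for B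
    using P(2)[OF that] by (simp add: g_def M.emeasure_eq_measure N.emeasure_eq_measure)
  have neg: "g B \<le> 0" if "B \<in> sets \<mu>" "B \<inter> P = {}" for B
    using P(3)[OF that] by (simp add: g_def M.emeasure_eq_measure N.emeasure_eq_measure)
  have g_Un: "g (B \<union> C) = g B + g C" if "B \<in> sets \<mu>" "C \<in> sets \<mu>" "B \<inter> C = {}" for B C
    using M.finite_measure_Union[of B C] N.finite_measure_Union[of B C] that sets by (simp add: g_def)
  \<comment> \<open>Being a Hahn set is used in the form of maximising the signed measure
    \<open>g\<close>, which makes invariance under shifts immediate.\<close>
  have max: "g B \<le> g P" if B: "B \<in> sets \<mu>" for B
  proof -
    have "g ((B \<inter> P) \<union> (B - P)) = g (B \<inter> P) + g (B - P)"
      by (rule g_Un) (use B P(1) in auto)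
    moreover have "(B \<inter> P) \<union> (B - P) = B" by blast
    moreover have "g ((B \<inter> P) \<union> (P - B)) = g (B \<inter> P) + g (P - B)"
      by (rule g_Un) (use B P(1) in auto)
    moreover have "(B \<inter> P) \<union> (P - B) = P" by blast
    moreover have "0 \<le> g (P - B)" "g (B - P) \<le> 0" using pos[of "P - B"] neg[of "B - P"] B P(1) by auto
    ultimately show ?thesis by simp
  qed
  \<comment> \<open>By inclusion and exclusion, \<open>g (B \<union> C) + g (B \<inter> C)\<close>
    is twice the maximum, so both terms attain it.\<close>
  have max_Un: "g (B \<union> C) = g P" if BC: "B \<in> sets \<mu>" "C \<in> sets \<mu>" "g B = g P" "g C = g P" for B C
  proof -
    have "g (B \<union> (C - B)) = g B + g (C - B)"
      by (rule g_Un) (use BC in auto)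
    moreover have "B \<union> (C - B) = B \<union> C" by blast
    moreover have "g ((B \<inter> C) \<union> (C - B)) = g (B \<inter> C) + g (C - B)"
      by (rule g_Un) (use BC in auto)
    moreover have "(B \<inter> C) \<union> (C - B) = C" by blast
    moreover have "g (B \<inter> C) \<le> g P" "g (B \<union> C) \<le> g P" using BC by (auto intro!: max)
    ultimately show ?thesis using BC by simp
  qed
  define Q where "Q i = {x \<in> X. shift_by i x \<in> P}" for i
  have Qs: "Q i \<in> sets \<mu>" for i unfolding Q_def by (rule measure_shift_by_vimage(1)[OF i\<mu> P(1)])
  have gQ: "g (Q i) = g P" for i
    using measure_shift_by_vimage(2)[OF i\<mu> P(1)] measure_shift_by_vimage(2)[OF i\<nu>, of P] P(1) sets by (simp add: g_def Q_def)
  \<comment> \<open>Finite unions are maximising by induction; as they increase to the full union,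
    continuity of both measures carries this over to the limit.\<close>
  define R where "R n = (\<Union>i\<in>{- int n..int n}. Q i)" for n :: nat
  have UQ: "(\<Union>i\<in>I. Q i) \<in> sets \<mu> \<and> g (\<Union>i\<in>I. Q i) = g P" if "finite I" "I \<noteq> {}" for I
    using that
  proof (induction I rule: finite_ne_induct)
    case (singleton i)
    then show ?case using Qs gQ by simp
  next
    case (insert i I)
    then show ?case using max_Un[of "Q i" "\<Union>i\<in>I. Q i"] Qs gQ by auto
  qed
  have R: "R n \<in> sets \<mu>" "g (R n) = g P" for n using UQ[of "{- int n..int n}"] by (auto simp: R_def)
  define S where "S = (\<Union>n. R n)"
  have S: "S \<in> sets \<mu>" using R by (auto simp: S_def)
  have inc: "incseq R" unfolding R_def incseq_def by (intro allI impI UN_mono) auto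
  have "(\<lambda>n. measure \<mu> (R n)) \<longlonglongrightarrow> measure \<mu> S" "(\<lambda>n. measure \<nu> (R n)) \<longlonglongrightarrow> measure \<nu> S"
    unfolding S_def using R(1) sets inc by (auto intro!: M.finite_Lim_measure_incseq N.finite_Lim_measure_incseq)
  then have "(\<lambda>n. g (R n)) \<longlonglongrightarrow> g S" unfolding g_def by (rule tendsto_diff)
  then have gS: "g S = g P" using R(2) by (simp add: LIMSEQ_const_iff)
  have S_eq: "S = {x \<in> X. \<exists>i. shift_by i x \<in> P}"
  proof (intro Set.set_eqI iffI)
    fix x assume "x \<in> {x \<in> X. \<exists>i. shift_by i x \<in> P}"
    then obtain i where "x \<in> Q i" by (auto simp: Q_def)
    then have "x \<in> R (nat \<bar>i\<bar>)" unfolding R_def by (intro UN_I[of i]) auto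
    then show "x \<in> S" by (auto simp: S_def)
  qed (auto simp: S_def R_def Q_def)
  have inv: "shift_map -` S \<inter> X = S"
  proof (intro Set.set_eqI iffI)
    fix x assume "x \<in> shift_map -` S \<inter> X"
    then show "x \<in> S" by (auto simp: S_eq shift_map_eq_shift_by)
  next
    fix x assume "x \<in> S"
    then obtain i where "x \<in> X" "shift_by i x \<in> P" by (auto simp: S_eq)
    then have "shift_by (i - 1) (shift_by 1 x) \<in> P" by simp
    then show "x \<in> shift_map -` S \<inter> X" using \<open>x \<in> X\<close> by (auto simp: S_eq shift_map_eq_shift_by simp del: shift_by_shift_by)
  qed
  have m01: "measure \<mu> S = 0 \<or> measure \<mu> S = 1" "measure \<nu> S = 0 \<or> measure \<nu> S = 1"
    using \<mu> \<nu> S sets inv invariant_prob_space[OF i\<mu>] invariant_prob_space[OF i\<nu>]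
    by (auto simp: ergodic_measures_def)
  \<comment> \<open>Otherwise \<open>g\<close> is nowhere positive; since complements have the
    opposite value, it vanishes and the measures coincide.\<close>
  have "0 < g P"
  proof (rule ccontr)
    assume "\<not> 0 < g P"
    then have le: "g B \<le> 0" if "B \<in> sets \<mu>" for B using max[OF that] by simp
    have "g B = 0" if B: "B \<in> sets \<mu>" for B
    proof -
      have "g (space \<mu> - B) = - g B"
        using M.prob_compl[OF B] N.prob_compl[of B] B sets sets_eq_imp_space_eq[OF sets] by (simp add: g_def)
      then show ?thesis using le[OF B] le[of "space \<mu> - B"] B by auto
    qed
    then have "\<mu> = \<nu>"
      using sets by (intro measure_eqI) (auto simp: g_def M.emeasure_eq_measure N.emeasure_eq_measure)
    then show False using ne by simp
  qed
  \<comment> \<open>Both measures of \<open>S\<close> are 0 or 1 and their difference is positive,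
    which leaves one possibility.\<close>
  then have "measure \<mu> S = 1 \<and> measure \<nu> S = 0" using gS m01 by (auto simp: g_def)
  then show ?thesis using S by blast
qed

section \<open>Columns\<close>

definition column :: "nat \<Rightarrow> 'a list \<Rightarrow> (int \<Rightarrow> 'a) set" where
  "column n e = {x \<in> X. branch n x = e}"

definition level :: "nat \<Rightarrow> 'a list \<Rightarrow> nat \<Rightarrow> (int \<Rightarrow> 'a) set" where
  "level n e s = {x \<in> X. branch n x = e \<and> age n x = s}"

definition heights :: "nat \<Rightarrow> 'a list \<Rightarrow> nat set" where
  "heights n e = {s. level n e s \<noteq> {}}"

lemma finite_heights: "finite (heights n e)"
  by (rule finite_subset[of _ "{..card (language n)}"]) (use age_le in \<open>auto simp: heights_def level_def\<close>)

lemma column_eq: "column n e = (\<Union>s\<in>heights n e. level n e s)"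
  by (auto simp: column_def level_def heights_def)

text \<open>By \<open>branch_level\<close>, one point on a level forces the whole shifted base into
  it. For an \<open>s\<close> without such a point, the shifted base can be nonempty while the level
  is empty.\<close>

lemma level_eq:
  assumes "s \<in> heights n e"
  shows "level n e s = {x \<in> X. shift_by (- int s) x \<in> {y \<in> X. word (Suc n) y = e}}"
proof -
  obtain y where y: "y \<in> X" "branch n y = e" "age n y = s" using assms by (auto simp: heights_def level_def)
  show ?thesis
  proof (intro Set.set_eqI iffI)
    fix x assume "x \<in> level n e s"
    then show "x \<in> {x \<in> X. shift_by (- int s) x \<in> {y \<in> X. word (Suc n) y = e}}" by (auto simp: level_def branch_def)
  next
    fix x assume "x \<in> {x \<in> X. shift_by (- int s) x \<in> {y \<in> X. word (Suc n) y = e}}"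
    then show "x \<in> level n e s" using branch_level[OF y(1), of x n] y by (simp add: level_def)
  qed
qed

lemma cylinder_set_base: "cylinder_set (Suc n) {y \<in> X. word (Suc n) y = e}"
proof -
  have "word (Suc n) x = word (Suc n) y" if "agree (Suc n) x y" for x y
    using that unfolding agree_def word_eq_iff by simp
  then show ?thesis by (auto simp: cylinder_set_def)
qed

lemma level_measure:
  assumes \<mu>: "invariant_prob \<mu>" and s: "s \<in> heights n e"
  shows "level n e s \<in> sets \<mu>" "measure \<mu> (level n e s) = measure \<mu> {y \<in> X. word (Suc n) y = e}"
  unfolding level_eq[OF s] using measure_shift_by_vimage[OF \<mu> cylinder_set_sets[OF \<mu> cylinder_set_base]] by auto

text \<open>By invariance every level weighs as much as the base, so within a column masses are
  compared by counting levels, and this count is the same for all measures.\<close>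

lemma levels_measure:
  assumes \<mu>: "invariant_prob \<mu>" and J: "J \<subseteq> heights n e"
  shows "(\<Union>s\<in>J. level n e s) \<in> sets \<mu>"
    "measure \<mu> (\<Union>s\<in>J. level n e s) = real (card J) * measure \<mu> {y \<in> X. word (Suc n) y = e}"
proof -
  interpret prob_space \<mu> using \<mu> by (rule invariant_prob_prob_space)
  have fin: "finite J" using J finite_heights finite_subset by blast
  show "(\<Union>s\<in>J. level n e s) \<in> sets \<mu>" using fin level_measure(1)[OF \<mu>] J by (intro sets.finite_UN) auto
  have "measure \<mu> (\<Union>s\<in>J. level n e s) = (\<Sum>s\<in>J. measure \<mu> (level n e s))"
    using fin level_measure(1)[OF \<mu>] J
    by (intro finite_measure_finite_Union) (auto simp: disjoint_family_on_def level_def)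
  also have "\<dots> = (\<Sum>s\<in>J. measure \<mu> {y \<in> X. word (Suc n) y = e})"
    using level_measure(2)[OF \<mu>] J by (intro sum.cong) auto
  finally show "measure \<mu> (\<Union>s\<in>J. level n e s) = real (card J) * measure \<mu> {y \<in> X. word (Suc n) y = e}" by simp
qed

lemma column_sets: "invariant_prob \<mu> \<Longrightarrow> column n e \<in> sets \<mu>"
  unfolding column_eq by (rule levels_measure(1)) auto

text \<open>Once \<open>n\<close> is large, a shift of \<open>C\<close> either contains or misses each level of a column. If it
  contains at least half of them, the \<open>\<mu>\<close>-measure of the column is small, otherwise its
  \<open>\<nu>\<close>-measure is.\<close>

lemma column_not_shared:
  assumes \<mu>: "invariant_prob \<mu>" and \<nu>: "invariant_prob \<nu>"
    and C: "cylinder_set r C" "measure \<mu> C < d" "measure \<nu> (X - C) < d" and n: "2 * r + 1 \<le> n"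
  shows "measure \<mu> (column n e) < 2 * d \<or> measure \<nu> (column n e) < 2 * d"
proof -
  interpret M: prob_space \<mu> using \<mu> by (rule invariant_prob_prob_space)
  interpret N: prob_space \<nu> using \<nu> by (rule invariant_prob_prob_space)
  let ?B = "{y \<in> X. word (Suc n) y = e}"
  \<comment> \<open>The shift makes membership depend on the first \<open>2 * r + 1\<close> letters,
    hence only on the word of length \<open>n\<close>, which is constant on a level.\<close>
  define D where "D = {x \<in> X. shift_by (int r) x \<in> C}"
  have D: "D \<in> sets \<mu>" "measure \<mu> D < d"
    using measure_shift_by_vimage[OF \<mu> cylinder_set_sets[OF \<mu> C(1)]] C(2) by (auto simp: D_def)
  have "X - D = {x \<in> X. shift_by (int r) x \<in> X - C}" by (auto simp: D_def)
  then have D': "X - D \<in> sets \<nu>" "measure \<nu> (X - D) < d"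
    using measure_shift_by_vimage[OF \<nu> cylinder_set_sets[OF \<nu> cylinder_set_Diff[OF C(1)]]] C(3) by auto
  have Dw: "x \<in> D \<longleftrightarrow> y \<in> D" if xy: "x \<in> X" "y \<in> X" "word n x = word n y" for x y
  proof -
    have "word (2 * r + 1) x = word (2 * r + 1) y" by (rule word_eq_mono[OF xy(3) n])
    then have "agree r (shift_by (int r) x) (shift_by (int r) y)" by (simp add: agree_iff_word)
    then show ?thesis using C(1) xy by (simp add: cylinder_set_def D_def)
  qed
  have same: "x \<in> D \<longleftrightarrow> y \<in> D" if "x \<in> level n e s" "y \<in> level n e s" for x y s
    using that branch_level(3)[of x y n] by (intro Dw) (auto simp: level_def branch_def)
  define J where "J = {s \<in> heights n e. level n e s \<subseteq> D}"
  define K where "K = heights n e - J"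
  have JK: "J \<subseteq> heights n e" "K \<subseteq> heights n e" by (auto simp: J_def K_def)
  have card: "card (heights n e) = card J + card K"
    unfolding K_def using card_Diff_subset[OF _ JK(1)] card_mono[OF finite_heights JK(1)] finite_subset[OF JK(1) finite_heights] by simp
  have "(\<Union>s\<in>J. level n e s) \<subseteq> D" by (auto simp: J_def)
  then have j: "real (card J) * measure \<mu> ?B < d"
    using M.finite_measure_mono[OF _ D(1), of "\<Union>s\<in>J. level n e s"] D(2) levels_measure(2)[OF \<mu> JK(1)] by linarith
  have "level n e s \<subseteq> X - D" if s: "s \<in> K" for s
  proof (rule subsetI)
    fix y assume y: "y \<in> level n e s"
    have "\<not> level n e s \<subseteq> D" using s by (simp add: K_def J_def)
    then obtain x where "x \<in> level n e s" "x \<notin> D" by (auto simp only: subset_iff)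
    then have "y \<notin> D" using same[of x s y] y by simp
    then show "y \<in> X - D" using y by (simp add: level_def)
  qed
  then have "(\<Union>s\<in>K. level n e s) \<subseteq> X - D" by blast
  then have k: "real (card K) * measure \<nu> ?B < d"
    using N.finite_measure_mono[OF _ D'(1), of "\<Union>s\<in>K. level n e s"] D'(2) levels_measure(2)[OF \<nu> JK(2)] by linarith
  have col: "measure \<kappa> (column n e) = real (card J + card K) * measure \<kappa> ?B" if "invariant_prob \<kappa>" for \<kappa>
    unfolding column_eq card[symmetric] by (rule levels_measure(2)[OF that]) simp
  show ?thesis
  proof (cases "card K \<le> card J")
    case True
    then have "real (card J + card K) * measure \<mu> ?B \<le> (2 * real (card J)) * measure \<mu> ?B"
      by (intro mult_right_mono) auto
    then show ?thesis using j col[OF \<mu>] by simp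
  next
    case False
    then have "real (card J + card K) * measure \<nu> ?B \<le> (2 * real (card K)) * measure \<nu> ?B"
      by (intro mult_right_mono) auto
    then show ?thesis using k col[OF \<nu>] by simp
  qed
qed

text \<open>A set that is null for \<open>\<mu>\<close> and full for \<open>\<nu>\<close> is
  approximated for both measures by one cylinder set. The error is \<open>d / 2\<close> since
  \<open>column_not_shared\<close> loses a factor 2.\<close>

lemma ergodic_columns_disjoint:
  assumes \<mu>: "\<mu> \<in> ergodic_measures X" and \<nu>: "\<nu> \<in> ergodic_measures X" and ne: "\<mu> \<noteq> \<nu>" and d: "0 < d"
  shows "\<forall>\<^sub>F n in sequentially. \<forall>e. measure \<mu> (column n e) < d \<or> measure \<nu> (column n e) < d"
proof -
  have i\<mu>: "invariant_prob \<mu>" and i\<nu>: "invariant_prob \<nu>" using \<mu> \<nu> ergodic_invariant_prob by auto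
  interpret M: prob_space \<mu> using i\<mu> by (rule invariant_prob_prob_space)
  interpret N: prob_space \<nu> using i\<nu> by (rule invariant_prob_prob_space)
  have sets: "sets \<nu> = sets \<mu>" using i\<mu> i\<nu> invariant_prob_sets by simp
  obtain B where B: "B \<in> sets \<nu>" "measure \<nu> B = 1" "measure \<mu> B = 0"
    using ergodic_singular[OF \<nu> \<mu>] ne by auto
  have "cylinder_approx \<mu> \<nu> B" using cylinder_approximation[OF i\<mu> i\<nu>, of B] B(1) sets by simp
  moreover have "0 < d / 2" using d by simp
  ultimately obtain r C where C: "cylinder_set r C" "measure \<mu> (sym_diff B C) < d / 2" "measure \<nu> (sym_diff B C) < d / 2"
    unfolding cylinder_approx_def by blast
  have Cs: "C \<in> sets \<mu>" "C \<in> sets \<nu>" using cylinder_set_sets C(1) i\<mu> i\<nu> by auto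
  have "measure \<mu> C \<le> measure \<mu> (sym_diff B C \<union> B)"
    using Cs B(1) sets by (intro M.finite_measure_mono) auto
  also have "\<dots> \<le> measure \<mu> (sym_diff B C) + measure \<mu> B" using Cs B(1) sets by (intro measure_Un_le) auto
  finally have 1: "measure \<mu> C < d / 2" using C(2) B(3) by simp
  have X: "X = space \<nu>" using invariant_prob_space[OF i\<nu>] by simp
  have "measure \<nu> (X - C) \<le> measure \<nu> (sym_diff B C \<union> (X - B))"
    using Cs B(1) unfolding X by (intro N.finite_measure_mono) auto
  also have "\<dots> \<le> measure \<nu> (sym_diff B C) + measure \<nu> (X - B)" using Cs B(1) unfolding X by (intro measure_Un_le) auto
  also have "measure \<nu> (X - B) = 0" unfolding X using N.prob_compl[OF B(1)] B(2) by simp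
  finally have 2: "measure \<nu> (X - C) < d / 2" using C(3) by simp
  show ?thesis
    using eventually_ge_at_top[of "2 * r + 1"]
    by eventually_elim (use column_not_shared[OF i\<mu> i\<nu> C(1) 1 2] in auto)
qed

section \<open>Ergodic multiplicity\<close>

lemma cylindrical_bounded: "cylindrical r f \<Longrightarrow> \<exists>K\<ge>0. \<forall>x. \<bar>f x\<bar> \<le> K"
proof -
  assume f: "cylindrical r f"
  have "\<bar>f x\<bar> \<le> max 0 (sup_norm_on X f)" for x
    using abs_le_sup_norm[OF cylindrical_in_C_space[OF f], of x] f by (cases "x \<in> X") (auto simp: cylindrical_def)
  then show ?thesis by (intro exI[of _ "max 0 (sup_norm_on X f)"]) auto
qed

lemma cylindrical_square_integrable:
  assumes \<mu>: "invariant_prob \<mu>" and f: "cylindrical r f"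
  shows "prob_space.square_integrable \<mu> f"
proof -
  interpret prob_space \<mu> using \<mu> by (rule invariant_prob_prob_space)
  have m: "f \<in> borel_measurable \<mu>" by (rule cylindrical_measurable[OF \<mu> f])
  obtain K where K: "\<And>x. \<bar>f x\<bar> \<le> K" using cylindrical_bounded[OF f] by blast
  have "norm ((f x)\<^sup>2) \<le> K\<^sup>2" for x using K[of x] by (simp add: power2_le_iff_abs_le order_trans[OF abs_ge_zero])
  then have "integrable \<mu> (\<lambda>x. (f x)\<^sup>2)"
    using m by (intro integrable_const_bound[where B = "K\<^sup>2"]) auto
  then show ?thesis using m by (simp add: square_integrable_def)
qed

lemma cylindrical_add: "cylindrical q f \<Longrightarrow> cylindrical r g \<Longrightarrow> cylindrical (max q r) (\<lambda>x. f x + g x)"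
  using cylindrical_mono[of q f "max q r"] cylindrical_mono[of r g "max q r"] by (simp add: cylindrical_def)

lemma cylindrical_scale: "cylindrical r f \<Longrightarrow> cylindrical r (\<lambda>x. c * f x)"
  unfolding cylindrical_def by auto

text \<open>Indicators are handled by \<open>cylinder_approximation\<close>, then simple functions
  by linearity, and the rest by dominated convergence.\<close>

lemma L2_cylindrical_dense:
  assumes \<mu>: "invariant_prob \<mu>" and f: "prob_space.square_integrable \<mu> f" and e: "0 < e"
  shows "\<exists>r g. cylindrical r g \<and> L2_norm \<mu> (\<lambda>x. f x - g x) < e"
proof -
  interpret M: prob_space \<mu> using \<mu> by (rule invariant_prob_prob_space)
  define appr where "appr f \<longleftrightarrow> M.square_integrable f \<and>
    (\<forall>e>0. \<exists>r g. cylindrical r g \<and> L2_norm \<mu> (\<lambda>x. f x - g x) < e)" for f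
  have add: "appr (\<lambda>x. f x + g x)" if f: "appr f" and g: "appr g" for f g
    unfolding appr_def
  proof (intro conjI allI impI)
    show "M.square_integrable (\<lambda>x. f x + g x)" using f g by (simp add: appr_def M.square_integrable_add)
    fix e :: real assume "0 < e"
    then have e2: "0 < e / 2" by simp
    obtain q u where u: "cylindrical q u" "L2_norm \<mu> (\<lambda>x. f x - u x) < e / 2" using f e2 unfolding appr_def by blast
    obtain r v where v: "cylindrical r v" "L2_norm \<mu> (\<lambda>x. g x - v x) < e / 2" using g e2 unfolding appr_def by blast
    have "L2_norm \<mu> (\<lambda>x. (f x - u x) + (g x - v x)) \<le> L2_norm \<mu> (\<lambda>x. f x - u x) + L2_norm \<mu> (\<lambda>x. g x - v x)"
      using f g by (intro M.L2_norm_triangle M.square_integrable_diff cylindrical_square_integrable[OF \<mu> u(1)]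
          cylindrical_square_integrable[OF \<mu> v(1)]) (simp_all add: appr_def)
    then have "L2_norm \<mu> (\<lambda>x. f x + g x - (u x + v x)) < e" using u v by (simp add: algebra_simps)
    then show "\<exists>r h. cylindrical r h \<and> L2_norm \<mu> (\<lambda>x. f x + g x - h x) < e"
      using cylindrical_add[OF u(1) v(1)] by blast
  qed
  have scale: "appr (\<lambda>x. c * f x)" if f: "appr f" for c f
    unfolding appr_def
  proof (intro conjI allI impI)
    show "M.square_integrable (\<lambda>x. c * f x)" using f by (simp add: appr_def M.square_integrable_scale)
    fix e :: real assume "0 < e"
    then have "0 < e / (\<bar>c\<bar> + 1)" by simp
    then obtain r g where g: "cylindrical r g" "L2_norm \<mu> (\<lambda>x. f x - g x) < e / (\<bar>c\<bar> + 1)"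
      using f unfolding appr_def by blast
    have "L2_norm \<mu> (\<lambda>x. c * f x - c * g x) = \<bar>c\<bar> * L2_norm \<mu> (\<lambda>x. f x - g x)"
      using M.L2_norm_scale[of c "\<lambda>x. f x - g x"] by (simp add: right_diff_distrib)
    also have "\<dots> \<le> (\<bar>c\<bar> + 1) * L2_norm \<mu> (\<lambda>x. f x - g x)" by (intro mult_right_mono) auto
    also have "\<dots> < e" using g(2) by (simp add: field_simps)
    finally show "\<exists>r h. cylindrical r h \<and> L2_norm \<mu> (\<lambda>x. c * f x - h x) < e"
      using cylindrical_scale[OF g(1)] by blast
  qed
  have zero: "appr (\<lambda>x. 0)"
    unfolding appr_def by (auto intro!: exI[of _ 0] exI[of _ "\<lambda>x. 0"] simp: cylindrical_def L2_norm_def)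
  have sum: "appr (\<lambda>x. \<Sum>i\<in>I. h i x)" if "finite I" "\<And>i. i \<in> I \<Longrightarrow> appr (h i)" for I :: "real set" and h
    using that by (induction I rule: finite_induct) (auto intro!: add zero)
  have ind: "appr (indicator B)" if B: "B \<in> sets \<mu>" for B
    unfolding appr_def
  proof (intro conjI allI impI)
    have "(\<lambda>x. (indicator B x :: real)\<^sup>2) = indicator B" by (auto simp: indicator_def)
    then show "M.square_integrable (indicator B)"
      unfolding M.square_integrable_def using B by (simp add: M.emeasure_eq_measure)
    fix e :: real assume e: "0 < e"
    have "cylinder_approx \<mu> \<mu> B" by (rule cylinder_approximation[OF \<mu> \<mu> B])
    \<comment> \<open>The squared distance of two indicators is the measure of the symmetric
      difference, hence the square.\<close>
    moreover have "0 < e\<^sup>2" using e by simp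
    ultimately obtain r C where C: "cylinder_set r C" "measure \<mu> (sym_diff B C) < e\<^sup>2"
      unfolding cylinder_approx_def by blast
    have Cs: "sym_diff B C \<in> sets \<mu>" using cylinder_set_sets[OF \<mu> C(1)] B by auto
    have "(L2_norm \<mu> (\<lambda>x. indicator B x - indicator C x))\<^sup>2 = (\<integral>x. indicator (sym_diff B C) x \<partial>\<mu>)"
      unfolding M.L2_norm_power2 by (intro Bochner_Integration.integral_cong) (auto simp: indicator_def)
    also have "\<dots> = measure \<mu> (sym_diff B C)" using Cs sets.sets_into_space[OF Cs] by (simp add: Int_absorb2)
    finally have "(L2_norm \<mu> (\<lambda>x. indicator B x - indicator C x))\<^sup>2 < e\<^sup>2" using C(2) by simp
    then have "L2_norm \<mu> (\<lambda>x. indicator B x - indicator C x) < e" by (rule power2_less_imp_less) (use e in simp)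
    then show "\<exists>r g. cylindrical r g \<and> L2_norm \<mu> (\<lambda>x. indicator B x - g x) < e"
      using cylindrical_indicator_set[OF C(1)] by blast
  qed
  have simple: "\<exists>r g. cylindrical r g \<and> L2_norm \<mu> (\<lambda>x. s x - g x) < e" if s: "simple_function \<mu> s" and e: "0 < e" for s e
  proof -
    \<comment> \<open>The canonical form of \<open>s\<close>, a finite combination of indicators; it
      equals \<open>s\<close> on the space, which is enough for the norm.\<close>
    define s' where "s' x = (\<Sum>y\<in>s ` space \<mu>. y * indicator (s -` {y} \<inter> space \<mu>) x)" for x
    have "appr s'"
      unfolding s'_def using simple_functionD[OF s] by (intro sum scale ind) auto
    then obtain r g where g: "cylindrical r g" "L2_norm \<mu> (\<lambda>x. s' x - g x) < e" using e unfolding appr_def by blast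
    have "s' x = s x" if x: "x \<in> space \<mu>" for x
    proof -
      have "s' x = (\<Sum>y\<in>s ` space \<mu>. if y = s x then y else 0)"
        unfolding s'_def using x by (intro sum.cong) (auto simp: indicator_def)
      then show ?thesis using x simple_functionD(1)[OF s] by simp
    qed
    then have "L2_norm \<mu> (\<lambda>x. s x - g x) = L2_norm \<mu> (\<lambda>x. s' x - g x)" by (intro M.L2_norm_cong) simp
    then show ?thesis using g by metis
  qed
  have fm: "f \<in> borel_measurable \<mu>" and fi: "integrable \<mu> (\<lambda>x. (f x)\<^sup>2)"
    using f by (auto simp: M.square_integrable_def)
  obtain S where "(\<forall>i. simple_function \<mu> (S i)) \<and> (\<forall>x\<in>space \<mu>. (\<lambda>i. S i x) \<longlonglongrightarrow> f x) \<and>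
      (\<forall>i. \<forall>x\<in>space \<mu>. dist (S i x) 0 \<le> 2 * dist (f x) 0)"
    using borel_measurable_implies_sequence_metric[OF fm, of 0] ..
  then have S: "simple_function \<mu> (S i)" "x \<in> space \<mu> \<Longrightarrow> (\<lambda>i. S i x) \<longlonglongrightarrow> f x"
    "x \<in> space \<mu> \<Longrightarrow> \<bar>S i x\<bar> \<le> 2 * \<bar>f x\<bar>" for i x
    by (auto simp: dist_real_def)
  have Sm: "S i \<in> borel_measurable \<mu>" for i using S(1) by (rule borel_measurable_simple_function)
  have "(\<lambda>i. \<integral>x. (f x - S i x)\<^sup>2 \<partial>\<mu>) \<longlonglongrightarrow> (\<integral>x. 0 \<partial>\<mu>)"
  \<comment> \<open>The bound \<open>2 * \<bar>f x\<bar>\<close> for the simple functions gives a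
    difference of at most \<open>3 * \<bar>f x\<bar>\<close>, and 9 is the square of 3.\<close>
  proof (rule integral_dominated_convergence[where w = "\<lambda>x. 9 * (f x)\<^sup>2"])
    show "integrable \<mu> (\<lambda>x. 9 * (f x)\<^sup>2)" using fi by simp
    show "(\<lambda>x. (f x - S i x)\<^sup>2) \<in> borel_measurable \<mu>" for i
      by (intro borel_measurable_power borel_measurable_diff fm Sm)
    show "AE x in \<mu>. (\<lambda>i. (f x - S i x)\<^sup>2) \<longlonglongrightarrow> 0"
    proof (rule AE_I2)
      fix x assume "x \<in> space \<mu>"
      from S(2)[OF this] have "(\<lambda>i. (f x - S i x)\<^sup>2) \<longlonglongrightarrow> (f x - f x)\<^sup>2" by (intro tendsto_intros)
      then show "(\<lambda>i. (f x - S i x)\<^sup>2) \<longlonglongrightarrow> 0" by simp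
    qed
    show "AE x in \<mu>. norm ((f x - S i x)\<^sup>2) \<le> 9 * (f x)\<^sup>2" for i
    proof (rule AE_I2)
      fix x assume "x \<in> space \<mu>"
      from S(3)[OF this, of i] have "\<bar>f x - S i x\<bar> \<le> 3 * \<bar>f x\<bar>" by linarith
      then have "\<bar>f x - S i x\<bar>\<^sup>2 \<le> (3 * \<bar>f x\<bar>)\<^sup>2" by (rule power_mono) simp
      then show "norm ((f x - S i x)\<^sup>2) \<le> 9 * (f x)\<^sup>2" by (simp add: power_mult_distrib)
    qed
  qed simp
  then have "(\<lambda>i. L2_norm \<mu> (\<lambda>x. f x - S i x)) \<longlonglongrightarrow> sqrt 0"
    unfolding L2_norm_def by (intro tendsto_real_sqrt) simp
  then have "\<forall>\<^sub>F i in sequentially. L2_norm \<mu> (\<lambda>x. f x - S i x) < e / 2"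
    using e by (intro order_tendstoD(2)) auto
  then obtain i where i: "L2_norm \<mu> (\<lambda>x. f x - S i x) < e / 2"
    unfolding eventually_sequentially by blast
  have "0 < e / 2" using e by simp
  from simple[OF S(1) this] obtain r g where g: "cylindrical r g" "L2_norm \<mu> (\<lambda>x. S i x - g x) < e / 2" by blast
  have le: "(S i x)\<^sup>2 \<le> 4 * (f x)\<^sup>2" if "x \<in> space \<mu>" for x
  proof -
    have "\<bar>S i x\<bar>\<^sup>2 \<le> (2 * \<bar>f x\<bar>)\<^sup>2" using S(3)[OF that] by (intro power_mono) auto
    then show ?thesis by (simp add: power_mult_distrib)
  qed
  have "integrable \<mu> (\<lambda>x. (S i x)\<^sup>2)"
  proof (rule Bochner_Integration.integrable_bound)
    show "integrable \<mu> (\<lambda>x. 4 * (f x)\<^sup>2)" using fi by simp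
    show "(\<lambda>x. (S i x)\<^sup>2) \<in> borel_measurable \<mu>" using Sm by (rule borel_measurable_power)
    show "AE x in \<mu>. norm ((S i x)\<^sup>2) \<le> norm (4 * (f x)\<^sup>2)" using le by (intro AE_I2) simp
  qed
  then have Si: "M.square_integrable (S i)" using Sm by (simp add: M.square_integrable_def)
  have "L2_norm \<mu> (\<lambda>x. (f x - S i x) + (S i x - g x)) \<le> L2_norm \<mu> (\<lambda>x. f x - S i x) + L2_norm \<mu> (\<lambda>x. S i x - g x)"
    by (intro M.L2_norm_triangle M.square_integrable_diff f Si cylindrical_square_integrable[OF \<mu> g(1)])
  then have "L2_norm \<mu> (\<lambda>x. f x - g x) < e" using i g(2) by simp
  then show ?thesis using g(1) by blast
qed

lemma integral_shift_by:
  assumes \<mu>: "invariant_prob \<mu>" and f: "f \<in> borel_measurable \<mu>"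
  shows "(\<integral>x. f (shift_by i x) \<partial>\<mu>) = (\<integral>x. (f x :: real) \<partial>\<mu>)"
  using integral_distr[OF shift_by_measurable[OF \<mu>] f, of i] shift_by_distr[OF \<mu>, of i] by simp

lemma isometric_L20_space:
  assumes "\<mu> \<in> ergodic_measures X"
  shows "isometric_bijection (L20_space \<mu>) (L2_norm \<mu>) koopman"
proof -
  interpret M: prob_space \<mu> using assms by (intro invariant_prob_prob_space ergodic_invariant_prob)
  note K = koopman_bij_betw_L20_space[OF shift_X assms]
  show ?thesis
  proof (rule isometric_bijection.intro)
    show "subspace (L20_space \<mu>)"
    proof (rule subspaceI)
      show "0 \<in> L20_space \<mu>" by (simp add: M.L20_space_iff zero_fun_def)
    next
      fix f g assume "f \<in> L20_space \<mu>" "g \<in> L20_space \<mu>"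
      then show "f + g \<in> L20_space \<mu>"
        by (simp add: M.L20_space_iff plus_fun_def M.square_integrable_add M.square_integrable_integrable)
    next
      fix c f assume "f \<in> L20_space \<mu>"
      then show "c *\<^sub>R f \<in> L20_space \<mu>"
        by (simp add: M.L20_space_iff scaleR_fun_def M.square_integrable_scale)
    qed
    show "bij_betw koopman (L20_space \<mu>) (L20_space \<mu>)" by (rule K(1))
    show "linear koopman" by (rule linear_koopman)
  next
    fix f g assume "f \<in> L20_space \<mu>" "g \<in> L20_space \<mu>"
    then show "L2_norm \<mu> (f + g) \<le> L2_norm \<mu> f + L2_norm \<mu> g"
      using M.L2_norm_triangle[of f g] by (simp add: M.L20_space_iff plus_fun_def)
  next
    fix c f assume "f \<in> L20_space \<mu>"
    then show "L2_norm \<mu> (c *\<^sub>R f) = \<bar>c\<bar> * L2_norm \<mu> f"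
      using M.L2_norm_scale[of c f] by (simp add: scaleR_fun_def)
  next
    fix f assume "f \<in> L20_space \<mu>"
    then show "L2_norm \<mu> (koopman f) = L2_norm \<mu> f" by (rule K(2))
  qed
qed

text \<open>The projection onto mean-zero functions. Neither cylinder indicators nor column bases
  need to have mean 0, so they are projected before they serve as generators.\<close>

definition centered :: "(int \<Rightarrow> 'a) measure \<Rightarrow> ((int \<Rightarrow> 'a) \<Rightarrow> real) \<Rightarrow> (int \<Rightarrow> 'a) \<Rightarrow> real" where
  "centered \<mu> f = (\<lambda>x. f x - (\<integral>x. f x \<partial>\<mu>))"

lemma centered_in_L20_space:
  assumes "prob_space \<mu>" "prob_space.square_integrable \<mu> f"
  shows "centered \<mu> f \<in> L20_space \<mu>"
proof -
  interpret M: prob_space \<mu> by fact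
  show ?thesis
    using M.square_integrable_diff[OF assms(2) M.square_integrable_const] M.square_integrable_integrable[OF assms(2)]
    by (simp add: M.L20_space_iff centered_def M.prob_space)
qed

text \<open>As \<open>f\<close> has mean 0, the left-hand function is the centred difference of
  \<open>f\<close> and \<open>g\<close>, and centring does not increase the norm.\<close>

lemma L2_norm_diff_centered_le:
  assumes "prob_space \<mu>" "f \<in> L20_space \<mu>" "prob_space.square_integrable \<mu> g"
  shows "L2_norm \<mu> (f - centered \<mu> g) \<le> L2_norm \<mu> (\<lambda>x. f x - g x)"
proof -
  interpret M: prob_space \<mu> by fact
  have f: "M.square_integrable f" "(\<integral>x. f x \<partial>\<mu>) = 0" using assms(2) by (auto simp: M.L20_space_iff)
  have "f - centered \<mu> g = (\<lambda>x. (f x - g x) - (\<integral>x. f x - g x \<partial>\<mu>))"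
    using f M.square_integrable_integrable[OF f(1)] M.square_integrable_integrable[OF assms(3)]
    by (simp add: centered_def fun_eq_iff)
  then show ?thesis using M.L2_norm_centered[OF M.square_integrable_diff[OF f(1) assms(3)]] by simp
qed

text \<open>Replacing a function by 0 outside the heavy columns of a measure costs little in
  \<open>L\<^sup>2\<close>, so only the bases of these columns are needed as generators.\<close>

lemma ergodic_mult_le:
  assumes \<mu>e: "\<mu> \<in> ergodic_measures X"
    and heavy: "\<And>N d. 0 < d \<Longrightarrow> \<exists>n\<ge>N. \<exists>S\<subseteq>branches n. card S \<le> m \<and>
      (\<Sum>e\<in>branches n - S. measure \<mu> (column n e)) < d"
  shows "ergodic_mult \<mu> \<le> enat m"
proof -
  have \<mu>: "invariant_prob \<mu>" using \<mu>e by (rule ergodic_invariant_prob)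
  interpret M: prob_space \<mu> using \<mu> by (rule invariant_prob_prob_space)
  interpret L: isometric_bijection "L20_space \<mu>" "L2_norm \<mu>" koopman by (rule isometric_L20_space[OF \<mu>e])
  have V: "L.V n f = f \<circ> shift_by n" if "f \<in> L20_space \<mu>" for n f
    by (rule int_pow_koopman[OF koopman_bij_betw_L20_space(1)[OF shift_X \<mu>e] that])
  note sq = cylindrical_square_integrable[OF \<mu>]
  note cen = centered_in_L20_space[OF M.prob_space_axioms]
  have "L.approximable m"
    unfolding L.approximable_def
  proof (intro allI impI)
    fix G and \<epsilon> :: real assume G: "finite G" "G \<subseteq> L20_space \<mu>" and \<epsilon>: "0 < \<epsilon>"
    then have \<epsilon>2: "0 < \<epsilon> / 2" by simp
    \<comment> \<open>Radius, approximant and bound are packed into a triple so that all three can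
      be chosen at once for each \<open>g\<close>.\<close>
    define Q where "Q g t \<longleftrightarrow> (case t of (r, \<phi>, K) \<Rightarrow>
      cylindrical r \<phi> \<and> L2_norm \<mu> (\<lambda>x. g x - \<phi> x) < \<epsilon> / 2 \<and> 0 \<le> K \<and> (\<forall>x. \<bar>\<phi> x\<bar> \<le> K))" for g and t :: "nat \<times> ((int \<Rightarrow> 'a) \<Rightarrow> real) \<times> real"
    have "\<exists>t. Q g t" if "g \<in> G" for g
    proof -
      have "M.square_integrable g" using that G by (auto simp: M.L20_space_iff)
      then obtain r \<phi> where "cylindrical r \<phi>" "L2_norm \<mu> (\<lambda>x. g x - \<phi> x) < \<epsilon> / 2"
        using L2_cylindrical_dense[OF \<mu> _ \<epsilon>2] by blast
      moreover from this(1) obtain K where "0 \<le> K" "\<forall>x. \<bar>\<phi> x\<bar> \<le> K" using cylindrical_bounded by blast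
      ultimately have "Q g (r, \<phi>, K)" by (simp add: Q_def)
      then show ?thesis ..
    qed
    then obtain t where t: "\<And>g. g \<in> G \<Longrightarrow> Q g (t g)" by metis
    define q where "q g = fst (t g)" for g
    define \<phi> where "\<phi> g = fst (snd (t g))" for g
    define k where "k g = snd (snd (t g))" for g
    have \<phi>: "cylindrical (q g) (\<phi> g)" "L2_norm \<mu> (\<lambda>x. g x - \<phi> g x) < \<epsilon> / 2" "0 \<le> k g" "\<bar>\<phi> g x\<bar> \<le> k g"
      if "g \<in> G" for g x
      using t[OF that] by (auto simp: Q_def q_def \<phi>_def k_def split: prod.splits)
    define r where "r = (\<Sum>g\<in>G. q g)"
    \<comment> \<open>Adding 1 keeps \<open>K\<close> positive, also for empty
      \<open>G\<close>.\<close>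
    define K where "K = (\<Sum>g\<in>G. k g) + 1"
    have cyl: "cylindrical r (\<phi> g)" if g: "g \<in> G" for g
    proof (rule cylindrical_mono[OF \<phi>(1)[OF g]])
      show "q g \<le> r" unfolding r_def using g G by (intro member_le_sum) auto
    qed
    have K: "0 < K" unfolding K_def using \<phi>(3) by (intro add_nonneg_pos sum_nonneg) auto
    have bound: "\<bar>\<phi> g x\<bar> \<le> K" if g: "g \<in> G" for g x
    proof -
      have "k g \<le> (\<Sum>g\<in>G. k g)" using g G \<phi>(3) by (intro member_le_sum) auto
      then show ?thesis using \<phi>(4)[OF g, of x] by (simp add: K_def)
    qed
    \<comment> \<open>Chosen so that \<open>K\<^sup>2 * d\<close> is
      \<open>(\<epsilon> / 2)\<^sup>2\<close>, the admissible squared error on the discarded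
      columns.\<close>
    define d where "d = (\<epsilon> / (2 * K))\<^sup>2"
    have d: "0 < d" using \<epsilon> K by (simp add: d_def)
    obtain n S where n: "2 * r + 1 \<le> n" "S \<subseteq> branches n" "card S \<le> m"
      "(\<Sum>e\<in>branches n - S. measure \<mu> (column n e)) < d" using heavy[OF d] by blast
    have finS: "finite S" using n(2) finite_branches finite_subset by blast
    define F where "F = (\<lambda>e. centered \<mu> (branch_base n e)) ` S"
    have bb: "M.square_integrable (branch_base n e)" for e by (rule sq[OF branch_base_cylindrical])
    have F: "F \<subseteq> L20_space \<mu>" using cen[OF bb] by (auto simp: F_def)
    \<comment> \<open>The points lost by discarding columns; they are shifted by \<open>r\<close>
      because the representation of a cylindrical function is.\<close>
    define bad where "bad = {x \<in> X. shift_by (- int r) x \<in> (\<Union>e\<in>branches n - S. column n e)}"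
    have cols: "(\<Union>e\<in>branches n - S. column n e) \<in> sets \<mu>"
      using finite_branches column_sets[OF \<mu>] by (intro sets.finite_UN) auto
    have bad: "bad \<in> sets \<mu>" "measure \<mu> bad < d"
    proof -
      show "bad \<in> sets \<mu>" unfolding bad_def by (rule measure_shift_by_vimage(1)[OF \<mu> cols])
      have "measure \<mu> bad = measure \<mu> (\<Union>e\<in>branches n - S. column n e)"
        unfolding bad_def by (rule measure_shift_by_vimage(2)[OF \<mu> cols])
      also have "\<dots> \<le> (\<Sum>e\<in>branches n - S. measure \<mu> (column n e))"
        using finite_branches column_sets[OF \<mu>] by (intro measure_UNION_le) auto
      finally show "measure \<mu> bad < d" using n(4) by simp
    qed
    have "\<exists>h\<in>L.orbit_span F. L2_norm \<mu> (g - h) < \<epsilon>" if g: "g \<in> G" for g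
    proof -
      have gL: "g \<in> L20_space \<mu>" "M.square_integrable g" using g G by (auto simp: M.L20_space_iff)
      define h where "h x = (if x \<in> X \<and> branch n (shift_by (- int r) x) \<in> S then \<phi> g x else 0)" for x
      obtain c where c: "\<And>x. h x = (\<Sum>e\<in>S. \<Sum>s\<le>card (language n). c e s * branch_base n e (shift_by (- int s - int r) x))"
        using cylindrical_representation[OF cyl[OF g] n(1,2)] unfolding h_def by blast
      have bbsh: "integrable \<mu> (\<lambda>x. branch_base n e (shift_by i x))" for e i
        using integrable_distr_eq[OF shift_by_measurable[OF \<mu>] M.square_integrable_measurable[OF bb], of i e]
          M.square_integrable_integrable[OF bb] by (simp add: shift_by_distr[OF \<mu>])
      have hm: "h \<in> borel_measurable \<mu>"
        unfolding c[abs_def] using bbsh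
        by (intro borel_measurable_sum borel_measurable_times borel_measurable_const) (rule borel_measurable_integrable)
      have hK: "(h x)\<^sup>2 \<le> K\<^sup>2" for x
        using bound[OF g, of x] K by (simp add: h_def power2_le_iff_abs_le)
      have hs: "M.square_integrable h"
        unfolding M.square_integrable_def using hm hK
        by (auto intro!: M.integrable_const_bound[where B = "K\<^sup>2"])
      have inth: "(\<integral>x. h x \<partial>\<mu>) = (\<Sum>e\<in>S. \<Sum>s\<le>card (language n). c e s * (\<integral>x. branch_base n e x \<partial>\<mu>))"
        unfolding c using bbsh by (simp add: integral_shift_by[OF \<mu> M.square_integrable_measurable[OF bb]])
      \<comment> \<open>Integrals are invariant under shifts, so centring commutes with them and the
        representation of \<open>h\<close> passes to the centred bases.\<close>
      have "centered \<mu> h = (\<Sum>e\<in>S. \<Sum>s\<le>card (language n). c e s *\<^sub>R L.V (- int s - int r) (centered \<mu> (branch_base n e)))"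
      proof
        fix x
        show "centered \<mu> h x = (\<Sum>e\<in>S. \<Sum>s\<le>card (language n). c e s *\<^sub>R L.V (- int s - int r) (centered \<mu> (branch_base n e))) x"
          unfolding sum_fun_apply scaleR_fun_def V[OF cen[OF bb]]
          unfolding centered_def inth unfolding c
          by (simp add: sum_subtractf right_diff_distrib)
      qed
      also have "\<dots> \<in> L.orbit_span F"
        by (intro subspace_sum[OF L.subspace_Z] subspace_scale[OF L.subspace_Z] L.orbit_span_base) (auto simp: F_def)
      finally have "centered \<mu> h \<in> L.orbit_span F" .
      moreover have "L2_norm \<mu> (g - centered \<mu> h) < \<epsilon>"
      proof -
        have "\<phi> g x - h x = indicator bad x * \<phi> g x" for x
          using cyl[OF g] branch_in[of "shift_by (- int r) x" n]
          by (auto simp: h_def bad_def column_def cylindrical_def indicator_def)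
        moreover have "(indicator bad x * \<phi> g x)\<^sup>2 \<le> K\<^sup>2 * indicator bad x" for x
          using bound[OF g, of x] K by (simp add: indicator_def power2_le_iff_abs_le)
        ultimately have "(\<phi> g x - h x)\<^sup>2 \<le> K\<^sup>2 * indicator bad x" for x by simp
        moreover have "integrable \<mu> (\<lambda>x. (\<phi> g x - h x)\<^sup>2)"
          using M.square_integrable_diff[OF sq[OF cyl[OF g]] hs] by (simp add: M.square_integrable_def)
        moreover have "integrable \<mu> (\<lambda>x. K\<^sup>2 * indicator bad x)"
          using bad(1) by (intro integrable_mult_right) (simp add: M.emeasure_eq_measure)
        ultimately have "(L2_norm \<mu> (\<lambda>x. \<phi> g x - h x))\<^sup>2 \<le> (\<integral>x. K\<^sup>2 * indicator bad x \<partial>\<mu>)"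
          unfolding M.L2_norm_power2 by (intro integral_mono)
        also have "\<dots> = K\<^sup>2 * measure \<mu> bad" using bad(1) sets.sets_into_space[OF bad(1)] by (simp add: Int_absorb2)
        also have "\<dots> \<le> K\<^sup>2 * d" using bad(2) by (intro mult_left_mono) auto
        also have "\<dots> = (\<epsilon> / 2)\<^sup>2" using K by (simp add: d_def power_divide power_mult_distrib)
        finally have "L2_norm \<mu> (\<lambda>x. \<phi> g x - h x) \<le> \<epsilon> / 2" by (rule power2_le_imp_le) (use \<epsilon> in simp)
        moreover have "L2_norm \<mu> (\<lambda>x. (g x - \<phi> g x) + (\<phi> g x - h x)) \<le> L2_norm \<mu> (\<lambda>x. g x - \<phi> g x) + L2_norm \<mu> (\<lambda>x. \<phi> g x - h x)"
          by (intro M.L2_norm_triangle M.square_integrable_diff gL(2) sq[OF cyl[OF g]] hs)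
        moreover have "L2_norm \<mu> (g - centered \<mu> h) \<le> L2_norm \<mu> (\<lambda>x. g x - h x)"
          by (rule L2_norm_diff_centered_le[OF M.prob_space_axioms gL(1) hs])
        ultimately show ?thesis using \<phi>(2)[OF g] by simp
      qed
      ultimately show ?thesis by blast
    qed
    moreover have "card F \<le> m" using card_image_le[OF finS] n(3) unfolding F_def by (rule le_trans)
    ultimately show "\<exists>F. finite F \<and> F \<subseteq> L20_space \<mu> \<and> card F \<le> m \<and> (\<forall>g\<in>G. \<exists>h\<in>L.orbit_span F. L2_norm \<mu> (g - h) < \<epsilon>)"
      using F finS by (intro exI[of _ F]) (auto simp: F_def)
  qed
  moreover
  define g where "g n = centered \<mu> (from_nat_into cylinder_indicators n)" for n
  have cyl_ind: "range (from_nat_into cylinder_indicators) = cylinder_indicators"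
    using countable_cylinder_indicators cylinder_indicators_ne by (rule range_from_nat_into[rotated])
  have gL: "g n \<in> L20_space \<mu>" for n
  proof -
    have "from_nat_into cylinder_indicators n \<in> cylinder_indicators" using cyl_ind by blast
    then show ?thesis using cylindrical_indicator sq cen unfolding g_def by blast
  qed
  moreover have "\<exists>h\<in>span (range g). L2_norm \<mu> (f - h) < e" if f: "f \<in> L20_space \<mu>" and e: "0 < e" for f e
  proof -
    have fs: "M.square_integrable f" using f by (simp add: M.L20_space_iff)
    obtain r \<phi> where \<phi>: "cylindrical r \<phi>" "L2_norm \<mu> (\<lambda>x. f x - \<phi> x) < e" using L2_cylindrical_dense[OF \<mu> fs e] by blast
    \<comment> \<open>Centring is linear on square integrable functions, so it maps the span of the
      indicators into the span of the centred indicators.\<close>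
    have "span cylinder_indicators \<subseteq> {u. M.square_integrable u \<and> centered \<mu> u \<in> span (range g)}"
    proof (rule span_minimal)
      show "cylinder_indicators \<subseteq> {u. M.square_integrable u \<and> centered \<mu> u \<in> span (range g)}"
      proof safe
        fix u assume u: "u \<in> cylinder_indicators"
        then show "M.square_integrable u" using cylindrical_indicator sq by blast
        show "centered \<mu> u \<in> span (range g)"
        proof -
          obtain j where "u = from_nat_into cylinder_indicators j" using u cyl_ind by (metis imageE)
          then have "centered \<mu> u = g j" by (simp add: g_def)
          then show ?thesis by (simp add: span_base)
        qed
      qed
      show "subspace {u. M.square_integrable u \<and> centered \<mu> u \<in> span (range g)}"
      proof (rule subspaceI)
        have "centered \<mu> 0 = 0" by (simp add: centered_def fun_eq_iff)
        then show "0 \<in> {u. M.square_integrable u \<and> centered \<mu> u \<in> span (range g)}"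
          by (simp add: span_zero) (simp add: zero_fun_def)
      next
        fix u v assume uv: "u \<in> {u. M.square_integrable u \<and> centered \<mu> u \<in> span (range g)}"
          "v \<in> {u. M.square_integrable u \<and> centered \<mu> u \<in> span (range g)}"
        then have "centered \<mu> (u + v) = centered \<mu> u + centered \<mu> v"
          by (simp add: centered_def fun_eq_iff M.square_integrable_integrable)
        then show "u + v \<in> {u. M.square_integrable u \<and> centered \<mu> u \<in> span (range g)}"
          using uv by (simp add: span_add) (simp add: plus_fun_def M.square_integrable_add)
      next
        fix c u assume u: "u \<in> {u. M.square_integrable u \<and> centered \<mu> u \<in> span (range g)}"
        then have "centered \<mu> (c *\<^sub>R u) = c *\<^sub>R centered \<mu> u"
          by (simp add: centered_def fun_eq_iff scaleR_fun_def right_diff_distrib)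
        then show "c *\<^sub>R u \<in> {u. M.square_integrable u \<and> centered \<mu> u \<in> span (range g)}"
          using u by (simp add: span_scale) (simp add: scaleR_fun_def M.square_integrable_scale)
      qed
    qed
    then have "centered \<mu> \<phi> \<in> span (range g)" using cylindrical_in_span[OF \<phi>(1)] by blast
    moreover have "L2_norm \<mu> (f - centered \<mu> \<phi>) < e"
      using L2_norm_diff_centered_le[OF M.prob_space_axioms f sq[OF \<phi>(1)]] \<phi>(2) by simp
    ultimately show ?thesis by blast
  qed
  ultimately show ?thesis
    unfolding ergodic_mult_def by (intro L.multiplicity_le[where g = g] M.L20_complete) simp_all
qed

text \<open>Once the measures are separated, the sets of columns heavy for different measures are
  disjoint subsets of \<open>branches\<close>, so their sizes add up to at most
  \<open>2 * k\<close>. The light columns of a measure have small total mass, as their number is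
  bounded too.\<close>

lemma sum_ergodic_mult_le:
  assumes k: "liminf (\<lambda>n. ereal (real (word_complexity X n) / real n)) \<le> ereal (real k)"
    and E: "finite E" "E \<subseteq> ergodic_measures X"
  shows "(\<Sum>\<mu>\<in>E. ergodic_mult \<mu>) \<le> enat (2 * k)"
proof -
  define a where "a l = 1 / real (Suc l)" for l
  have a: "0 < a l" for l by (simp add: a_def)
  define apart where "apart l n \<longleftrightarrow> (\<forall>\<mu>\<in>E. \<forall>\<nu>\<in>E. \<mu> \<noteq> \<nu> \<longrightarrow>
      (\<forall>e. measure \<mu> (column n e) < a l \<or> measure \<nu> (column n e) < a l))" for l n
  have "\<exists>n\<ge>l. card (branches n) \<le> 2 * k \<and> apart l n" for l
  proof -
    have "\<forall>\<^sub>F n in sequentially. apart l n"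
      unfolding apart_def
    proof (intro eventually_ball_finite ballI E(1))
      fix \<mu> \<nu> assume \<mu>\<nu>: "\<mu> \<in> E" "\<nu> \<in> E"
      show "\<forall>\<^sub>F n in sequentially. \<mu> \<noteq> \<nu> \<longrightarrow> (\<forall>e. measure \<mu> (column n e) < a l \<or> measure \<nu> (column n e) < a l)"
      proof (cases "\<mu> = \<nu>")
        case False
        have "\<forall>\<^sub>F n in sequentially. \<forall>e. measure \<mu> (column n e) < a l \<or> measure \<nu> (column n e) < a l"
          using \<mu>\<nu> E(2) by (intro ergodic_columns_disjoint[OF _ _ False a]) auto
        then show ?thesis by (rule eventually_mono) simp
      qed simp
    qed
    then obtain N where "\<And>n. n \<ge> N \<Longrightarrow> apart l n"
      unfolding eventually_sequentially by blast
    then show ?thesis using frequently_few_branches[OF k, of "max N l"] by auto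
  qed
  then obtain n where n: "\<And>l. l \<le> n l" "\<And>l. card (branches (n l)) \<le> 2 * k" "\<And>l. apart l (n l)"
    by metis
  define S where "S l \<mu> = {e \<in> branches (n l). a l \<le> measure \<mu> (column (n l) e)}" for l \<mu>
  have S_sub: "S l \<mu> \<subseteq> branches (n l)" for l \<mu> by (auto simp: S_def)
  have finS: "finite (S l \<mu>)" for l \<mu> using S_sub finite_branches finite_subset by blast
  have sum_S: "(\<Sum>\<mu>\<in>E. card (S l \<mu>)) \<le> 2 * k" for l
  proof -
    have "S l \<mu> \<inter> S l \<nu> = {}" if "\<mu> \<in> E" "\<nu> \<in> E" "\<mu> \<noteq> \<nu>" for \<mu> \<nu>
    proof -
      have "\<not> (a l \<le> measure \<mu> (column (n l) e) \<and> a l \<le> measure \<nu> (column (n l) e))" for e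
        using n(3)[of l] that unfolding apart_def by (meson not_le)
      then show ?thesis unfolding S_def by blast
    qed
    then have "(\<Sum>\<mu>\<in>E. card (S l \<mu>)) = card (\<Union>\<mu>\<in>E. S l \<mu>)"
      using E(1) finS by (intro card_UN_disjoint[symmetric]) auto
    also have "\<dots> \<le> card (branches (n l))"
      using S_sub by (intro card_mono finite_branches) auto
    finally show ?thesis using n(2)[of l] by simp
  qed
  \<comment> \<open>The restriction to \<open>E\<close> makes the vector of counts an element of a
    finite function space. Some vector recurs for infinitely many \<open>l\<close>, that is, with
    thresholds tending to 0.\<close>
  define v where "v l = restrict (\<lambda>\<mu>. card (S l \<mu>)) E" for l
  have "card (S l \<mu>) \<le> 2 * k" for l \<mu>
    using card_mono[OF finite_branches S_sub] n(2)[of l] le_trans by blast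
  then have "range v \<subseteq> E \<rightarrow>\<^sub>E {..2 * k}" by (auto simp: v_def)
  then have "finite (range v)" using E(1) finite_subset finite_PiE by (metis finite_atMost)
  then obtain l0 where "infinite {l \<in> UNIV. v l = v l0}"
    using pigeonhole_infinite[OF infinite_UNIV_nat, of v] by blast
  then have inf: "\<exists>l\<ge>N. v l = v l0" for N by (auto simp: infinite_nat_iff_unbounded_le)
  have "ergodic_mult \<mu> \<le> enat (card (S l0 \<mu>))" if \<mu>: "\<mu> \<in> E" for \<mu>
  proof (rule ergodic_mult_le)
    show "\<mu> \<in> ergodic_measures X" using \<mu> E(2) by blast
    fix N :: nat and d :: real assume d: "0 < d"
    \<comment> \<open>At most \<open>2 * k\<close> light columns, each of mass below
      \<open>a l\<close>, have total mass below \<open>d\<close> once \<open>l\<close> reaches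
      \<open>N'\<close>.\<close>
    obtain N' where N': "real (2 * k) / d < real N'" using reals_Archimedean2 by blast
    obtain l where l: "l \<ge> max N N'" "v l = v l0" using inf by blast
    have "card (S l \<mu>) = card (S l0 \<mu>)" using fun_cong[OF l(2), of \<mu>] \<mu> by (simp add: v_def)
    moreover have "(\<Sum>e\<in>branches (n l) - S l \<mu>. measure \<mu> (column (n l) e)) < d"
    proof -
      have "(\<Sum>e\<in>branches (n l) - S l \<mu>. measure \<mu> (column (n l) e)) \<le> (\<Sum>e\<in>branches (n l) - S l \<mu>. a l)"
        by (intro sum_mono) (auto simp: S_def)
      also have "\<dots> \<le> (\<Sum>e\<in>branches (n l). a l)"
        using finite_branches a by (intro sum_mono2) (auto intro: less_imp_le)
      also have "\<dots> \<le> real (2 * k) * a l"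
        using n(2)[of l] a[of l] by (simp del: of_nat_mult)
      also have "\<dots> < d"
      proof -
        have "real (2 * k) < d * real N'" using N' d by (simp add: field_simps)
        also have "\<dots> \<le> d * real (Suc l)" using l(1) d by (intro mult_left_mono) auto
        finally show ?thesis by (simp add: a_def field_simps)
      qed
      finally show ?thesis .
    qed
    ultimately show "\<exists>n\<ge>N. \<exists>T\<subseteq>branches n. card T \<le> card (S l0 \<mu>) \<and> (\<Sum>e\<in>branches n - T. measure \<mu> (column n e)) < d"
      using S_sub n(1)[of l] l(1) by (intro exI[of _ "n l"] conjI exI[of _ "S l \<mu>"]) auto
  qed
  then have "(\<Sum>\<mu>\<in>E. ergodic_mult \<mu>) \<le> (\<Sum>\<mu>\<in>E. enat (card (S l0 \<mu>)))" by (rule sum_mono)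
  also have "\<dots> = enat (\<Sum>\<mu>\<in>E. card (S l0 \<mu>))" by (simp add: of_nat_eq_enat[symmetric])
  also have "\<dots> \<le> enat (2 * k)" using sum_S by simp
  finally show ?thesis .
qed

end

theorem mainTheorem2:
  fixes A :: "'a::discrete_topology set" and X :: "(int \<Rightarrow> 'a) set" and k :: nat
  assumes "finite A" and "subshift A X" and "aperiodic X"
    and "liminf (\<lambda>n. ereal (real (word_complexity X n) / real n)) \<le> ereal (real k)"
  shows "top_mult X \<le> enat (2 * k) \<and>
         (\<Sum>\<^sub>\<infinity>\<mu>\<in>ergodic_measures X. ergodic_mult \<mu>) \<le> enat (2 * k)"
proof -
  interpret aperiodic_subshift A X using assms by unfold_locales
  \<comment> \<open>The infinite sum is the supremum of its finite partial sums, so the bound for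
    finite sets of measures suffices.\<close>
  show ?thesis
    using top_mult_le[OF assms(4)] sum_ergodic_mult_le[OF assms(4)]
    by (auto simp: infsum_enat_eq_SUP intro!: SUP_least)
qed

end
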